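(* Let $A,B,C,D$ be complex numbers with strictly positive real parts such that ($A,B$ are both real or $A=\bar B$) and ($C,D$ are both real or $C=\bar D$), labelled so that $\Re(A)\le\Re(B)$ and $\Re(C)\le\Re(D)$. Let $T=(-\Re(C),\Re(A))$. For $t\in T$ and $x>0$ put $$f_t(x)=f(x;A-t,B-t,C+t,D+t),$$ and for $s<t$ in $T$ and $x,y>0$ put $$f_{s,t}(y|x)=f\left(y;A-t,B-t,t-s+i\sqrt{x},t-s-i\sqrt{x}\right),$$ where $f(\cdot\,;a,b,c,d)$ is the density on $(0,\infty)$ defined in the context. Then the following hold. (1) There is a Markov process $(Y_t)_{t\in T}$ with state space $(0,\infty)$ such that $Y_t$ has density $f_t$ for every $t\in T$, and for all $s<t$ in $T$ the conditional law of $Y_t$ given $Y_s=x$ has density $y\mapsto f_{s,t}(y|x)$. (2) $\mathbb{E}(Y_0)=\dfrac{ABC+ABD+ACD+BCD}{A+B+C+D}$, and for $t\in T$ $$\mathbb{E}(Y_t)=\mathbb{E}(Y_0)+2\,\frac{AB-CD}{A+B+C+D}\,t-t^2 .$$ (3) For $s\le t$ in $T$, $\mathrm{Cov}(Y_s,Y_t)=M^2(C+D+2s)(A+B-2t)$, where $$M^2=\frac{(A+C)(B+C)(A+D)(B+D)}{(A+B+C+D)^2(A+B+C+D+1)}>0 .$$ (4) Let $\widetilde Y_t=Y_{t/2}+t^2/4$ for $-2\Re(C)<t<2\Re(A)$. Then, with $\alpha=\mathbb{E}(Y_0)$ and $\beta=\frac{AB-CD}{A+B+C+D}$, $\mathbb{E}(\widetilde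 Y_t)=\alpha+\beta t$, and for $s\le t$ in $(-2\Re(C),2\Re(A))$ one has $\mathrm{Cov}(\widetilde Y_s,\widetilde Y_t)=M^2(C+D+s)(A+B-t)$ and $$\mathbb{E}(\widetilde Y_t|\widetilde Y_s)=\frac{A+B-t}{A+B-s}\widetilde Y_s+\frac{AB(t-s)}{A+B-s},$$ $$\mathrm{Var}(\widetilde Y_t|\widetilde Y_s)=\frac{(A+B-t)(t-s)\left(A^2-sA+\widetilde Y_s\right)\left(B^2-sB+\widetilde Y_s\right)}{(A+B-s)^2(A+B-s+1)} .$$ (5) For $s<t<u$ in $(-2\Re(C),2\Re(A))$, $$\mathbb{E}(\widetilde Y_t|\widetilde Y_s,\widetilde Y_u)=\frac{(u-t)\widetilde Y_s+(t-s)\widetilde Y_u}{u-s},$$ $$\mathrm{Var}(\widetilde Y_t|\widetilde Y_s,\widetilde Y_u)=\frac{(u-t)(t-s)}{u-s+1}\left(\frac{(\widetilde Y_u-\widetilde Y_s)^2}{(u-s)^2}+\frac{u\widetilde Y_s-s\widetilde Y_u}{u-s}\right).$$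
   Context: For $a,b,c,d$ that are positive real numbers, or come as one or two complex conjugate pairs with positive real parts (any remaining parameters being positive reals), define for $x>0$ $$f(x;a,b,c,d)=K(a,b,c,d)\,\frac{\left|\Gamma(a+i\sqrt{x})\Gamma(b+i\sqrt{x})\Gamma(c+i\sqrt{x})\Gamma(d+i\sqrt{x})\right|^2}{\sqrt{x}\,\left|\Gamma(2i\sqrt{x})\right|^2},$$ $$K(a,b,c,d)=\frac{\Gamma(a+b+c+d)}{4\pi\,\Gamma(a+b)\Gamma(a+c)\Gamma(b+c)\Gamma(a+d)\Gamma(b+d)\Gamma(c+d)} .$$ By the known generalized beta integral of de Branges and Wilson, this is a probability density on $(0,\infty)$. $\Re$ denotes the real part. *)

theory Defs
  imports "HOL-Probability.Probability"
begin

section \<open>The Wilson density\<close>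

definition wilson_const :: "complex \<Rightarrow> complex \<Rightarrow> complex \<Rightarrow> complex \<Rightarrow> complex" where
  "wilson_const a b c d =
     Gamma (a + b + c + d) /
     (4 * of_real pi * Gamma (a + b) * Gamma (a + c) * Gamma (b + c)
        * Gamma (a + d) * Gamma (b + d) * Gamma (c + d))"

text \<open>For the admissible parameters (positive reals or complex conjugate pairs) the normalizing
  constant is real, so that taking its real part below only converts the type.\<close>

lemma wilson_const_real:
  assumes "(a \<in> \<real> \<and> b \<in> \<real>) \<or> a = cnj b" and "(c \<in> \<real> \<and> d \<in> \<real>) \<or> c = cnj d"
  shows "wilson_const a b c d \<in> \<real>"
proof -
  have *: "cnj (wilson_const a b c d) = wilson_const (cnj a) (cnj b) (cnj c) (cnj d)"
    by (simp add: wilson_const_def cnj_Gamma)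
  have "wilson_const (cnj a) (cnj b) (cnj c) (cnj d) = wilson_const a b c d"
    using assms by (auto simp: Reals_cnj_iff wilson_const_def ac_simps)
  with * show ?thesis by (simp add: Reals_cnj_iff)
qed

text \<open>The density lives on the positive half-line; it is extended by zero to the real line.\<close>

definition wilson_density :: "complex \<Rightarrow> complex \<Rightarrow> complex \<Rightarrow> complex \<Rightarrow> real \<Rightarrow> real" where
  "wilson_density a b c d x =
     (if 0 < x then
        Re (wilson_const a b c d) *
        (cmod (Gamma (a + \<i> * of_real (sqrt x)) * Gamma (b + \<i> * of_real (sqrt x))
             * Gamma (c + \<i> * of_real (sqrt x)) * Gamma (d + \<i> * of_real (sqrt x))))\<^sup>2
        / (sqrt x * (cmod (Gamma (2 * \<i> * of_real (sqrt x))))\<^sup>2)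
      else 0)"


section \<open>Conditional moments and Markov processes\<close>

abbreviation sigma_of :: "'w measure \<Rightarrow> ('w \<Rightarrow> 'b::topological_space) \<Rightarrow> 'w measure" where
  "sigma_of P X \<equiv> vimage_algebra (space P) X borel"

definition covariance :: "'w measure \<Rightarrow> ('w \<Rightarrow> real) \<Rightarrow> ('w \<Rightarrow> real) \<Rightarrow> real" where
  "covariance P X Z =
     (\<integral>\<omega>. (X \<omega> - (\<integral>\<xi>. X \<xi> \<partial>P)) * (Z \<omega> - (\<integral>\<xi>. Z \<xi> \<partial>P)) \<partial>P)"

definition real_cond_var :: "'w measure \<Rightarrow> 'w measure \<Rightarrow> ('w \<Rightarrow> real) \<Rightarrow> 'w \<Rightarrow> real" where
  "real_cond_var P F X = real_cond_exp P F (\<lambda>\<omega>. (X \<omega> - real_cond_exp P F X \<omega>)\<^sup>2)"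

text \<open>All the \<open>sigma_of P (Y r)\<close> have the same space, so their supremum in the lattice of measures
  carries the \<open>\<sigma>\<close>-algebra generated by their union (see \<open>sets_Sup_eq\<close>).\<close>

definition natural_filtration ::
  "'w measure \<Rightarrow> real set \<Rightarrow> (real \<Rightarrow> 'w \<Rightarrow> real) \<Rightarrow> real \<Rightarrow> 'w measure" where
  "natural_filtration P T Y s = (SUP r\<in>{r\<in>T. r \<le> s}. sigma_of P (Y r))"

definition markov_process ::
  "'w measure \<Rightarrow> real set \<Rightarrow> real set \<Rightarrow> (real \<Rightarrow> 'w \<Rightarrow> real) \<Rightarrow> bool" where
  "markov_process P T S Y \<longleftrightarrow>
     prob_space P \<and>
     (\<forall>t\<in>T. Y t \<in> P \<rightarrow>\<^sub>M restrict_space borel S) \<and>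
     (\<forall>s\<in>T. \<forall>t\<in>T. s \<le> t \<longrightarrow> (\<forall>B\<in>sets borel. AE \<omega> in P.
        real_cond_exp P (natural_filtration P T Y s) (indicator (Y t -` B \<inter> space P)) \<omega>
        = real_cond_exp P (sigma_of P (Y s)) (indicator (Y t -` B \<inter> space P)) \<omega>))"

text \<open>The law of \<open>X\<close> given \<open>Z = x\<close> has the Lebesgue density \<open>g x\<close>, for \<open>x\<close> in the range \<open>S\<close> of
  \<open>Z\<close>: every \<open>g x\<close> is a probability density, and these laws form a version of the conditional
  distribution of \<open>X\<close> given \<open>Z\<close>.\<close>

definition has_conditional_density ::
  "'w measure \<Rightarrow> real set \<Rightarrow> ('w \<Rightarrow> real) \<Rightarrow> ('w \<Rightarrow> real) \<Rightarrow> (real \<Rightarrow> real \<Rightarrow> real) \<Rightarrow> bool" where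
  "has_conditional_density P S X Z g \<longleftrightarrow>
     (\<forall>x\<in>S. g x \<in> borel_measurable borel \<and> prob_space (density lborel (\<lambda>y. ennreal (g x y)))) \<and>
     (\<forall>B\<in>sets borel. AE \<omega> in P.
        real_cond_exp P (sigma_of P Z) (indicator (X -` B \<inter> space P)) \<omega>
        = measure (density lborel (\<lambda>y. ennreal (g (Z \<omega>) y))) B)"


section \<open>The process\<close>

definition wilson_marginal ::
  "complex \<Rightarrow> complex \<Rightarrow> complex \<Rightarrow> complex \<Rightarrow> real \<Rightarrow> real \<Rightarrow> real" where
  "wilson_marginal A B C D t =
     wilson_density (A - of_real t) (B - of_real t) (C + of_real t) (D + of_real t)"

definition wilson_transition ::
  "complex \<Rightarrow> complex \<Rightarrow> real \<Rightarrow> real \<Rightarrow> real \<Rightarrow> real \<Rightarrow> real" where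
  "wilson_transition A B s t x =
     wilson_density (A - of_real t) (B - of_real t)
       (of_real (t - s) + \<i> * of_real (sqrt x)) (of_real (t - s) - \<i> * of_real (sqrt x))"

definition wilson_process ::
  "complex \<Rightarrow> complex \<Rightarrow> complex \<Rightarrow> complex \<Rightarrow> 'w measure \<Rightarrow> (real \<Rightarrow> 'w \<Rightarrow> real) \<Rightarrow> bool" where
  "wilson_process A B C D P Y \<longleftrightarrow>
     (let T = {- Re C<..<Re A} in
       markov_process P T {0<..} Y \<and>
       (\<forall>t\<in>T. distributed P lborel (Y t) (\<lambda>x. ennreal (wilson_marginal A B C D t x))) \<and>
       (\<forall>s\<in>T. \<forall>t\<in>T. s < t \<longrightarrow>
          has_conditional_density P {0<..} (Y t) (Y s) (wilson_transition A B s t)))"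

end

theory Submission
  imports Defs "HOL-Complex_Analysis.Complex_Analysis" "HOL-Real_Asymp.Real_Asymp"
begin

text \<open>
  Everything rests on the de Branges--Wilson integral. Put
  \<open>W(z) = \<Prod>\<^sub>p \<Gamma>(p + z) \<Gamma>(p - z) / (\<Gamma>(2 z) \<Gamma>(- 2 z))\<close>, the product running over the four parameters
  \<open>p = a, b, c, d\<close>, let \<open>I(a, b, c, d)\<close> be the integral of \<open>W(i y)\<close> over real \<open>y\<close>, and let
  \<open>J(a, b, c, d)\<close> be the product of the six values \<open>\<Gamma>(p + q)\<close> divided by \<open>\<Gamma>(a + b + c + d)\<close>. The claim is
  \<open>I = 4 \<pi> J\<close> for all complex parameters with positive real part.

  The function \<open>h(z) = \<Prod>\<^sub>p \<Gamma>(p + 1/2 + z) \<Gamma>(p + 1/2 - z) sin(2 \<pi> z)\<close> is holomorphic on a neighbourhood of the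
  strip \<open>\<bar>Re z\<bar> \<le> 1/2\<close> and decays exponentially there, so its integrals along the two boundary lines agree.
  Their difference is, up to the factor \<open>- \<pi>\<close>, the integral of \<open>(e\<^sub>1 z\<^sup>2 + e\<^sub>3) W(z)\<close> along the imaginary axis, with
  \<open>e\<^sub>1, e\<^sub>3\<close> the elementary symmetric polynomials of the parameters. Hence the second moment of \<open>W(i y)\<close>
  is \<open>e\<^sub>3 / e\<^sub>1\<close> times the total mass (\<open>wilson_first_moment_relation\<close>). Since multiplying \<open>W(i y)\<close> by \<open>a\<^sup>2 + y\<^sup>2\<close>
  replaces \<open>a\<close> by \<open>a + 1\<close>, this says that \<open>I / J\<close> does not change under \<open>a \<mapsto> a + 1\<close>. Letting \<open>a + n\<close> tend to
  infinity turns \<open>I / J\<close> into a quotient in which \<open>a\<close> does not occur. So \<open>I / J\<close> is independent of \<open>a\<close>, by symmetry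
  it is constant, and for the parameters \<open>1/2\<close> the limiting integral is elementary
  (\<open>wilson_integral_eq\<close>). The substitution \<open>x = y\<^sup>2\<close> then gives the total mass of every Wilson density, its mean by the
  first moment relation, and its variance by raising both \<open>a\<close> and \<open>b\<close> by one (locale \<open>wilson_parameters\<close>).

  The process owes its existence to one algebraic identity, \<open>wilson_density_swap\<close>: a Wilson density times a
  transition density is a Wilson density in the other variable times a backward transition density. Integrating out
  either variable yields that the marginals are carried into each other and that the Chapman--Kolmogorov
  equation holds. The Daniell--Kolmogorov theorem provides the process, in the locale \<open>markov_densities\<close>. The
  same identity shows that, given the values at times \<open>s\<close> and \<open>u\<close>, the value at a time in between again has
  a Wilson density (\<open>trans_bridge\<close>).

  For an arbitrary process with these marginals and transitions, the joint laws at two and three times have explicit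
  densities, so all conditional means and variances are means and variances of Wilson densities. The assertions
  are then identities between rational functions of the parameters.
\<close>

section \<open>Decay of the Gamma function on vertical strips\<close>

text \<open>
  The quotient \<open>\<bar>\<Gamma>(x + i y)\<bar> / \<Gamma>(x)\<close> is increasing in \<open>x > 0\<close>: in Gauss' product it is the limit of the
  products of the factors \<open>(x + k) / \<bar>x + k + i y\<bar>\<close>, each of which increases with \<open>x\<close>. Decay on the line
  \<open>Re z = N + 1\<close>, which follows from the reflection formula, therefore passes to all smaller real parts.
\<close>

lemma norm_Gamma_ratio_mono:
  fixes x x' y :: real
  assumes "0 < x" "x \<le> x'"
  shows "cmod (Gamma (Complex x y)) * Gamma x' \<le> cmod (Gamma (Complex x' y)) * Gamma x"
proof -
  have frac: "cmod (Gamma_series (Complex u y) n) =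
      Gamma_series u n * (\<Prod>k\<in>{0..n}. (u + real k) / cmod (Complex u y + of_nat k))"
    if "0 < u" for u n
  proof -
    have "cmod (exp (Complex u y * of_real (ln (real n)))) = exp (u * ln (real n))"
      by simp
    moreover have "(\<Prod>k\<in>{0..n}. u + real k) \<noteq> 0"
      using that by (auto simp: add_eq_0_iff)
    ultimately show ?thesis
      by (simp add: Gamma_series_def pochhammer_prod atLeastLessThanSuc_atLeastAtMost norm_divide norm_mult prod_norm
            prod_dividef)
  qed
  have le: "(\<Prod>k\<in>{0..n}. (x + real k) / cmod (Complex x y + of_nat k))
      \<le> (\<Prod>k\<in>{0..n}. (x' + real k) / cmod (Complex x' y + of_nat k))" for n
  proof (intro prod_mono conjI)
    fix k
    define u where "u = x + real k"
    define u' where "u' = x' + real k"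
    have u: "0 < u" "u \<le> u'" using assms by (auto simp: u_def u'_def)
    have "u\<^sup>2 * (u'\<^sup>2 + y\<^sup>2) \<le> u'\<^sup>2 * (u\<^sup>2 + y\<^sup>2)"
      using u by (auto simp: algebra_simps intro!: mult_left_mono mult_right_mono power_mono)
    hence "sqrt (u\<^sup>2 * (u'\<^sup>2 + y\<^sup>2)) \<le> sqrt (u'\<^sup>2 * (u\<^sup>2 + y\<^sup>2))"
      by (rule real_sqrt_le_mono)
    hence *: "u * sqrt (u'\<^sup>2 + y\<^sup>2) \<le> u' * sqrt (u\<^sup>2 + y\<^sup>2)"
      using u by (simp add: real_sqrt_mult)
    have pos: "0 < sqrt (u\<^sup>2 + y\<^sup>2)" "0 < sqrt (u'\<^sup>2 + y\<^sup>2)"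
      using u by (auto intro!: add_pos_nonneg)
    have "u / sqrt (u\<^sup>2 + y\<^sup>2) \<le> u' / sqrt (u'\<^sup>2 + y\<^sup>2)"
      using * pos by (simp add: field_simps)
    thus "(x + real k) / cmod (Complex x y + of_nat k) \<le> (x' + real k) / cmod (Complex x' y + of_nat k)"
      by (simp add: cmod_def u_def u'_def)
    show "0 \<le> (x + real k) / cmod (Complex x y + of_nat k)"
      using assms by simp
  qed
  have pos: "0 \<le> Gamma_series u n" if "0 < u" for u :: real and n
    using that by (auto simp: Gamma_series_def intro!: divide_nonneg_nonneg pochhammer_nonneg)
  have "cmod (Gamma_series (Complex x y) n) * Gamma_series x' n
      \<le> cmod (Gamma_series (Complex x' y) n) * Gamma_series x n" for n
    using assms pos[of x n] pos[of x' n] le[of n]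
    by (simp add: frac mult_ac mult_left_mono)
  thus ?thesis
    by (intro LIMSEQ_le[OF tendsto_mult[OF tendsto_norm[OF Gamma_series_LIMSEQ] Gamma_series_LIMSEQ]
          tendsto_mult[OF tendsto_norm[OF Gamma_series_LIMSEQ] Gamma_series_LIMSEQ]]) auto
qed

lemma norm_Gamma_le_Gamma_Re:
  assumes "0 < Re z"
  shows "cmod (Gamma z) \<le> Gamma (Re z)"
proof -
  have "cmod (Gamma_series z n) \<le> Gamma_series (Re z) n" for n
  proof -
    have "0 < pochhammer (Re z) (Suc n)"
      using assms by (intro pochhammer_pos)
    moreover have "pochhammer (Re z) (Suc n) \<le> cmod (pochhammer z (Suc n))"
      unfolding pochhammer_prod prod_norm[symmetric]
    proof (intro prod_mono)
      show "0 \<le> Re z + of_nat i \<and> Re z + of_nat i \<le> cmod (z + of_nat i)" for i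
        using assms complex_Re_le_cmod[of "z + of_nat i"] by simp
    qed
    ultimately show ?thesis
      by (simp add: Gamma_series_def norm_divide norm_mult frac_le)
  qed
  thus ?thesis
    by (intro LIMSEQ_le[OF tendsto_norm[OF Gamma_series_LIMSEQ] Gamma_series_LIMSEQ]) auto
qed

text \<open>
  The reflection formula evaluates \<open>\<Gamma>(1 + i y) \<Gamma>(1 - i y)\<close>, and the two factors are complex conjugates.
\<close>

lemma norm_Gamma_1_ii:
  "cmod (Gamma (Complex 1 y)) ^ 2 * sinh (pi * y) = pi * y"
proof (cases "y = 0")
  case False
  define z where "z = \<i> * of_real y"
  have z: "z \<notin> \<int>\<^sub>\<le>\<^sub>0"
    using False by (auto simp: z_def elim!: nonpos_Ints_cases simp: complex_eq_iff)
  have 1: "Gamma (1 + z) = z * Gamma z"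
    using Gamma_plus1[OF z] by (simp add: add.commute)
  have sin: "sin (of_real pi * z) = \<i> * of_real (sinh (pi * y))"
  proof -
    have "of_real pi * z = \<i> * of_real (pi * y)" by (simp add: z_def)
    thus ?thesis
      by (simp only: sin_i_times) (simp add: sinh_field_def exp_of_real[symmetric] exp_minus)
  qed
  have sh: "sinh (pi * y) \<noteq> 0"
    using False by simp
  have "of_real (cmod (Gamma (1 + z)) ^ 2) = Gamma (1 + z) * cnj (Gamma (1 + z))"
    by (rule complex_norm_square)
  also have "cnj (Gamma (1 + z)) = Gamma (1 - z)"
    by (simp add: cnj_Gamma z_def)
  also have "Gamma (1 + z) * Gamma (1 - z) = z * (of_real pi / sin (of_real pi * z))"
    using Gamma_reflection_complex[of z] by (simp add: 1 mult.assoc)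
  also have "\<dots> = of_real (pi * y / sinh (pi * y))"
    unfolding sin using sh by (simp add: z_def)
  finally have "cmod (Gamma (1 + z)) ^ 2 = pi * y / sinh (pi * y)"
    using of_real_eq_iff by blast
  moreover have "1 + z = Complex 1 y"
    by (simp add: z_def complex_eq_iff)
  ultimately show ?thesis using sh by simp
qed auto

text \<open>
  With \<open>u = \<pi> \<bar>y\<bar>\<close> the left-hand side is \<open>u / sinh u \<le> (1 + 2 u) exp(- u)\<close>. Giving up a twelfth of the exponent
  absorbs the linear factor, because \<open>1 + 2 u \<le> 24 exp(u / 12)\<close>.
\<close>

lemma norm_Gamma_1_ii_le:
  "cmod (Gamma (Complex 1 y)) ^ 2 \<le> 24 * exp (- (11 / 12) * (pi * \<bar>y\<bar>))"
proof (cases "y = 0")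
  case True
  have "Complex 1 0 = 1" by (simp add: complex_eq_iff)
  with True show ?thesis by simp
next
  case False
  define u where "u = pi * \<bar>y\<bar>"
  have u: "0 < u" using False by (simp add: u_def)
  have sinh: "0 < sinh u" using u by simp
  have "cmod (Gamma (Complex 1 y)) ^ 2 * sinh u = u"
    using norm_Gamma_1_ii[of y] by (cases "y \<ge> 0") (auto simp: u_def)
  hence eq: "cmod (Gamma (Complex 1 y)) ^ 2 = u / sinh u"
    using sinh by (simp add: field_simps)
  have "u \<le> (24 * exp (- (11 / 12) * u)) * sinh u"
  proof -
    have "(1 + 2 * u) * exp (- 2 * u) \<le> exp (2 * u) * exp (- 2 * u)"
      using exp_ge_add_one_self[of "2 * u"] by (intro mult_right_mono) auto
    hence 1: "2 * u \<le> (1 + 2 * u) * (1 - exp (- 2 * u))"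
      by (simp add: mult_exp_exp algebra_simps)
    have "1 + u / 12 \<le> exp (u / 12)" by (rule exp_ge_add_one_self)
    hence 2: "1 + 2 * u \<le> 24 * exp (u / 12)" by linarith
    have "2 * u \<le> 24 * exp (u / 12) * (1 - exp (- 2 * u))"
      using u by (intro order_trans[OF 1 mult_right_mono[OF 2]]) auto
    also have "\<dots> = 2 * ((24 * exp (- (11 / 12) * u)) * sinh u)"
      by (simp add: sinh_def scaleR_conv_of_real algebra_simps mult_exp_exp)
    finally show ?thesis by linarith
  qed
  thus ?thesis
    unfolding eq using sinh by (simp add: u_def[symmetric] field_simps)
qed

lemma power_le_exp:
  fixes k \<epsilon> :: real
  assumes "0 \<le> k" "0 < \<epsilon>"
  obtains C where "0 \<le> C" "\<And>t. 0 \<le> t \<Longrightarrow> (k + t) ^ N \<le> C * exp (\<epsilon> * t)"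
proof
  \<comment> \<open>With \<open>v = \<epsilon> t / (N + 1)\<close> one has \<open>k + t \<le> K (1 + v) \<le> K exp v\<close>, and \<open>N v \<le> \<epsilon> t\<close>.\<close>
  define K where "K = k + real (N + 1) / \<epsilon>"
  have K: "0 \<le> K" "k \<le> K" "real (N + 1) / \<epsilon> \<le> K" using assms by (auto simp: K_def)
  show "0 \<le> K ^ N" using K by simp
  show "(k + t) ^ N \<le> K ^ N * exp (\<epsilon> * t)" if "0 \<le> t" for t
  proof -
    define v where "v = \<epsilon> * t / real (N + 1)"
    have v: "0 \<le> v" using assms that by (simp add: v_def)
    have "t = real (N + 1) / \<epsilon> * v" using assms by (simp add: v_def)
    also have "\<dots> \<le> K * v" using K v by (intro mult_right_mono)
    finally have "k + t \<le> K * (1 + v)" using K by (simp add: algebra_simps)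
    also have "\<dots> \<le> K * exp v" using K exp_ge_add_one_self[of v] by (intro mult_left_mono) auto
    finally have "(k + t) ^ N \<le> (K * exp v) ^ N"
      using assms that by (intro power_mono) auto
    also have "\<dots> = K ^ N * exp (real N * v)"
      by (simp add: power_mult_distrib exp_of_nat_mult)
    also have "\<dots> \<le> K ^ N * exp (real (N + 1) * v)"
      using K v by (intro mult_left_mono) (auto simp: algebra_simps)
    also have "real (N + 1) * v = \<epsilon> * t" unfolding v_def by simp
    finally show ?thesis .
  qed
qed

text \<open>
  The true rate is \<open>\<pi> / 2\<close> up to a power of \<open>\<bar>Im z\<bar>\<close>. The rate \<open>5 \<pi> / 12\<close> is smaller, which absorbs the power,
  but still large enough for the integrals below: six Gamma factors decay at rate \<open>5 \<pi> / 2\<close> and so beat the growth of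
  \<open>z sin(2 \<pi> z)\<close>, which is of rate \<open>2 \<pi>\<close>.
\<close>

lemma Gamma_vertical_decay:
  assumes "0 < lo"
  obtains C where "\<And>z. lo \<le> Re z \<Longrightarrow> Re z \<le> hi \<Longrightarrow> cmod (Gamma z) \<le> C * exp (- (5 * pi / 12) * \<bar>Im z\<bar>)"
proof -
  obtain N :: nat where N: "hi \<le> real N" using real_arch_simple by blast
  have "compact (Gamma ` {lo..hi})"
    using assms by (intro compact_continuous_image continuous_on_Gamma)
      (auto elim!: nonpos_Ints_cases)
  then obtain G where G: "\<And>x. x \<in> {lo..hi} \<Longrightarrow> norm (Gamma x) \<le> G"
    by (meson bounded_iff compact_imp_bounded imageI)
  have "0 < pi / 24" by simp
  then obtain C where C: "0 \<le> C" "\<And>t. 0 \<le> t \<Longrightarrow> (real (N + 1) + t) ^ N \<le> C * exp (pi / 24 * t)"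
    using power_le_exp[of "real (N + 1)" "pi / 24" N] by auto
  have GN: "1 \<le> Gamma (1 + real N)"
    using Gamma_fact[of N, where 'a=real] by simp
  define B where "B = \<bar>G\<bar> * (C * 5)"
  show thesis
  proof (rule that[of B])
    fix z assume z: "lo \<le> Re z" "Re z \<le> hi"
    define x where "x = Re z"
    define y where "y = Im z"
    have zxy: "z = Complex x y" by (simp add: x_def y_def)
    have x: "0 < x" "x \<le> 1 + real N" using z N assms by (auto simp: x_def)
    have Gx: "Gamma x \<le> \<bar>G\<bar>" "0 < Gamma x" using G[of x] z x by (auto simp: x_def)
    \<comment> \<open>Half of the rate \<open>11 \<pi> / 12\<close> of the square; the power of \<open>\<bar>y\<bar>\<close> below costs \<open>\<pi> / 24\<close> more, which leaves \<open>5 \<pi> / 12\<close>.\<close>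
    have g1: "cmod (Gamma (Complex 1 y)) \<le> 5 * exp (- (11 / 24) * (pi * \<bar>y\<bar>))"
    proof (rule power2_le_imp_le)
      have "(5 * exp (- (11 / 24) * (pi * \<bar>y\<bar>)))\<^sup>2 = 25 * exp (- (11 / 12) * (pi * \<bar>y\<bar>))"
        by (simp add: power_mult_distrib exp_double[symmetric])
      thus "(cmod (Gamma (Complex 1 y)))\<^sup>2 \<le> (5 * exp (- (11 / 24) * (pi * \<bar>y\<bar>)))\<^sup>2"
        using norm_Gamma_1_ii_le[of y] by (smt (verit) exp_gt_zero)
    qed simp
    have "Complex 1 y \<notin> \<int>\<^sub>\<le>\<^sub>0" by (auto elim!: nonpos_Ints_cases simp: complex_eq_iff)
    moreover have c1: "Complex 1 y + of_nat N = Complex (1 + real N) y"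
      by (simp add: complex_eq_iff)
    ultimately have "Gamma (Complex (1 + real N) y) = pochhammer (Complex 1 y) N * Gamma (Complex 1 y)"
      using pochhammer_Gamma[of "Complex 1 y" N] c1 by (simp add: Gamma_eq_zero_iff)
    hence "cmod (Gamma (Complex (1 + real N) y)) = cmod (pochhammer (Complex 1 y) N) * cmod (Gamma (Complex 1 y))"
      by (simp add: norm_mult)
    also have "cmod (pochhammer (Complex 1 y) N) \<le> (\<Prod>i\<in>{0..<N}. real (N + 1) + \<bar>y\<bar>)"
      unfolding pochhammer_prod prod_norm[symmetric]
    proof (intro prod_mono conjI)
      fix i assume "i \<in> {0..<N}"
      thus "cmod (Complex 1 y + of_nat i) \<le> real (N + 1) + \<bar>y\<bar>"
        using cmod_le[of "Complex 1 y + of_nat i"] by simp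
    qed simp
    also have "\<dots> \<le> C * exp (pi / 24 * \<bar>y\<bar>)" using C(2)[of "\<bar>y\<bar>"] by simp
    finally have "cmod (Gamma (Complex (1 + real N) y)) \<le>
        C * exp (pi / 24 * \<bar>y\<bar>) * cmod (Gamma (Complex 1 y))"
      by (simp add: mult_right_mono)
    also have "\<dots> \<le> C * exp (pi / 24 * \<bar>y\<bar>) * (5 * exp (- (11 / 24) * (pi * \<bar>y\<bar>)))"
      using g1 C by (intro mult_left_mono) auto
    also have "\<dots> = C * 5 * exp (pi / 24 * \<bar>y\<bar> + (- (11 / 24) * (pi * \<bar>y\<bar>)))"
      by (simp only: exp_add mult_ac)
    also have "pi / 24 * \<bar>y\<bar> + (- (11 / 24) * (pi * \<bar>y\<bar>)) = - (5 * pi / 12) * \<bar>y\<bar>"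
      by (simp add: field_simps)
    finally have gN: "cmod (Gamma (Complex (1 + real N) y)) \<le> C * 5 * exp (- (5 * pi / 12) * \<bar>y\<bar>)" .
    have "cmod (Gamma z) \<le> cmod (Gamma z) * Gamma (1 + real N)"
      using GN by (simp add: mult_le_cancel_left1)
    also have "\<dots> \<le> cmod (Gamma (Complex (1 + real N) y)) * Gamma x"
      unfolding zxy by (rule norm_Gamma_ratio_mono) (use x in auto)
    also have "\<dots> \<le> (C * 5 * exp (- (5 * pi / 12) * \<bar>y\<bar>)) * \<bar>G\<bar>"
      using gN Gx C by (intro mult_mono) auto
    finally show "cmod (Gamma z) \<le> B * exp (- (5 * pi / 12) * \<bar>Im z\<bar>)"
      by (simp add: B_def y_def mult_ac)
  qed
qed

text \<open>
  A negative rate \<open>r\<close> bounds a growing function; in this way the rates of the factors of a product simply add up.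
\<close>

definition exp_decay :: "complex set \<Rightarrow> real \<Rightarrow> (complex \<Rightarrow> complex) \<Rightarrow> bool" where
  "exp_decay S r f \<longleftrightarrow> (\<exists>C\<ge>0. \<forall>z\<in>S. cmod (f z) \<le> C * exp (- r * \<bar>Im z\<bar>))"

lemma exp_decayI:
  assumes "\<And>z. z \<in> S \<Longrightarrow> cmod (f z) \<le> C * exp (- r * \<bar>Im z\<bar>)"
  shows "exp_decay S r f"
  unfolding exp_decay_def
proof (intro exI[of _ "\<bar>C\<bar>"] conjI ballI)
  fix z assume "z \<in> S"
  thus "cmod (f z) \<le> \<bar>C\<bar> * exp (- r * \<bar>Im z\<bar>)"
    by (rule order_trans[OF assms]) (auto intro: mult_right_mono)
qed simp

lemma exp_decay_mult:
  assumes "exp_decay S r f" "exp_decay S q g"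
  shows "exp_decay S (r + q) (\<lambda>z. f z * g z)"
proof -
  obtain C D where CD: "0 \<le> C" "0 \<le> D" "\<And>z. z \<in> S \<Longrightarrow> cmod (f z) \<le> C * exp (- r * \<bar>Im z\<bar>)"
      "\<And>z. z \<in> S \<Longrightarrow> cmod (g z) \<le> D * exp (- q * \<bar>Im z\<bar>)"
    using assms unfolding exp_decay_def by blast
  show ?thesis
  proof (rule exp_decayI)
    fix z assume "z \<in> S"
    hence "cmod (f z * g z) \<le> (C * exp (- r * \<bar>Im z\<bar>)) * (D * exp (- q * \<bar>Im z\<bar>))"
      unfolding norm_mult using CD by (intro mult_mono) auto
    also have "\<dots> = (C * D) * exp (- (r + q) * \<bar>Im z\<bar>)"
      by (simp add: exp_add[symmetric] algebra_simps mult_exp_exp)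
    finally show "cmod (f z * g z) \<le> (C * D) * exp (- (r + q) * \<bar>Im z\<bar>)" .
  qed
qed

lemma exp_decay_weaken:
  assumes "exp_decay S r f" "q \<le> r"
  shows "exp_decay S q f"
proof -
  obtain C where C: "0 \<le> C" "\<And>z. z \<in> S \<Longrightarrow> cmod (f z) \<le> C * exp (- r * \<bar>Im z\<bar>)"
    using assms unfolding exp_decay_def by blast
  show ?thesis
  proof (rule exp_decayI)
    fix z assume "z \<in> S"
    hence "cmod (f z) \<le> C * exp (- r * \<bar>Im z\<bar>)" by (rule C)
    also have "\<dots> \<le> C * exp (- q * \<bar>Im z\<bar>)"
      using C assms by (intro mult_left_mono) (auto intro: mult_right_mono)
    finally show "cmod (f z) \<le> C * exp (- q * \<bar>Im z\<bar>)" .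
  qed
qed

lemma exp_decay_Gamma_add:
  assumes "0 < Re p + u"
  shows "exp_decay {z. u \<le> Re z \<and> Re z \<le> v} (5 * pi / 12) (\<lambda>z. Gamma (p + z))"
proof -
  obtain C where C: "\<And>z. Re p + u \<le> Re z \<Longrightarrow> Re z \<le> Re p + v \<Longrightarrow>
      cmod (Gamma z) \<le> C * exp (- (5 * pi / 12) * \<bar>Im z\<bar>)"
    using Gamma_vertical_decay[OF assms] by blast
  show ?thesis
  proof (rule exp_decayI)
    fix z assume z: "z \<in> {z. u \<le> Re z \<and> Re z \<le> v}"
    have "cmod (Gamma (p + z)) \<le> C * exp (- (5 * pi / 12) * \<bar>Im (p + z)\<bar>)"
      using z by (intro C) auto
    also have "\<dots> \<le> \<bar>C\<bar> * exp (- (5 * pi / 12) * \<bar>Im (p + z)\<bar>)"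
      by (intro mult_right_mono) auto
    also have "\<dots> \<le> \<bar>C\<bar> * exp (5 * pi / 12 * \<bar>Im p\<bar> + - (5 * pi / 12) * \<bar>Im z\<bar>)"
    proof -
      have "(5 * pi / 12) * \<bar>Im z\<bar> \<le> (5 * pi / 12) * (\<bar>Im p\<bar> + \<bar>Im (p + z)\<bar>)"
        by (intro mult_left_mono) auto
      thus ?thesis by (intro mult_left_mono) (auto simp: algebra_simps)
    qed
    also have "\<dots> = (\<bar>C\<bar> * exp (5 * pi / 12 * \<bar>Im p\<bar>)) * exp (- (5 * pi / 12) * \<bar>Im z\<bar>)"
      by (simp only: exp_add mult_ac)
    finally show "cmod (Gamma (p + z)) \<le> \<dots>" .
  qed
qed

lemma exp_decay_uminus:
  assumes "exp_decay S r f"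
  shows "exp_decay (uminus ` S) r (\<lambda>z. f (- z))"
  using assms unfolding exp_decay_def by auto

lemma exp_decay_Gamma_diff:
  assumes "v < Re p"
  shows "exp_decay {z. u \<le> Re z \<and> Re z \<le> v} (5 * pi / 12) (\<lambda>z. Gamma (p - z))"
proof -
  have "uminus ` {z. - v \<le> Re z \<and> Re z \<le> - u} = {z. u \<le> Re z \<and> Re z \<le> v}"
    by (force simp: image_iff intro: exI[of _ "- _"])
  thus ?thesis
    using exp_decay_uminus[OF exp_decay_Gamma_add[of p "- v" "- u"]] assms by simp
qed

lemma exp_decay_id:
  assumes "0 < \<epsilon>"
  shows "exp_decay {z. u \<le> Re z \<and> Re z \<le> v} (- \<epsilon>) (\<lambda>z. z)"
proof -
  obtain C where C: "0 \<le> C" "\<And>t. 0 \<le> t \<Longrightarrow> (\<bar>u\<bar> + \<bar>v\<bar> + t) ^ 1 \<le> C * exp (\<epsilon> * t)"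
    using power_le_exp[of "\<bar>u\<bar> + \<bar>v\<bar>" \<epsilon> 1] assms by auto
  show ?thesis
  proof (rule exp_decayI)
    fix z assume z: "z \<in> {z. u \<le> Re z \<and> Re z \<le> v}"
    have "cmod z \<le> \<bar>u\<bar> + \<bar>v\<bar> + \<bar>Im z\<bar>" using cmod_le[of z] z by auto
    thus "cmod z \<le> C * exp (- (- \<epsilon>) * \<bar>Im z\<bar>)" using C(2)[of "\<bar>Im z\<bar>"] by simp
  qed
qed

lemma exp_decay_const: "exp_decay S 0 (\<lambda>_. c)"
  by (rule exp_decayI[of _ _ "cmod c"]) simp

lemma norm_sin_le_exp: "cmod (sin z) \<le> exp \<bar>Im z\<bar>"
proof -
  have "cmod (sin z) \<le> (cmod (exp (\<i> * z)) + cmod (exp (- (\<i> * z)))) / 2"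
    using norm_triangle_ineq4[of "exp (\<i> * z)" "exp (- (\<i> * z))"]
    unfolding sin_exp_eq by (simp add: norm_divide norm_mult)
  also have "\<dots> = (exp (- Im z) + exp (Im z)) / 2" by simp
  also have "\<dots> \<le> exp \<bar>Im z\<bar>" by (auto simp: abs_if)
  finally show ?thesis .
qed

lemma exp_decay_sin: "exp_decay S (- (2 * pi)) (\<lambda>z. sin (2 * of_real pi * z))"
proof (rule exp_decayI[of _ _ 1])
  fix z
  have "Im (2 * of_real pi * z) = 2 * pi * Im z" by simp
  thus "cmod (sin (2 * of_real pi * z)) \<le> 1 * exp (- (- (2 * pi)) * \<bar>Im z\<bar>)"
    using norm_sin_le_exp[of "2 * of_real pi * z"] by (simp add: abs_mult)
qed

section \<open>Integrals along vertical lines\<close>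

lemma integrable_exp_minus_abs:
  assumes "0 < r"
  shows "integrable lborel (\<lambda>y::real. exp (- r * \<bar>y\<bar>))"
proof -
  interpret prob_space "density lborel (exponential_density r)"
    by (rule prob_space_exponential_density[OF assms])
  have "(\<integral>\<^sup>+ y. ennreal (exponential_density r y) \<partial>lborel) = 1"
    using emeasure_space_1 by (simp add: emeasure_density)
  hence 1: "integrable lborel (exponential_density r)"
    using assms by (intro integrableI_nonneg) (auto simp: exponential_density_def)
  hence 2: "integrable lborel (\<lambda>y. exponential_density r (- y))"
    using lborel_integrable_real_affine[OF 1, of "-1" 0] by simp
  show ?thesis
  proof (rule Bochner_Integration.integrable_bound)
    show "integrable lborel (\<lambda>y. (exponential_density r y + exponential_density r (- y)) / r)"
      using 1 2 by simp
    show "AE y in lborel. norm (exp (- r * \<bar>y\<bar>)) \<le> norm ((exponential_density r y + exponential_density r (- y)) / r)"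
      using assms by (intro AE_I2) (auto simp: exponential_density_def abs_if field_simps add_pos_pos)
  qed simp
qed

lemma integrable_on_vertical_line:
  assumes decay: "exp_decay S r f" "0 < r" and cont: "continuous_on S f"
    and line: "\<And>y. Complex x y \<in> S"
  shows "integrable lborel (\<lambda>y. f (Complex x y))"
proof -
  obtain C where C: "\<And>z. z \<in> S \<Longrightarrow> cmod (f z) \<le> C * exp (- r * \<bar>Im z\<bar>)"
    using decay unfolding exp_decay_def by blast
  have "continuous_on UNIV (\<lambda>y. f (Complex x y))"
    by (rule continuous_on_compose2[OF cont]) (use line in \<open>auto intro!: continuous_intros simp: Complex_eq\<close>)
  hence [measurable]: "(\<lambda>y. f (Complex x y)) \<in> borel_measurable lborel"
    by (simp add: borel_measurable_continuous_onI)
  show ?thesis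
  proof (rule Bochner_Integration.integrable_bound)
    show "integrable lborel (\<lambda>y. C * exp (- r * \<bar>y\<bar>))"
      using integrable_exp_minus_abs[OF decay(2)] by simp
    show "AE y in lborel. norm (f (Complex x y)) \<le> norm (C * exp (- r * \<bar>y\<bar>))"
      using C[OF line] by (intro AE_I2) (smt (verit, best) complex.sel real_norm_def)
  qed simp
qed

lemma integral_symmetric_intervals_tendsto:
  fixes g :: "real \<Rightarrow> 'a :: {banach, second_countable_topology}"
  assumes "integrable lborel g"
  shows "(\<lambda>n. \<integral>y. indicator {- real n..real n} y *\<^sub>R g y \<partial>lborel) \<longlonglongrightarrow> (\<integral>y. g y \<partial>lborel)"
proof (rule integral_dominated_convergence[where w = "\<lambda>y. norm (g y)"])
  show "AE y in lborel. (\<lambda>n. indicator {- real n..real n} y *\<^sub>R g y) \<longlonglongrightarrow> g y"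
  proof (intro AE_I2 tendsto_eventually)
    fix y :: real
    obtain N :: nat where "\<bar>y\<bar> \<le> real N" using real_arch_simple by blast
    thus "\<forall>\<^sub>F n in sequentially. indicator {- real n..real n} y *\<^sub>R g y = g y"
      by (intro eventually_sequentiallyI[of N]) (auto simp: indicator_def)
  qed
qed (use assms in \<open>auto simp: indicator_def\<close>)

text \<open>
  On the open strip, which is convex, \<open>f\<close> has a primitive \<open>F\<close>. So the integral of \<open>f\<close> over the vertical segment of
  height \<open>2 n\<close> is a difference of two values of \<open>F\<close>, and the segments at \<open>u\<close> and \<open>v\<close> differ by increments of \<open>F\<close> along
  horizontal segments at heights \<open>n\<close> and \<open>- n\<close>. These tend to \<open>0\<close> by the decay of \<open>f\<close>.
\<close>

lemma vertical_line_shift: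
  fixes f :: "complex \<Rightarrow> complex"
  assumes hol: "f holomorphic_on {z. u' < Re z \<and> Re z < v'}" and uv: "u' < u" "u \<le> v" "v < v'"
    and decay: "exp_decay {z. u \<le> Re z \<and> Re z \<le> v} r f" "0 < r"
  shows "(\<integral>y. f (Complex u y) \<partial>lborel) = (\<integral>y. f (Complex v y) \<partial>lborel)"
proof -
  define T where "T = {z. u' < Re z \<and> Re z < v'}"
  define S where "S = {z. u \<le> Re z \<and> Re z \<le> v}"
  have ST: "S \<subseteq> T" using uv by (auto simp: S_def T_def)
  have T_eq: "T = {z. u' < Re z} \<inter> {z. Re z < v'}" by (auto simp: T_def)
  have opT: "open T" unfolding T_eq
    by (intro open_Int open_halfspace_Re_gt open_halfspace_Re_lt)
  have conT: "convex T" unfolding T_eq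
    by (intro convex_Int convex_halfspace_Re_gt convex_halfspace_Re_lt)
  obtain F where F: "\<And>z. z \<in> T \<Longrightarrow> (F has_field_derivative f z) (at z within T)"
  proof (rule holomorphic_convex_primitive'[OF conT opT hol[folded T_def]])
    fix g assume "\<And>z. z \<in> T \<Longrightarrow> (g has_field_derivative f z) (at z within T)"
    thus thesis by (rule that)
  qed
  have F': "(F has_field_derivative f z) (at z)" if "z \<in> T" for z
    using F[OF that] unfolding at_within_open[OF that opT] .
  have contT: "continuous_on T f" using hol unfolding T_def by (rule holomorphic_on_imp_continuous_on)
  have cont: "continuous_on S f" by (rule continuous_on_subset[OF contT ST])
  obtain C where C: "\<And>z. z \<in> S \<Longrightarrow> cmod (f z) \<le> C * exp (- r * \<bar>Im z\<bar>)"
    using decay unfolding exp_decay_def S_def by blast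
  have int: "(\<integral>y. indicator {- real n..real n} y *\<^sub>R f (Complex x y) \<partial>lborel)
      = (F (Complex x (real n)) - F (Complex x (- real n))) / \<i>" if "u \<le> x" "x \<le> v" for x n
  proof -
    have line: "Complex x y \<in> S" for y using that by (simp add: S_def)
    have "(\<integral>y. indicator {- real n..real n} y *\<^sub>R f (Complex x y) \<partial>lborel)
        = F (Complex x (real n)) / \<i> - F (Complex x (- real n)) / \<i>"
    proof (rule integral_FTC_atLeastAtMost)
      show "((\<lambda>y. F (Complex x y) / \<i>) has_vector_derivative f (Complex x y))
          (at y within {- real n..real n})" for y
      proof -
        have 1: "((\<lambda>y. Complex x y) has_vector_derivative \<i>) (at y)"
          unfolding Complex_eq by (auto intro!: derivative_eq_intros)
        have 2: "(F has_field_derivative f (Complex x y)) (at (Complex x y))"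
          using line[of y] ST by (intro F') blast
        have "((\<lambda>y. F (Complex x y)) has_vector_derivative \<i> * f (Complex x y)) (at y within {- real n..real n})"
          using field_vector_diff_chain_at[OF 1 2] unfolding o_def by (rule has_vector_derivative_at_within)
        from has_vector_derivative_divide[OF this, of \<i>] show ?thesis by simp
      qed
      show "continuous_on {- real n..real n} (\<lambda>y. f (Complex x y))"
        by (rule continuous_on_compose2[OF cont])
          (use line in \<open>auto intro!: continuous_intros simp: Complex_eq\<close>)
    qed simp
    thus ?thesis unfolding diff_divide_distrib .
  qed
  have horiz: "cmod (F (Complex v y) - F (Complex u y)) \<le> C * exp (- r * \<bar>y\<bar>) * (v - u)" for y
  proof -
    have "cmod (F (Complex v y) - F (Complex u y)) \<le> C * exp (- r * \<bar>y\<bar>) * cmod (Complex v y - Complex u y)"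
    proof (rule field_differentiable_bound[of "closed_segment (Complex u y) (Complex v y)"])
      fix z assume "z \<in> closed_segment (Complex u y) (Complex v y)"
      hence z: "Im z = y" "z \<in> S"
        using uv by (auto simp: closed_segment_same_Im S_def closed_segment_eq_real_ivl)
      show "(F has_field_derivative f z) (at z within closed_segment (Complex u y) (Complex v y))"
        using F'[of z] z ST by (auto intro: has_field_derivative_at_within)
      show "cmod (f z) \<le> C * exp (- r * \<bar>y\<bar>)" using C[of z] z by simp
    qed auto
    also have "cmod (Complex v y - Complex u y) = v - u" using uv by (simp add: cmod_def)
    finally show ?thesis .
  qed
  have horiz0: "(\<lambda>n. F (Complex v (s * real n)) - F (Complex u (s * real n))) \<longlonglongrightarrow> 0" if "\<bar>s\<bar> = 1" for s
  proof (rule Lim_null_comparison)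
    show "\<forall>\<^sub>F n in sequentially. norm (F (Complex v (s * real n)) - F (Complex u (s * real n)))
        \<le> C * exp (- r * real n) * (v - u)"
      using horiz[of "s * real n" for n] that by (intro always_eventually) (simp add: abs_mult)
    show "(\<lambda>n. C * exp (- r * real n) * (v - u)) \<longlonglongrightarrow> 0"
      using decay(2) by real_asymp
  qed
  define L where "L x n = (\<integral>y. indicator {- real n..real n} y *\<^sub>R f (Complex x y) \<partial>lborel)" for x and n :: nat
  have "(\<lambda>n. ((F (Complex v (1 * real n)) - F (Complex u (1 * real n)))
      - (F (Complex v ((-1) * real n)) - F (Complex u ((-1) * real n)))) / \<i>) \<longlonglongrightarrow> (0 - 0) / \<i>"
    by (intro tendsto_intros horiz0) auto
  also have "(\<lambda>n. ((F (Complex v (1 * real n)) - F (Complex u (1 * real n)))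
      - (F (Complex v ((-1) * real n)) - F (Complex u ((-1) * real n)))) / \<i>) = (\<lambda>n. L v n - L u n)"
    using uv by (auto simp: L_def int field_simps)
  finally have 0: "(\<lambda>n. L v n - L u n) \<longlonglongrightarrow> 0" by simp
  have lim: "L x \<longlonglongrightarrow> (\<integral>y. f (Complex x y) \<partial>lborel)" if "u \<le> x" "x \<le> v" for x
    unfolding L_def
    by (intro integral_symmetric_intervals_tendsto integrable_on_vertical_line[OF _ decay(2) cont])
      (use decay that in \<open>auto simp: S_def\<close>)
  have "(\<lambda>n. L v n - L u n) \<longlonglongrightarrow> (\<integral>y. f (Complex v y) \<partial>lborel) - (\<integral>y. f (Complex u y) \<partial>lborel)"
    using uv by (intro tendsto_diff lim) auto
  from LIMSEQ_unique[OF this 0] show ?thesis by simp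
qed

section \<open>The de Branges--Wilson integral\<close>

definition Gamma_pair :: "complex \<Rightarrow> complex \<Rightarrow> complex" where
  "Gamma_pair p z = Gamma (p + z) * Gamma (p - z)"

text \<open>
  The last factor is \<open>1 / (\<Gamma>(2 z) \<Gamma>(- 2 z))\<close>, written as the entire function that the reflection formula makes of it.
  The three-parameter weight is the limit of the four-parameter one, suitably normalized, when the real part of
  \<open>a\<close> tends to infinity.
\<close>

definition wilson_weight3 :: "complex \<Rightarrow> complex \<Rightarrow> complex \<Rightarrow> complex \<Rightarrow> complex" where
  "wilson_weight3 b c d z =
     Gamma_pair b z * Gamma_pair c z * Gamma_pair d z * (- 2 * z * sin (2 * of_real pi * z) / of_real pi)"

definition wilson_weight :: "complex \<Rightarrow> complex \<Rightarrow> complex \<Rightarrow> complex \<Rightarrow> complex \<Rightarrow> complex" where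
  "wilson_weight a b c d z = Gamma_pair a z * wilson_weight3 b c d z"

definition wilson_integral :: "complex \<Rightarrow> complex \<Rightarrow> complex \<Rightarrow> complex \<Rightarrow> complex" where
  "wilson_integral a b c d = (\<integral>y. wilson_weight a b c d (Complex 0 y) \<partial>lborel)"

definition wilson_gammas :: "complex \<Rightarrow> complex \<Rightarrow> complex \<Rightarrow> complex \<Rightarrow> complex" where
  "wilson_gammas a b c d =
     Gamma (a + b) * Gamma (a + c) * Gamma (a + d) * Gamma (b + c) * Gamma (b + d) * Gamma (c + d)
       / Gamma (a + b + c + d)"

lemma not_nonpos_Ints_if_Re_pos: "0 < Re z \<Longrightarrow> z \<notin> \<int>\<^sub>\<le>\<^sub>0"
  by (auto elim!: nonpos_Ints_cases)

lemma Gamma_nonzero_if_Re_pos: "0 < Re z \<Longrightarrow> Gamma z \<noteq> 0"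
  by (simp add: Gamma_eq_zero_iff not_nonpos_Ints_if_Re_pos)

lemma exp_decay_Gamma_pair:
  assumes "- Re p < u" "v < Re p"
  shows "exp_decay {z. u \<le> Re z \<and> Re z \<le> v} (5 * pi / 6) (Gamma_pair p)"
  using exp_decay_mult[OF exp_decay_Gamma_add[of p u v] exp_decay_Gamma_diff[of v p u]] assms
  unfolding Gamma_pair_def by (simp add: field_simps)

lemma holomorphic_Gamma_pair:
  assumes "\<And>z. z \<in> S \<Longrightarrow> \<bar>Re z\<bar> < Re p"
  shows "Gamma_pair p holomorphic_on S"
  unfolding Gamma_pair_def
proof (intro holomorphic_intros)
  show "p + z \<notin> \<int>\<^sub>\<le>\<^sub>0" "p - z \<notin> \<int>\<^sub>\<le>\<^sub>0" if "z \<in> S" for z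
    using assms[OF that] by (auto intro!: not_nonpos_Ints_if_Re_pos)
qed

lemma exp_decay_wilson_kernel:
  "exp_decay {z. u \<le> Re z \<and> Re z \<le> v} (- (9 * pi / 4)) (\<lambda>z. - 2 * z * sin (2 * of_real pi * z) / of_real pi)"
proof -
  have "exp_decay {z. u \<le> Re z \<and> Re z \<le> v} (0 + (- (pi / 4) + - (2 * pi)))
      (\<lambda>z. (- 2 / of_real pi) * (z * sin (2 * of_real pi * z)))"
    by (intro exp_decay_mult exp_decay_const exp_decay_id exp_decay_sin) simp
  moreover have "0 + (- (pi / 4) + - (2 * pi)) = - (9 * pi / 4)" by simp
  ultimately show ?thesis by (simp add: mult.assoc)
qed

lemma exp_decay_wilson_weight3:
  assumes "0 < Re b" "0 < Re c" "0 < Re d"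
  shows "exp_decay {z. 0 \<le> Re z \<and> Re z \<le> 0} (pi / 4) (wilson_weight3 b c d)"
proof -
  have "exp_decay {z. 0 \<le> Re z \<and> Re z \<le> 0} (5 * pi / 6 + 5 * pi / 6 + 5 * pi / 6 + - (9 * pi / 4)) (wilson_weight3 b c d)"
    unfolding wilson_weight3_def
    by (intro exp_decay_mult exp_decay_Gamma_pair exp_decay_wilson_kernel) (use assms in auto)
  thus ?thesis by (rule exp_decay_weaken) (simp add: field_simps)
qed

lemma continuous_on_wilson_weight3:
  assumes "0 < Re b" "0 < Re c" "0 < Re d"
  shows "continuous_on {z. 0 \<le> Re z \<and> Re z \<le> 0} (wilson_weight3 b c d)"
  unfolding wilson_weight3_def
  by (intro continuous_intros holomorphic_on_imp_continuous_on[OF holomorphic_Gamma_pair]) (use assms in auto)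

lemma integrable_wilson_weight3:
  assumes "0 < Re b" "0 < Re c" "0 < Re d"
  shows "integrable lborel (\<lambda>y. wilson_weight3 b c d (Complex 0 y))"
  by (rule integrable_on_vertical_line[OF exp_decay_wilson_weight3 _ continuous_on_wilson_weight3])
    (use assms in auto)

lemma integrable_wilson_weight:
  assumes "0 < Re a" "0 < Re b" "0 < Re c" "0 < Re d"
  shows "integrable lborel (\<lambda>y. wilson_weight a b c d (Complex 0 y))"
proof (rule integrable_on_vertical_line)
  show "exp_decay {z. 0 \<le> Re z \<and> Re z \<le> 0} (5 * pi / 6 + pi / 4) (wilson_weight a b c d)"
    unfolding wilson_weight_def
    by (intro exp_decay_mult exp_decay_Gamma_pair exp_decay_wilson_weight3) (use assms in auto)
  show "continuous_on {z. 0 \<le> Re z \<and> Re z \<le> 0} (wilson_weight a b c d)"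
    unfolding wilson_weight_def
    by (intro continuous_intros holomorphic_on_imp_continuous_on[OF holomorphic_Gamma_pair]
          continuous_on_wilson_weight3) (use assms in auto)
qed (auto intro: add_pos_pos)

lemma Gamma_pair_plus_1:
  assumes "\<bar>Re z\<bar> < Re p"
  shows "Gamma_pair (p + 1) z = (p\<^sup>2 - z\<^sup>2) * Gamma_pair p z"
proof -
  have "Gamma (p + z + 1) = (p + z) * Gamma (p + z)" "Gamma (p - z + 1) = (p - z) * Gamma (p - z)"
    using assms by (auto intro!: Gamma_plus1 not_nonpos_Ints_if_Re_pos)
  moreover have "p + 1 + z = p + z + 1" "p + 1 - z = p - z + 1" by auto
  ultimately have "Gamma_pair (p + 1) z = ((p + z) * (p - z)) * Gamma_pair p z"
    unfolding Gamma_pair_def by (simp only: mult_ac)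
  also have "(p + z) * (p - z) = p\<^sup>2 - z\<^sup>2" by (simp add: power2_eq_square algebra_simps)
  finally show ?thesis .
qed

lemma wilson_weight_plus_1:
  assumes "0 < Re a"
  shows "wilson_weight (a + 1) b c d (Complex 0 y)
    = a\<^sup>2 * wilson_weight a b c d (Complex 0 y) + of_real (y\<^sup>2) * wilson_weight a b c d (Complex 0 y)"
proof -
  have "(Complex 0 y)\<^sup>2 = - of_real (y\<^sup>2)" by (simp add: complex_eq_iff power2_eq_square)
  hence "Gamma_pair (a + 1) (Complex 0 y) = (a\<^sup>2 + of_real (y\<^sup>2)) * Gamma_pair a (Complex 0 y)"
    using Gamma_pair_plus_1[of "Complex 0 y" a] assms by simp
  thus ?thesis
    unfolding wilson_weight_def by (simp only: ring_distribs mult.assoc)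
qed

lemma integrable_wilson_weight_y2:
  assumes "0 < Re a" "0 < Re b" "0 < Re c" "0 < Re d"
  shows "integrable lborel (\<lambda>y. of_real (y\<^sup>2) * wilson_weight a b c d (Complex 0 y))"
proof -
  have "integrable lborel (\<lambda>y. wilson_weight (a + 1) b c d (Complex 0 y) - a\<^sup>2 * wilson_weight a b c d (Complex 0 y))"
    using assms by (intro Bochner_Integration.integrable_diff integrable_mult_right integrable_wilson_weight) auto
  thus ?thesis using assms by (simp add: wilson_weight_plus_1)
qed

lemma Gamma_pair_half_shift:
  assumes "Re z = 0" "0 < Re p"
  shows "Gamma_pair (p + 1/2) (z - 1/2) = (p - z) * Gamma_pair p z"
    and "Gamma_pair (p + 1/2) (z + 1/2) = (p + z) * Gamma_pair p z"
proof -
  have "Gamma (p + z + 1) = (p + z) * Gamma (p + z)" "Gamma (p - z + 1) = (p - z) * Gamma (p - z)"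
    using assms by (auto intro!: Gamma_plus1 not_nonpos_Ints_if_Re_pos)
  moreover have "p + 1/2 + (z - 1/2) = p + z" "p + 1/2 - (z - 1/2) = p - z + 1"
    "p + 1/2 + (z + 1/2) = p + z + 1" "p + 1/2 - (z + 1/2) = p - z" by simp_all
  ultimately show "Gamma_pair (p + 1/2) (z - 1/2) = (p - z) * Gamma_pair p z"
    "Gamma_pair (p + 1/2) (z + 1/2) = (p + z) * Gamma_pair p z"
    unfolding Gamma_pair_def by (simp_all only: mult_ac)
qed

text \<open>
  The contour shift. With \<open>h\<close> built from the parameters \<open>p + 1/2\<close>, the recurrence of \<open>\<Gamma>\<close> turns \<open>h(z - 1/2)\<close> and
  \<open>h(z + 1/2)\<close> into the product of the \<open>\<Gamma>(p + z) \<Gamma>(p - z)\<close> times \<open>\<Prod>\<^sub>p (p - z)\<close> and \<open>\<Prod>\<^sub>p (p + z)\<close> respectively,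
  times \<open>- sin(2 \<pi> z)\<close>. The difference of the two quartic polynomials is \<open>- 2 z (e\<^sub>1 z\<^sup>2 + e\<^sub>3)\<close>, and the factor
  \<open>z sin(2 \<pi> z)\<close> completes the weight.
\<close>

lemma wilson_first_moment_relation:
  assumes "0 < Re a" "0 < Re b" "0 < Re c" "0 < Re d"
  shows "(a + b + c + d) * (\<integral>y. of_real (y\<^sup>2) * wilson_weight a b c d (Complex 0 y) \<partial>lborel)
    = (a * b * c + a * b * d + a * c * d + b * c * d) * wilson_integral a b c d"
proof -
  define e1 where "e1 = a + b + c + d"
  define e3 where "e3 = a * b * c + a * b * d + a * c * d + b * c * d"
  define W where "W y = wilson_weight a b c d (Complex 0 y)" for y
  define h where "h z = Gamma_pair (a + 1/2) z * Gamma_pair (b + 1/2) z * Gamma_pair (c + 1/2) z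
    * Gamma_pair (d + 1/2) z * sin (2 * of_real pi * z)" for z
  define m where "m = Min {Re a, Re b, Re c, Re d}"
  have m: "0 < m" "m \<le> Re a" "m \<le> Re b" "m \<le> Re c" "m \<le> Re d"
    using assms by (auto simp: m_def)
  have hol: "h holomorphic_on {z. - (1/2 + m) < Re z \<and> Re z < 1/2 + m}"
    unfolding h_def by (intro holomorphic_intros holomorphic_Gamma_pair) (use m in auto)
  have "exp_decay {z. - (1/2) \<le> Re z \<and> Re z \<le> 1/2}
      (5 * pi / 6 + 5 * pi / 6 + 5 * pi / 6 + 5 * pi / 6 + - (2 * pi)) h"
    unfolding h_def by (intro exp_decay_mult exp_decay_Gamma_pair exp_decay_sin) (use assms in auto)
  hence decay: "exp_decay {z. - (1/2) \<le> Re z \<and> Re z \<le> 1/2} pi h"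
    by (rule exp_decay_weaken) (simp add: field_simps)
  have cont: "continuous_on {z. - (1/2) \<le> Re z \<and> Re z \<le> 1/2} h"
    by (rule continuous_on_subset[OF holomorphic_on_imp_continuous_on[OF hol]]) (use m in auto)
  have "(\<integral>y. h (Complex (- (1/2)) y) \<partial>lborel) = (\<integral>y. h (Complex (1/2) y) \<partial>lborel)"
    by (rule vertical_line_shift[OF hol _ _ _ decay]) (use m in auto)
  moreover have "integrable lborel (\<lambda>y. h (Complex x y))" if "x = 1/2 \<or> x = - (1/2)" for x
    by (rule integrable_on_vertical_line[OF decay _ cont]) (use that in auto)
  ultimately have "(\<integral>y. h (Complex (- (1/2)) y) - h (Complex (1/2) y) \<partial>lborel) = 0"
    by (subst Bochner_Integration.integral_diff) auto
  moreover have "h (Complex (- (1/2)) y) - h (Complex (1/2) y)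
      = of_real pi * (e1 * (of_real (y\<^sup>2) * W y) - e3 * W y)" for y
  proof -
    define z where "z = Complex 0 y"
    have z: "Re z = 0" "z\<^sup>2 = - of_real (y\<^sup>2)" by (auto simp: z_def complex_eq_iff power2_eq_square)
    have c: "Complex (- (1/2)) y = z - 1/2" "Complex (1/2) y = z + 1/2"
      by (auto simp: z_def complex_eq_iff)
    have sin: "sin (2 * of_real pi * (z - 1/2)) = - sin (2 * of_real pi * z)"
         "sin (2 * of_real pi * (z + 1/2)) = - sin (2 * of_real pi * z)"
      by (simp_all add: ring_distribs sin_diff sin_add flip: sin_of_real cos_of_real)
    define G where "G = Gamma_pair a z * Gamma_pair b z * Gamma_pair c z * Gamma_pair d z"
    have W: "W y = G * (- 2 * z * sin (2 * of_real pi * z) / of_real pi)"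
      by (simp add: W_def wilson_weight_def wilson_weight3_def G_def z_def mult_ac)
    have "h (Complex (- (1/2)) y) - h (Complex (1/2) y)
      = - sin (2 * of_real pi * z) * G * ((a - z) * (b - z) * (c - z) * (d - z) - (a + z) * (b + z) * (c + z) * (d + z))"
    proof -
      have "h (z - 1/2) = - sin (2 * of_real pi * z) * G * ((a - z) * (b - z) * (c - z) * (d - z))"
        unfolding h_def sin Gamma_pair_half_shift(1)[OF z(1) assms(1)] Gamma_pair_half_shift(1)[OF z(1) assms(2)]
          Gamma_pair_half_shift(1)[OF z(1) assms(3)] Gamma_pair_half_shift(1)[OF z(1) assms(4)] G_def
        by (simp only: mult_ac mult_minus_left mult_minus_right)
      moreover have "h (z + 1/2) = - sin (2 * of_real pi * z) * G * ((a + z) * (b + z) * (c + z) * (d + z))"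
        unfolding h_def sin Gamma_pair_half_shift(2)[OF z(1) assms(1)] Gamma_pair_half_shift(2)[OF z(1) assms(2)]
          Gamma_pair_half_shift(2)[OF z(1) assms(3)] Gamma_pair_half_shift(2)[OF z(1) assms(4)] G_def
        by (simp only: mult_ac mult_minus_left mult_minus_right)
      ultimately show ?thesis unfolding c by (simp only: right_diff_distrib)
    qed
    also have "(a - z) * (b - z) * (c - z) * (d - z) - (a + z) * (b + z) * (c + z) * (d + z)
      = - 2 * z * (e1 * z\<^sup>2 + e3)"
      unfolding e1_def e3_def power2_eq_square by algebra
    also have "- sin (2 * of_real pi * z) * G * (- 2 * z * (e1 * z\<^sup>2 + e3)) = - of_real pi * (e1 * z\<^sup>2 + e3) * W y"
      by (simp add: W)
    finally show ?thesis unfolding z by (simp add: algebra_simps)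
  qed
  ultimately have "(\<integral>y. of_real pi * (e1 * (of_real (y\<^sup>2) * W y) - e3 * W y) \<partial>lborel) = 0"
    by simp
  moreover have "(\<integral>y. of_real pi * (e1 * (of_real (y\<^sup>2) * W y) - e3 * W y) \<partial>lborel)
     = of_real pi * (e1 * (\<integral>y. of_real (y\<^sup>2) * W y \<partial>lborel) - e3 * (\<integral>y. W y \<partial>lborel))"
    using integrable_wilson_weight[OF assms] integrable_wilson_weight_y2[OF assms]
    unfolding W_def by (simp only: integral_mult_right_zero Bochner_Integration.integral_diff integrable_mult_right)
  ultimately show ?thesis
    by (simp add: e1_def e3_def W_def wilson_integral_def)
qed

text \<open>
  Multiplying the weight by \<open>a\<^sup>2 + y\<^sup>2\<close> raises \<open>a\<close> by one, and \<open>a\<^sup>2 e\<^sub>1 + e\<^sub>3 = (a + b) (a + c) (a + d)\<close>.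
\<close>

lemma wilson_integral_plus_1:
  assumes "0 < Re a" "0 < Re b" "0 < Re c" "0 < Re d"
  shows "(a + b + c + d) * wilson_integral (a + 1) b c d
    = (a + b) * (a + c) * (a + d) * wilson_integral a b c d"
proof -
  have "wilson_integral (a + 1) b c d = a\<^sup>2 * wilson_integral a b c d
      + (\<integral>y. of_real (y\<^sup>2) * wilson_weight a b c d (Complex 0 y) \<partial>lborel)"
    unfolding wilson_integral_def
    using integrable_wilson_weight[OF assms] integrable_wilson_weight_y2[OF assms] assms(1)
    by (simp only: wilson_weight_plus_1 Bochner_Integration.integral_add integral_mult_right_zero integrable_mult_right)
  hence "(a + b + c + d) * wilson_integral (a + 1) b c d
     = (a + b + c + d) * a\<^sup>2 * wilson_integral a b c d
      + (a * b * c + a * b * d + a * c * d + b * c * d) * wilson_integral a b c d"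
    using wilson_first_moment_relation[OF assms] by (simp only: ring_distribs mult.assoc)
  also have "\<dots> = (a + b) * (a + c) * (a + d) * wilson_integral a b c d"
    unfolding power2_eq_square by algebra
  finally show ?thesis .
qed

lemma wilson_gammas_plus_1:
  assumes "0 < Re a" "0 < Re b" "0 < Re c" "0 < Re d"
  shows "(a + b + c + d) * wilson_gammas (a + 1) b c d = (a + b) * (a + c) * (a + d) * wilson_gammas a b c d"
proof -
  have "Gamma (a + b + 1) = (a + b) * Gamma (a + b)" "Gamma (a + c + 1) = (a + c) * Gamma (a + c)"
       "Gamma (a + d + 1) = (a + d) * Gamma (a + d)"
       "Gamma (a + b + c + d + 1) = (a + b + c + d) * Gamma (a + b + c + d)"
    using assms by (auto intro!: Gamma_plus1 not_nonpos_Ints_if_Re_pos)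
  moreover have sums: "a + 1 + b = a + b + 1" "a + 1 + c = a + c + 1" "a + 1 + d = a + d + 1"
    "a + b + 1 + c + d = a + b + c + d + 1" by auto
  moreover have "a + b + c + d \<noteq> 0" using assms by (auto simp: complex_eq_iff)
  ultimately show ?thesis unfolding wilson_gammas_def sums by simp
qed

lemma wilson_gammas_nonzero:
  assumes "0 < Re a" "0 < Re b" "0 < Re c" "0 < Re d"
  shows "wilson_gammas a b c d \<noteq> 0"
  unfolding wilson_gammas_def using assms by (simp add: Gamma_nonzero_if_Re_pos)

definition wilson_ratio :: "complex \<Rightarrow> complex \<Rightarrow> complex \<Rightarrow> complex \<Rightarrow> complex" where
  "wilson_ratio a b c d = wilson_integral a b c d / wilson_gammas a b c d"

lemma wilson_ratio_plus_of_nat: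
  assumes "0 < Re a" "0 < Re b" "0 < Re c" "0 < Re d"
  shows "wilson_ratio (a + of_nat n) b c d = wilson_ratio a b c d"
proof (induction n)
  case (Suc n)
  define a' where "a' = a + of_nat n"
  have a': "0 < Re a'" using assms by (simp add: a'_def)
  define s where "s = a' + b + c + d"
  define t where "t = (a' + b) * (a' + c) * (a' + d)"
  have "p \<noteq> 0" if "0 < Re p" for p using that by auto
  hence "s \<noteq> 0" "t \<noteq> 0" using a' assms by (simp_all add: s_def t_def)
  hence "wilson_integral (a' + 1) b c d = t / s * wilson_integral a' b c d"
     "wilson_gammas (a' + 1) b c d = t / s * wilson_gammas a' b c d" "t / s \<noteq> 0"
    using wilson_integral_plus_1[OF a' assms(2-4), folded s_def t_def]
      wilson_gammas_plus_1[OF a' assms(2-4), folded s_def t_def]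
    by (simp_all add: nonzero_eq_divide_eq mult.commute)
  hence "wilson_ratio (a' + 1) b c d = wilson_ratio a' b c d"
    unfolding wilson_ratio_def by (metis nonzero_mult_divide_mult_cancel_left)
  thus ?case using Suc by (simp add: a'_def add_ac)
qed simp

lemma wilson_ratio_permute:
  "wilson_ratio a b c d = wilson_ratio b a c d"
  "wilson_ratio a b c d = wilson_ratio c b a d"
  "wilson_ratio a b c d = wilson_ratio d b c a"
  unfolding wilson_ratio_def wilson_integral_def wilson_weight_def wilson_weight3_def wilson_gammas_def
  by (simp_all only: mult_ac add_ac)

text \<open>
  Normalized so as to tend to \<open>1\<close>: \<open>\<Gamma>(p + n + 1)\<close> is asymptotic to \<open>n! n\<^sup>p\<close>.
\<close>

definition Gamma_shift_quotient :: "nat \<Rightarrow> 'a \<Rightarrow> 'a :: Gamma" where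
  "Gamma_shift_quotient n p = Gamma (p + of_nat n + 1) / (fact n * exp (p * of_real (ln (real n))))"

lemma Gamma_shift_quotient_LIMSEQ:
  assumes "p \<notin> \<int>\<^sub>\<le>\<^sub>0"
  shows "(\<lambda>n. Gamma_shift_quotient n p) \<longlonglongrightarrow> 1"
proof -
  have "(\<lambda>n. Gamma p / Gamma_series p n) \<longlonglongrightarrow> Gamma p / Gamma p"
    using assms by (intro tendsto_intros Gamma_series_LIMSEQ) (simp add: Gamma_eq_zero_iff)
  moreover have "Gamma p / Gamma_series p n = Gamma_shift_quotient n p" for n
  proof -
    have "p + of_nat (Suc n) = p + of_nat n + 1" by simp
    hence "Gamma (p + of_nat n + 1) = pochhammer p (Suc n) * Gamma p"
      using pochhammer_Gamma[OF assms, of "Suc n"] assms by (simp add: Gamma_eq_zero_iff add_ac)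
    thus ?thesis by (simp add: Gamma_shift_quotient_def Gamma_series_def field_simps)
  qed
  ultimately show ?thesis using assms by (simp add: Gamma_eq_zero_iff)
qed

lemma norm_Gamma_shift_quotient_le:
  assumes "0 < Re p"
  shows "cmod (Gamma_shift_quotient n p) \<le> Gamma_shift_quotient n (Re p)"
proof -
  have "cmod (Gamma (p + of_nat n + 1)) \<le> Gamma (Re p + of_nat n + 1)"
    using norm_Gamma_le_Gamma_Re[of "p + of_nat n + 1"] assms by simp
  thus ?thesis
    by (simp add: Gamma_shift_quotient_def norm_divide norm_mult divide_right_mono)
qed

text \<open>
  By periodicity the ratio at \<open>a\<close> is the limit of the ratios at \<open>a + n + 1\<close>. After division of numerator and
  denominator by \<open>(n! n\<^sup>a)\<^sup>2\<close> both converge: the integral by dominated convergence, since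
  \<open>\<bar>\<Gamma>(a + n + 1 + i y)\<bar> \<le> \<Gamma>(Re a + n + 1)\<close>, and the Gamma quotient because all powers of \<open>n\<close> cancel.
\<close>

lemma wilson_ratio_eq_3:
  assumes "0 < Re a" "0 < Re b" "0 < Re c" "0 < Re d"
  shows "wilson_ratio a b c d = (\<integral>y. wilson_weight3 b c d (Complex 0 y) \<partial>lborel)
    / (Gamma (b + c) * Gamma (b + d) * Gamma (c + d))"
proof -
  let ?g = "\<lambda>n p. Gamma_shift_quotient n p :: complex"
  define N where "N n = (fact n * exp (a * of_real (ln (real n))))\<^sup>2" for n :: nat
  have N0: "N n \<noteq> 0" for n by (simp add: N_def)
  have gp: "Gamma_pair (a + of_nat (Suc n)) z / N n = ?g n (a + z) * ?g n (a - z)" for n z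
  proof -
    have "exp (a * of_real (ln (real n))) * exp (a * of_real (ln (real n)))
        = exp ((a + z) * of_real (ln (real n))) * exp ((a - z) * of_real (ln (real n)))"
      by (simp add: mult_exp_exp algebra_simps)
    hence "N n = (fact n * exp ((a + z) * of_real (ln (real n)))) * (fact n * exp ((a - z) * of_real (ln (real n))))"
      unfolding N_def power2_eq_square by (simp add: mult_ac)
    moreover have "a + of_nat (Suc n) + z = a + z + of_nat n + 1" "a + of_nat (Suc n) - z = a - z + of_nat n + 1"
      by simp_all
    ultimately show ?thesis
      unfolding Gamma_pair_def Gamma_shift_quotient_def by (simp only: times_divide_times_eq)
  qed
  have "convergent (\<lambda>n. Gamma_shift_quotient n (Re a))"
    by (rule convergentI[OF Gamma_shift_quotient_LIMSEQ]) (use assms in \<open>auto elim!: nonpos_Ints_cases\<close>)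
  then obtain B where B: "\<And>n. \<bar>Gamma_shift_quotient n (Re a)\<bar> \<le> B"
    using BseqE[OF convergent_imp_Bseq] by (metis real_norm_def)
  have gB: "cmod (?g n (a + z)) \<le> B" if "Re z = 0" for n z
    using norm_Gamma_shift_quotient_le[of "a + z" n] B[of n] that assms by simp
  have "0 \<le> B" using B[of 0] by linarith
  have 1: "(\<lambda>n. \<integral>y. ?g n (a + Complex 0 y) * ?g n (a - Complex 0 y) * wilson_weight3 b c d (Complex 0 y) \<partial>lborel)
      \<longlonglongrightarrow> (\<integral>y. wilson_weight3 b c d (Complex 0 y) \<partial>lborel)"
  proof (rule integral_dominated_convergence[where w = "\<lambda>y. B * B * cmod (wilson_weight3 b c d (Complex 0 y))"])
    show "AE y in lborel. (\<lambda>n. ?g n (a + Complex 0 y) * ?g n (a - Complex 0 y) * wilson_weight3 b c d (Complex 0 y))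
        \<longlonglongrightarrow> wilson_weight3 b c d (Complex 0 y)"
    proof (rule AE_I2)
      fix y
      have "(\<lambda>n. ?g n (a + Complex 0 y) * ?g n (a - Complex 0 y) * wilson_weight3 b c d (Complex 0 y))
          \<longlonglongrightarrow> 1 * 1 * wilson_weight3 b c d (Complex 0 y)"
        by (intro tendsto_mult tendsto_const Gamma_shift_quotient_LIMSEQ not_nonpos_Ints_if_Re_pos)
          (use assms in auto)
      thus "(\<lambda>n. ?g n (a + Complex 0 y) * ?g n (a - Complex 0 y) * wilson_weight3 b c d (Complex 0 y))
          \<longlonglongrightarrow> wilson_weight3 b c d (Complex 0 y)" by simp
    qed
    show "AE y in lborel. norm (?g n (a + Complex 0 y) * ?g n (a - Complex 0 y) * wilson_weight3 b c d (Complex 0 y))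
        \<le> B * B * cmod (wilson_weight3 b c d (Complex 0 y))" for n
      using gB[of "Complex 0 y" n for y] gB[of "- Complex 0 y" n for y] \<open>0 \<le> B\<close>
      by (intro AE_I2) (auto simp: norm_mult intro!: mult_right_mono mult_mono)
    show "(\<lambda>y. ?g n (a + Complex 0 y) * ?g n (a - Complex 0 y) * wilson_weight3 b c d (Complex 0 y)) \<in> borel_measurable lborel" for n
    proof -
      have "integrable lborel (\<lambda>y. wilson_weight (a + of_nat (Suc n)) b c d (Complex 0 y) / N n)"
        using assms by (intro integrable_divide integrable_wilson_weight) auto
      thus ?thesis unfolding gp[symmetric] wilson_weight_def
        by (simp only: borel_measurable_integrable times_divide_eq_left)
    qed
  qed (use integrable_wilson_weight3[OF assms(2-4)] in \<open>auto dest: borel_measurable_integrable\<close>)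
  have "(\<integral>y. ?g n (a + Complex 0 y) * ?g n (a - Complex 0 y) * wilson_weight3 b c d (Complex 0 y) \<partial>lborel)
      = wilson_integral (a + of_nat (Suc n)) b c d / N n" for n
    unfolding gp[symmetric] wilson_integral_def wilson_weight_def
    by (simp only: integral_divide_zero[symmetric] times_divide_eq_left)
  hence 2: "(\<lambda>n. wilson_integral (a + of_nat (Suc n)) b c d / N n) \<longlonglongrightarrow> (\<integral>y. wilson_weight3 b c d (Complex 0 y) \<partial>lborel)"
    using 1 by (simp only:)
  have gam: "wilson_gammas (a + of_nat (Suc n)) b c d / N n =
     ?g n (a + b) * ?g n (a + c) * ?g n (a + d) / ?g n (a + b + c + d) * (Gamma (b + c) * Gamma (b + d) * Gamma (c + d))" for n
  proof -
    define e where "e p = exp (p * of_real (ln (real n)))" for p :: complex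
    have e: "e (p + q) = e p * e q" for p q by (simp add: e_def ring_distribs exp_add)
    have e0: "e p \<noteq> 0" for p by (simp add: e_def)
    define f :: complex where "f = fact n"
    have f0: "f \<noteq> 0" by (simp add: f_def)
    have G: "Gamma (p + of_nat (Suc n)) = ?g n p * f * e p" for p
      by (simp add: Gamma_shift_quotient_def e_def f_def add_ac)
    have Ge: "N n = f * f * e a * e a" by (simp add: N_def e_def f_def power2_eq_square)
    have sum: "a + of_nat (Suc n) + b = (a + b) + of_nat (Suc n)" "a + of_nat (Suc n) + c = (a + c) + of_nat (Suc n)"
        "a + of_nat (Suc n) + d = (a + d) + of_nat (Suc n)"
        "(a + b) + of_nat (Suc n) + c + d = (a + b + c + d) + of_nat (Suc n)" by simp_all
    have "wilson_gammas (a + of_nat (Suc n)) b c d =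
      (?g n (a + b) * f * e (a + b)) * (?g n (a + c) * f * e (a + c)) * (?g n (a + d) * f * e (a + d))
         * Gamma (b + c) * Gamma (b + d) * Gamma (c + d) / (?g n (a + b + c + d) * f * e (a + b + c + d))"
      unfolding wilson_gammas_def sum G ..
    also have "\<dots> = N n * (?g n (a + b) * ?g n (a + c) * ?g n (a + d) / ?g n (a + b + c + d) * (Gamma (b + c) * Gamma (b + d) * Gamma (c + d)))"
      unfolding Ge e using e0 f0 by (cases "?g n (a + b + c + d) = 0") (simp_all add: divide_simps)
    finally show ?thesis using N0[of n] by simp
  qed
  have 3: "(\<lambda>n. wilson_gammas (a + of_nat (Suc n)) b c d / N n) \<longlonglongrightarrow> 1 * 1 * 1 / 1 * (Gamma (b + c) * Gamma (b + d) * Gamma (c + d))"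
    unfolding gam using assms
    by (intro tendsto_mult tendsto_divide tendsto_const Gamma_shift_quotient_LIMSEQ not_nonpos_Ints_if_Re_pos) auto
  have G0: "1 * 1 * 1 / 1 * (Gamma (b + c) * Gamma (b + d) * Gamma (c + d)) \<noteq> 0"
    using assms by (simp add: Gamma_nonzero_if_Re_pos)
  have "(wilson_integral (a + of_nat (Suc n)) b c d / N n) / (wilson_gammas (a + of_nat (Suc n)) b c d / N n)
     = wilson_ratio a b c d" for n
    using N0[of n] wilson_ratio_plus_of_nat[OF assms, of "Suc n"] unfolding wilson_ratio_def by (simp del: of_nat_Suc)
  with tendsto_divide[OF 2 3 G0] show ?thesis
    by (simp del: of_nat_Suc add: LIMSEQ_const_iff)
qed

lemma wilson_ratio_const:
  assumes "0 < Re a" "0 < Re b" "0 < Re c" "0 < Re d"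
  shows "wilson_ratio a b c d = wilson_ratio (1/2) (1/2) (1/2) (1/2)"
proof -
  have *: "wilson_ratio a b c d = wilson_ratio (1/2) b c d"
    if "0 < Re a" "0 < Re b" "0 < Re c" "0 < Re d" for a b c d
    using that by (simp add: wilson_ratio_eq_3)
  have "wilson_ratio a b c d = wilson_ratio (1/2) b c d" using assms by (intro *) auto
  also have "\<dots> = wilson_ratio b (1/2) c d" by (rule wilson_ratio_permute)
  also have "\<dots> = wilson_ratio (1/2) (1/2) c d" using assms by (intro *) auto
  also have "\<dots> = wilson_ratio c (1/2) (1/2) d" by (rule wilson_ratio_permute)
  also have "\<dots> = wilson_ratio (1/2) (1/2) (1/2) d" using assms by (intro *) auto
  also have "\<dots> = wilson_ratio d (1/2) (1/2) (1/2)" by (rule wilson_ratio_permute)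
  also have "\<dots> = wilson_ratio (1/2) (1/2) (1/2) (1/2)" using assms by (intro *) auto
  finally show ?thesis .
qed

text \<open>
  At the parameter \<open>1/2\<close> the reflection formula reads \<open>\<Gamma>(1/2 + z) \<Gamma>(1/2 - z) = \<pi> / cos(\<pi> z)\<close>.
\<close>

lemma wilson_weight3_half:
  "wilson_weight3 (1/2) (1/2) (1/2) (Complex 0 y)
    = of_real (4 * pi\<^sup>2 * y * sinh (pi * y) / (cosh (pi * y))\<^sup>2)"
proof -
  define z where "z = Complex 0 y"
  have z: "z = \<i> * of_real y" by (simp add: z_def complex_eq_iff)
  have piz: "of_real pi * z = \<i> * of_real (pi * y)" by (simp add: z)
  have cos: "cos (of_real pi * z) = of_real (cosh (pi * y))"
    unfolding piz cos_i_times by (simp add: cosh_field_def exp_of_real[symmetric] exp_minus)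
  have sin: "sin (of_real pi * z) = \<i> * of_real (sinh (pi * y))"
    unfolding piz sin_i_times by (simp add: sinh_field_def exp_of_real[symmetric] exp_minus)
  have "Gamma_pair (1/2) z = of_real pi / sin (of_real pi * (1/2 + z))"
    using Gamma_reflection_complex[of "1/2 + z"] by (simp add: Gamma_pair_def)
  also have "sin (of_real pi * (1/2 + z)) = cos (of_real pi * z)"
    by (simp add: ring_distribs sin_add flip: sin_of_real cos_of_real)
  finally have G: "Gamma_pair (1/2) z = of_real pi / of_real (cosh (pi * y))" by (simp add: cos)
  have sin2: "sin (2 * of_real pi * z) = 2 * sin (of_real pi * z) * cos (of_real pi * z)"
    by (simp only: mult.assoc sin_double)
  have kernel: "- 2 * z * sin (2 * of_real pi * z) = of_real (4 * y * sinh (pi * y) * cosh (pi * y))"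
    unfolding sin2 sin cos by (simp add: z complex_eq_iff)
  show ?thesis
    unfolding wilson_weight3_def z_def[symmetric] G kernel
    by (simp add: power2_eq_square)
qed

lemma wilson_ratio_half: "wilson_ratio (1/2) (1/2) (1/2) (1/2) = 4 * of_real pi"
proof -
  define g where "g y = 4 * pi\<^sup>2 * y * sinh (pi * y) / (cosh (pi * y))\<^sup>2" for y
  define F where "F y = 4 * arctan (sinh (pi * y)) - 4 * pi * y / cosh (pi * y)" for y
  have int': "integrable lborel (\<lambda>y. complex_of_real (g y))"
    using integrable_wilson_weight3[of "1/2" "1/2" "1/2"] unfolding wilson_weight3_half g_def by simp
  have int: "integrable lborel g" using int' by (simp add: complex_of_real_integrable_eq)
  have FTC: "(\<integral>y. indicator {- real n..real n} y *\<^sub>R g y \<partial>lborel) = F (real n) - F (- real n)" for n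
  proof (rule integral_FTC_atLeastAtMost)
    show "(F has_vector_derivative g y) (at y within {- real n..real n})" for y
    proof -
      have c: "cosh (pi * y) \<noteq> 0" "1 + (sinh (pi * y))\<^sup>2 = (cosh (pi * y))\<^sup>2"
        using cosh_square_eq[of "pi * y"] by auto
      have "(F has_field_derivative 4 * ((pi * cosh (pi * y)) / (1 + (sinh (pi * y))\<^sup>2))
          - (4 * pi * cosh (pi * y) - 4 * pi * y * (pi * sinh (pi * y))) / (cosh (pi * y))\<^sup>2) (at y within {- real n..real n})"
        unfolding F_def
        by (rule derivative_eq_intros refl c(1) | simp add: c(1))+ (simp add: power2_eq_square mult_ac divide_inverse)
      moreover have "4 * ((pi * cosh (pi * y)) / (1 + (sinh (pi * y))\<^sup>2))
          - (4 * pi * cosh (pi * y) - 4 * pi * y * (pi * sinh (pi * y))) / (cosh (pi * y))\<^sup>2 = g y"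
        unfolding c(2) using c(1) by (simp add: g_def power2_eq_square divide_simps)
      ultimately show ?thesis by (simp add: has_real_derivative_iff_has_vector_derivative)
    qed
    show "continuous_on {- real n..real n} g"
      unfolding g_def by (intro continuous_intros) auto
  qed simp
  have "(\<lambda>n. F (real n) - F (- real n)) \<longlonglongrightarrow> 4 * pi"
    unfolding F_def sinh_def cosh_def real_scaleR_def by real_asymp
  with integral_symmetric_intervals_tendsto[OF int] have "(\<integral>y. g y \<partial>lborel) = 4 * pi"
    unfolding FTC by (rule LIMSEQ_unique)
  hence "(\<integral>y. wilson_weight3 (1/2) (1/2) (1/2) (Complex 0 y) \<partial>lborel) = of_real (4 * pi)"
    unfolding wilson_weight3_half g_def[symmetric] by simp
  thus ?thesis by (simp add: wilson_ratio_eq_3)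
qed

theorem wilson_integral_eq:
  assumes "0 < Re a" "0 < Re b" "0 < Re c" "0 < Re d"
  shows "wilson_integral a b c d = 4 * of_real pi * wilson_gammas a b c d"
  using wilson_ratio_const[OF assms] wilson_gammas_nonzero[OF assms]
  by (simp add: wilson_ratio_half) (simp add: wilson_ratio_def field_simps)

section \<open>Moments of the Wilson density\<close>

lemma borel_measurable_Gamma [measurable]: "(Gamma :: complex \<Rightarrow> complex) \<in> borel_measurable borel"
proof -
  have eq: "(Gamma :: complex \<Rightarrow> complex) = (\<lambda>z. inverse (rGamma z))"
    by (simp add: fun_eq_iff rGamma_inverse_Gamma)
  have [measurable]: "(rGamma :: complex \<Rightarrow> complex) \<in> borel_measurable borel"
    by (intro borel_measurable_continuous_onI continuous_on_rGamma)
  show ?thesis unfolding eq by measurable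
qed

lemma borel_measurable_wilson_density [measurable]:
  assumes [measurable]: "a \<in> borel_measurable M" "b \<in> borel_measurable M" "c \<in> borel_measurable M"
    "d \<in> borel_measurable M" "x \<in> borel_measurable M"
  shows "(\<lambda>\<omega>. wilson_density (a \<omega>) (b \<omega>) (c \<omega>) (d \<omega>) (x \<omega>)) \<in> borel_measurable M"
  unfolding wilson_density_def wilson_const_def by measurable

lemma wilson_density_nonpos: "x \<le> 0 \<Longrightarrow> wilson_density a b c d x = 0"
  by (simp add: wilson_density_def)

text \<open>
  The substitution \<open>x = y\<^sup>2\<close> on the positive half-line, as an equality of measures, so that it serves integrands
  with values in any Banach space. It is obtained from the substitution on \<open>{0..n}\<close> by monotone convergence.
\<close>

lemma distr_square_density:
  "distr (density lborel (\<lambda>y. ennreal (2 * y) * indicator {0<..} y)) borel (\<lambda>y::real. y\<^sup>2)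
    = density lborel (indicator {0<..})"
proof (rule measure_eqI)
  fix B assume "B \<in> sets (distr (density lborel (\<lambda>y. ennreal (2 * y) * indicator {0<..} y)) borel (\<lambda>y::real. y\<^sup>2))"
  hence [measurable]: "B \<in> sets borel" by simp
  have [measurable]: "(\<lambda>y::real. y\<^sup>2) -` B \<in> sets borel"
    using measurable_sets[of "\<lambda>y::real. y\<^sup>2" borel borel B] by simp
  have eq: "(\<integral>\<^sup>+x. indicator (B \<inter> {0<..}) x * indicator {0..(real n)\<^sup>2} x \<partial>lborel)
      = (\<integral>\<^sup>+y. indicator (B \<inter> {0<..}) (y\<^sup>2) * ennreal (2 * y) * indicator {0..real n} y \<partial>lborel)" for n
  proof (cases "n = 0")
    case False
    have "(\<integral>\<^sup>+x. indicator (B \<inter> {0<..}) x * indicator {(0\<^sup>2)..(real n)\<^sup>2} x \<partial>lborel)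
      = (\<integral>\<^sup>+y. indicator (B \<inter> {0<..}) (y\<^sup>2) * ennreal (2 * y) * indicator {0..real n} y \<partial>lborel)"
      by (rule nn_integral_substitution_aux) (use False in \<open>auto intro!: derivative_eq_intros continuous_intros\<close>)
    thus ?thesis by simp
  next
    case True
    have "(\<integral>\<^sup>+x. indicator (B \<inter> {0<..}) x * indicator {0..(real n)\<^sup>2} x \<partial>lborel) = (\<integral>\<^sup>+x. 0 \<partial>(lborel :: real measure))"
      using True by (intro nn_integral_cong) (auto simp: indicator_def)
    moreover have "(\<integral>\<^sup>+y. indicator (B \<inter> {0<..}) (y\<^sup>2) * ennreal (2 * y) * indicator {0..real n} y \<partial>lborel)
        = (\<integral>\<^sup>+x. 0 \<partial>(lborel :: real measure))"
      using True by (intro nn_integral_cong) (auto simp: indicator_def)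
    ultimately show ?thesis by simp
  qed
  have SUP: "(SUP n. f * (indicator {0..u n} x :: ennreal)) = f"
    if u: "\<And>m n. m \<le> n \<Longrightarrow> u m \<le> u n" "\<And>n. real n \<le> u n" and "0 \<le> x" for u :: "nat \<Rightarrow> real" and x and f :: ennreal
  proof (rule antisym)
    show "(SUP n. f * (indicator {0..u n} x :: ennreal)) \<le> f"
      by (intro SUP_least) (auto simp: indicator_def)
    obtain n :: nat where "x \<le> real n" using real_arch_simple by blast
    hence "indicator {0..u n} x = (1::ennreal)" using u(2)[of n] \<open>0 \<le> x\<close> by simp
    thus "f \<le> (SUP n. f * (indicator {0..u n} x :: ennreal))"
      by (intro SUP_upper2[of n]) auto
  qed
  have nsq: "real n \<le> (real n)\<^sup>2" for n
    by (cases n) (auto simp: power2_eq_square)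
  have "emeasure (density lborel (indicator {0<..})) B = (\<integral>\<^sup>+x. indicator (B \<inter> {0<..}) x \<partial>lborel)"
    by (subst emeasure_density, simp, simp)
      (auto simp: indicator_def simp del: nn_integral_indicator intro!: nn_integral_cong)
  also have "\<dots> = (\<integral>\<^sup>+x. (SUP n. indicator (B \<inter> {0<..}) x * indicator {0..(real n)\<^sup>2} x) \<partial>lborel)"
  proof (intro nn_integral_cong)
    fix x :: real
    show "indicator (B \<inter> {0<..}) x = (SUP n. indicator (B \<inter> {0<..}) x * indicator {0..(real n)\<^sup>2} x :: ennreal)"
    proof (cases "0 \<le> x")
      case True
      show ?thesis
        by (rule SUP[OF _ nsq True, symmetric]) (auto intro: power_mono)
    qed (auto simp: indicator_def)
  qed
  also have "\<dots> = (SUP n. \<integral>\<^sup>+x. indicator (B \<inter> {0<..}) x * indicator {0..(real n)\<^sup>2} x \<partial>lborel)"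
    by (intro nn_integral_monotone_convergence_SUP)
      (auto simp: incseq_def le_fun_def indicator_def intro: order_trans power_mono)
  also have "\<dots> = (SUP n. \<integral>\<^sup>+y. indicator (B \<inter> {0<..}) (y\<^sup>2) * ennreal (2 * y) * indicator {0..real n} y \<partial>lborel)"
    unfolding eq ..
  also have "\<dots> = (\<integral>\<^sup>+y. (SUP n. indicator (B \<inter> {0<..}) (y\<^sup>2) * ennreal (2 * y) * indicator {0..real n} y) \<partial>lborel)"
    by (intro nn_integral_monotone_convergence_SUP[symmetric])
      (auto simp: incseq_def le_fun_def indicator_def)
  also have "\<dots> = (\<integral>\<^sup>+y. ennreal (2 * y) * indicator {0<..} y * indicator B (y\<^sup>2) \<partial>lborel)"
  proof (intro nn_integral_cong)
    fix y :: real
    have "(SUP n. indicator (B \<inter> {0<..}) (y\<^sup>2) * ennreal (2 * y) * indicator {0..real n} y)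
      = indicator (B \<inter> {0<..}) (y\<^sup>2) * ennreal (2 * y)" if "0 \<le> y"
      by (rule SUP[OF _ _ that]) auto
    thus "(SUP n. indicator (B \<inter> {0<..}) (y\<^sup>2) * ennreal (2 * y) * indicator {0..real n} y)
      = ennreal (2 * y) * indicator {0<..} y * indicator B (y\<^sup>2)"
      by (cases "0 \<le> y") (auto simp: indicator_def)
  qed
  also have "\<dots> = emeasure (distr (density lborel (\<lambda>y. ennreal (2 * y) * indicator {0<..} y)) borel (\<lambda>y::real. y\<^sup>2)) B"
    by (subst emeasure_distr, simp, simp, subst emeasure_density) (auto simp: indicator_def intro!: nn_integral_cong)
  finally show "emeasure (distr (density lborel (\<lambda>y. ennreal (2 * y) * indicator {0<..} y)) borel (\<lambda>y::real. y\<^sup>2)) B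
      = emeasure (density lborel (indicator {0<..})) B" ..
qed simp

lemma has_bochner_integral_square_substitution:
  fixes g :: "real \<Rightarrow> 'a :: {banach, second_countable_topology}"
  assumes [measurable]: "g \<in> borel_measurable borel"
    and int: "has_bochner_integral lborel (\<lambda>y. indicator {0<..} y *\<^sub>R (2 * y) *\<^sub>R g (y\<^sup>2)) I"
  shows "has_bochner_integral lborel (\<lambda>x. indicator {0<..} x *\<^sub>R g x) I"
proof -
  have d1: "(\<lambda>y. ennreal (2 * y) * indicator {0<..} y) = (\<lambda>y. ennreal (2 * y * indicator {0<..} y))"
    by (auto simp: indicator_def)
  have d2: "(indicator {0<..} :: real \<Rightarrow> ennreal) = (\<lambda>x. ennreal (indicator {0<..} x))"
    by (auto simp: indicator_def)
  have "has_bochner_integral (density lborel (\<lambda>y. ennreal (2 * y * indicator {0<..} y))) (\<lambda>y. g (y\<^sup>2)) I"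
    using int by (intro has_bochner_integral_density) (auto simp: indicator_def mult_ac)
  hence "has_bochner_integral (distr (density lborel (\<lambda>y. ennreal (2 * y) * indicator {0<..} y)) borel (\<lambda>y::real. y\<^sup>2)) g I"
    unfolding d1 by (intro has_bochner_integral_distr) auto
  hence "has_bochner_integral (density lborel (\<lambda>x. ennreal (indicator {0<..} x))) g I"
    unfolding distr_square_density d2[symmetric] .
  thus ?thesis
    by (auto simp: has_bochner_integral_iff integrable_density integral_density)
qed

lemma integral_even_function:
  fixes \<phi> :: "real \<Rightarrow> complex"
  assumes int: "integrable lborel \<phi>" and even: "\<And>y. \<phi> (- y) = \<phi> y" and zero: "\<phi> 0 = 0"
  shows "(\<integral>y. \<phi> y \<partial>lborel) = 2 * (\<integral>y. indicator {0<..} y *\<^sub>R \<phi> y \<partial>lborel)"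
proof -
  define \<psi> where "\<psi> y = indicator {0<..} y *\<^sub>R \<phi> y" for y
  have \<psi>: "integrable lborel \<psi>"
    unfolding \<psi>_def by (rule integrable_mult_indicator) (use int in auto)
  have \<psi>': "integrable lborel (\<lambda>y. \<psi> (- y))"
    using lborel_integrable_real_affine[OF \<psi>, of "-1" 0] by simp
  have "(\<integral>y. \<phi> y \<partial>lborel) = (\<integral>y. \<psi> y + \<psi> (- y) \<partial>lborel)"
    by (intro Bochner_Integration.integral_cong) (auto simp: \<psi>_def indicator_def even zero linorder_neq_iff not_less
       intro: zero)
  also have "\<dots> = (\<integral>y. \<psi> y \<partial>lborel) + (\<integral>y. \<psi> (- y) \<partial>lborel)"
    by (rule Bochner_Integration.integral_add[OF \<psi> \<psi>'])
  also have "(\<integral>y. \<psi> (- y) \<partial>lborel) = (\<integral>y. \<psi> y \<partial>lborel)"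
    using lborel_integral_real_affine[of "-1" \<psi> 0] by simp
  finally show ?thesis by (simp add: \<psi>_def)
qed

definition real_or_conj :: "complex \<Rightarrow> complex \<Rightarrow> bool" where
  "real_or_conj a b \<longleftrightarrow> (a \<in> \<real> \<and> b \<in> \<real>) \<or> a = cnj b"

text \<open>
  The squared modulus is a product with the complex conjugate. Conjugation either fixes both parameters or exchanges
  them, so the modulus becomes an expression that is holomorphic in the parameters.
\<close>

lemma norm_Gamma_times_Gamma_square:
  assumes "real_or_conj a b"
  shows "of_real ((cmod (Gamma (a + \<i> * of_real y) * Gamma (b + \<i> * of_real y)))\<^sup>2)
    = Gamma_pair a (Complex 0 y) * Gamma_pair b (Complex 0 y)"
proof -
  have y: "\<i> * of_real y = Complex 0 y" by (simp add: complex_eq_iff)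
  have cz: "cnj (Complex 0 y) = - Complex 0 y" by (simp add: complex_eq_iff)
  have cnj: "cnj (Gamma (p + Complex 0 y)) = Gamma (cnj p - Complex 0 y)" for p
    by (simp add: cnj_Gamma cz)
  show ?thesis
    unfolding complex_norm_square y complex_cnj_mult cnj Gamma_pair_def
    using assms by (auto simp: real_or_conj_def Reals_cnj_iff mult_ac)
qed

lemma norm_Gamma_2ii_square:
  assumes "0 < y"
  shows "1 / of_real ((cmod (Gamma (2 * \<i> * of_real y)))\<^sup>2)
    = - 2 * Complex 0 y * sin (2 * of_real pi * Complex 0 y) / of_real pi"
proof -
  define w where "w = 2 * Complex 0 y"
  have w: "w \<noteq> 0" "- w \<notin> \<int>\<^sub>\<le>\<^sub>0" "w \<notin> \<int>\<^sub>\<le>\<^sub>0"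
    using assms by (auto simp: w_def complex_eq_iff elim!: nonpos_Ints_cases)
  have "2 * \<i> * of_real y = w" by (simp add: w_def complex_eq_iff)
  moreover have "cnj w = - w" by (simp add: w_def complex_eq_iff)
  ultimately have 1: "complex_of_real ((cmod (Gamma (2 * \<i> * of_real y)))\<^sup>2) = Gamma w * Gamma (- w)"
    by (simp only: complex_norm_square cnj_Gamma)
  have "Gamma (1 - w) = - w * Gamma (- w)"
    using Gamma_plus1[OF w(2)] by (simp add: add.commute)
  hence 2: "- w * (Gamma w * Gamma (- w)) = of_real pi / sin (of_real pi * w)"
    using Gamma_reflection_complex[of w] by (simp add: mult_ac)
  have "Gamma w * Gamma (- w) \<noteq> 0" using w by (simp add: Gamma_eq_zero_iff)
  hence "sin (of_real pi * w) \<noteq> 0" using 2 w by auto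
  hence "1 / (Gamma w * Gamma (- w)) = - w * sin (of_real pi * w) / of_real pi"
    using 2 \<open>Gamma w * Gamma (- w) \<noteq> 0\<close> by (simp add: field_simps)
  thus ?thesis unfolding 1 by (simp add: w_def mult_ac)
qed

lemma wilson_const_eq: "wilson_const a b c d = 1 / (4 * of_real pi * wilson_gammas a b c d)"
  by (simp add: wilson_const_def wilson_gammas_def mult_ac)

lemma wilson_density_square:
  assumes "real_or_conj a b" "real_or_conj c d" "0 < y"
  shows "of_real (2 * y * wilson_density a b c d (y\<^sup>2)) = 2 * wilson_const a b c d * wilson_weight a b c d (Complex 0 y)"
proof -
  have K: "of_real (Re (wilson_const a b c d)) = wilson_const a b c d"
    using wilson_const_real[of a b c d] assms by (simp add: real_or_conj_def)
  have sq: "sqrt (y\<^sup>2) = y" using assms by simp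
  have "of_real (2 * y * wilson_density a b c d (y\<^sup>2)) = 2 * wilson_const a b c d *
      (of_real ((cmod (Gamma (a + \<i> * of_real y) * Gamma (b + \<i> * of_real y)))\<^sup>2)
      * of_real ((cmod (Gamma (c + \<i> * of_real y) * Gamma (d + \<i> * of_real y)))\<^sup>2)
      * (1 / of_real ((cmod (Gamma (2 * \<i> * of_real y)))\<^sup>2)))"
    unfolding wilson_density_def sq
    using assms(3) by (simp add: K norm_mult power_mult_distrib)
  thus ?thesis
    unfolding norm_Gamma_times_Gamma_square[OF assms(1)] norm_Gamma_times_Gamma_square[OF assms(2)]
      norm_Gamma_2ii_square[OF assms(3)] wilson_weight_def wilson_weight3_def by (simp only: mult_ac)
qed

lemma wilson_weight_even: "wilson_weight a b c d (Complex 0 (- y)) = wilson_weight a b c d (Complex 0 y)"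
proof -
  have "Complex 0 (- y) = - Complex 0 y" by (simp add: complex_eq_iff)
  thus ?thesis by (simp add: wilson_weight_def wilson_weight3_def Gamma_pair_def mult_ac)
qed

lemma has_bochner_integral_wilson_density:
  fixes P :: "real \<Rightarrow> complex"
  assumes adm: "real_or_conj a b" "real_or_conj c d" and [measurable]: "P \<in> borel_measurable borel"
    and int: "integrable lborel (\<lambda>y. P (y\<^sup>2) * wilson_weight a b c d (Complex 0 y))"
  shows "has_bochner_integral lborel (\<lambda>x. P x * of_real (wilson_density a b c d x))
     (wilson_const a b c d * (\<integral>y. P (y\<^sup>2) * wilson_weight a b c d (Complex 0 y) \<partial>lborel))"
proof -
  define W where "W y = P (y\<^sup>2) * wilson_weight a b c d (Complex 0 y)" for y
  have "has_bochner_integral lborel (\<lambda>y. (2 * wilson_const a b c d) * (indicator {0<..} y *\<^sub>R W y))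
     ((2 * wilson_const a b c d) * (\<integral>y. indicator {0<..} y *\<^sub>R W y \<partial>lborel))"
    using integrable_mult_indicator[OF _ int, of "{0<..}"]
    by (intro has_bochner_integral_mult_right has_bochner_integral_integrable) (auto simp: W_def)
  also have "(2 * wilson_const a b c d) * (\<integral>y. indicator {0<..} y *\<^sub>R W y \<partial>lborel) =
    wilson_const a b c d * (\<integral>y. W y \<partial>lborel)"
  proof -
    have "Complex 0 0 = 0" by (simp add: complex_eq_iff)
    hence "W 0 = 0" by (simp add: W_def wilson_weight_def wilson_weight3_def)
    hence "(\<integral>y. W y \<partial>lborel) = 2 * (\<integral>y. indicator {0<..} y *\<^sub>R W y \<partial>lborel)"
      by (intro integral_even_function) (use int in \<open>auto simp: W_def wilson_weight_even\<close>)
    thus ?thesis by simp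
  qed
  also have "(\<lambda>y. (2 * wilson_const a b c d) * (indicator {0<..} y *\<^sub>R W y))
    = (\<lambda>y. indicator {0<..} y *\<^sub>R (2 * y) *\<^sub>R (P (y\<^sup>2) * of_real (wilson_density a b c d (y\<^sup>2))))"
  proof
    fix y :: real
    show "(2 * wilson_const a b c d) * (indicator {0<..} y *\<^sub>R W y)
       = indicator {0<..} y *\<^sub>R (2 * y) *\<^sub>R (P (y\<^sup>2) * of_real (wilson_density a b c d (y\<^sup>2)))"
    proof (cases "0 < y")
      case True
      have "(2 * y) *\<^sub>R (P (y\<^sup>2) * of_real (wilson_density a b c d (y\<^sup>2)))
        = P (y\<^sup>2) * of_real (2 * y * wilson_density a b c d (y\<^sup>2))"
        by (simp add: scaleR_conv_of_real mult_ac)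
      thus ?thesis unfolding wilson_density_square[OF adm True] using True by (simp add: W_def mult_ac)
    qed simp
  qed
  finally have "has_bochner_integral lborel
     (\<lambda>x. indicator {0<..} x *\<^sub>R (P x * of_real (wilson_density a b c d x))) (wilson_const a b c d * (\<integral>y. W y \<partial>lborel))"
    by (rule has_bochner_integral_square_substitution[rotated]) measurable
  also have "(\<lambda>x. indicator {0<..} x *\<^sub>R (P x * of_real (wilson_density a b c d x)))
    = (\<lambda>x. P x * of_real (wilson_density a b c d x))"
    by (auto simp: fun_eq_iff indicator_def wilson_density_nonpos)
  finally show ?thesis unfolding W_def .
qed

locale wilson_parameters =
  fixes a b c d :: complex
  assumes adm: "real_or_conj a b" "real_or_conj c d"
    and pos: "0 < Re a" "0 < Re b" "0 < Re c" "0 < Re d"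
begin

lemma has_integral_1: "has_bochner_integral lborel (wilson_density a b c d) 1"
proof -
  have "has_bochner_integral lborel (\<lambda>x. 1 * complex_of_real (wilson_density a b c d x))
     (wilson_const a b c d * (\<integral>y. 1 * wilson_weight a b c d (Complex 0 y) \<partial>lborel))"
    by (rule has_bochner_integral_wilson_density) (use adm integrable_wilson_weight[OF pos] in auto)
  also have "wilson_const a b c d * (\<integral>y. 1 * wilson_weight a b c d (Complex 0 y) \<partial>lborel) = 1"
    using wilson_integral_eq[OF pos] wilson_gammas_nonzero[OF pos]
    by (simp add: wilson_const_eq wilson_integral_def)
  finally have "has_bochner_integral lborel (\<lambda>x. complex_of_real (wilson_density a b c d x)) 1" by simp
  thus ?thesis
    by (simp only: has_bochner_integral_iff complex_of_real_integrable_eq integral_complex_of_real of_real_eq_1_iff)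
qed

text \<open>
  The density is a constant times a nonnegative function, and its integral is \<open>1\<close>; a negative constant would make
  the integral nonpositive.
\<close>

lemma wilson_density_nonneg: "0 \<le> wilson_density a b c d x"
proof (rule ccontr)
  define q where "q y = (if 0 < y then
      (cmod (Gamma (a + \<i> * of_real (sqrt y)) * Gamma (b + \<i> * of_real (sqrt y))
             * Gamma (c + \<i> * of_real (sqrt y)) * Gamma (d + \<i> * of_real (sqrt y))))\<^sup>2
        / (sqrt y * (cmod (Gamma (2 * \<i> * of_real (sqrt y))))\<^sup>2) else 0)" for y
  have q: "0 \<le> q y" for y by (simp add: q_def)
  have Kq: "wilson_density a b c d y = Re (wilson_const a b c d) * q y" for y
    by (simp add: wilson_density_def q_def)
  assume "\<not> 0 \<le> wilson_density a b c d x"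
  hence "Re (wilson_const a b c d) \<le> 0"
    using q[of x] unfolding Kq by (meson linear mult_nonneg_nonneg)
  hence "wilson_density a b c d y \<le> 0" for y
    using q[of y] unfolding Kq by (rule mult_nonpos_nonneg)
  hence "0 \<le> (\<integral>y. - wilson_density a b c d y \<partial>lborel)"
    by (intro Bochner_Integration.integral_nonneg) simp
  thus False using has_integral_1 by (simp add: has_bochner_integral_iff)
qed

lemma nn_integral_1: "(\<integral>\<^sup>+x. ennreal (wilson_density a b c d x) \<partial>lborel) = 1"
  using has_integral_1 wilson_density_nonneg
  by (simp add: has_bochner_integral_iff nn_integral_eq_integral)

lemma sum_nonzero: "a + b + c + d \<noteq> 0" "a + b + c + d + 1 \<noteq> 0"
  using pos by (auto simp: complex_eq_iff)

lemma first_moment: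
  "has_bochner_integral lborel (\<lambda>x. of_real x * complex_of_real (wilson_density a b c d x))
     ((a * b * c + a * b * d + a * c * d + b * c * d) / (a + b + c + d))"
proof -
  have "has_bochner_integral lborel (\<lambda>x. of_real x * complex_of_real (wilson_density a b c d x))
     (wilson_const a b c d * (\<integral>y. of_real (y\<^sup>2) * wilson_weight a b c d (Complex 0 y) \<partial>lborel))"
    by (rule has_bochner_integral_wilson_density) (use adm integrable_wilson_weight_y2[OF pos] in auto)
  also have "(\<integral>y. of_real (y\<^sup>2) * wilson_weight a b c d (Complex 0 y) \<partial>lborel)
    = (a * b * c + a * b * d + a * c * d + b * c * d) / (a + b + c + d) * wilson_integral a b c d"
  proof -
    define X where "X = (\<integral>y. of_real (y\<^sup>2) * wilson_weight a b c d (Complex 0 y) \<partial>lborel)"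
    have "X = ((a + b + c + d) * X) / (a + b + c + d)"
      using sum_nonzero(1) by (rule nonzero_mult_div_cancel_left[symmetric])
    also have "(a + b + c + d) * X = (a * b * c + a * b * d + a * c * d + b * c * d) * wilson_integral a b c d"
      unfolding X_def by (rule wilson_first_moment_relation[OF pos])
    finally show ?thesis unfolding X_def times_divide_eq_left .
  qed
  finally show ?thesis
    using wilson_integral_eq[OF pos] wilson_gammas_nonzero[OF pos] by (simp add: wilson_const_eq)
qed

text \<open>
  The factor \<open>(x + a\<^sup>2) (x + b\<^sup>2)\<close> raises \<open>a\<close> and \<open>b\<close> by one, so this moment is a quotient of two
  de Branges--Wilson integrals. Together with the mean it determines the second moment.
\<close>

lemma product_moment:
  "has_bochner_integral lborel
     (\<lambda>x. ((of_real x + a\<^sup>2) * (of_real x + b\<^sup>2)) * complex_of_real (wilson_density a b c d x))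
     ((a + b) * (a + b + 1) * (a + c) * (b + c) * (a + d) * (b + d) / ((a + b + c + d) * (a + b + c + d + 1)))"
proof -
  have pos': "0 < Re (a + 1)" "0 < Re (b + 1)" using pos by auto
  have shift: "((of_real (y\<^sup>2) + a\<^sup>2) * (of_real (y\<^sup>2) + b\<^sup>2)) * wilson_weight a b c d (Complex 0 y)
      = wilson_weight (a + 1) (b + 1) c d (Complex 0 y)" for y
  proof -
    have sym: "wilson_weight a' b' c d z = wilson_weight b' a' c d z" for a' b' z
      by (simp add: wilson_weight_def wilson_weight3_def mult_ac)
    have "wilson_weight (a + 1) (b + 1) c d (Complex 0 y) = (of_real (y\<^sup>2) + a\<^sup>2) * wilson_weight (b + 1) a c d (Complex 0 y)"
      unfolding wilson_weight_plus_1[OF pos(1)] sym[of "b + 1"] by (simp add: algebra_simps)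
    also have "wilson_weight (b + 1) a c d (Complex 0 y) = (of_real (y\<^sup>2) + b\<^sup>2) * wilson_weight a b c d (Complex 0 y)"
      unfolding wilson_weight_plus_1[OF pos(2)] sym[of a] by (simp add: algebra_simps)
    finally show ?thesis by (simp add: mult_ac)
  qed
  have "has_bochner_integral lborel
     (\<lambda>x. ((of_real x + a\<^sup>2) * (of_real x + b\<^sup>2)) * complex_of_real (wilson_density a b c d x))
     (wilson_const a b c d * (\<integral>y. ((of_real (y\<^sup>2) + a\<^sup>2) * (of_real (y\<^sup>2) + b\<^sup>2)) * wilson_weight a b c d (Complex 0 y) \<partial>lborel))"
  proof (rule has_bochner_integral_wilson_density)
    show "integrable lborel (\<lambda>y. ((of_real (y\<^sup>2) + a\<^sup>2) * (of_real (y\<^sup>2) + b\<^sup>2)) * wilson_weight a b c d (Complex 0 y))"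
      unfolding shift using integrable_wilson_weight[OF pos' pos(3,4)] .
  qed (use adm in auto)
  also have "(\<integral>y. ((of_real (y\<^sup>2) + a\<^sup>2) * (of_real (y\<^sup>2) + b\<^sup>2)) * wilson_weight a b c d (Complex 0 y) \<partial>lborel)
     = 4 * of_real pi * wilson_gammas (a + 1) (b + 1) c d"
    unfolding shift using wilson_integral_eq[OF pos' pos(3,4)] by (simp add: wilson_integral_def)
  also have "wilson_gammas (a + 1) (b + 1) c d =
    (a + b) * (a + b + 1) * (a + c) * (b + c) * (a + d) * (b + d) / ((a + b + c + d) * (a + b + c + d + 1)) * wilson_gammas a b c d"
  proof -
    have sym: "wilson_gammas a' b' c d = wilson_gammas b' a' c d" for a' b'
      by (simp add: wilson_gammas_def mult_ac add_ac)
    define s where "s = a + b + c + d"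
    have s: "s \<noteq> 0" "s + 1 \<noteq> 0" using sum_nonzero by (auto simp: s_def)
    have "(s + 1) * wilson_gammas (a + 1) (b + 1) c d = (a + (b + 1)) * (a + c) * (a + d) * wilson_gammas (b + 1) a c d"
      using wilson_gammas_plus_1[OF pos(1) pos'(2) pos(3,4)] unfolding s_def sym[of "b + 1" a] by (simp only: add_ac)
    moreover have "s * wilson_gammas (b + 1) a c d = (b + a) * (b + c) * (b + d) * wilson_gammas a b c d"
      using wilson_gammas_plus_1[OF pos(2,1,3,4)] unfolding s_def sym[of a b] by (simp only: add_ac)
    ultimately have "(s * (s + 1)) * wilson_gammas (a + 1) (b + 1) c d
       = ((a + b) * (a + b + 1) * (a + c) * (b + c) * (a + d) * (b + d)) * wilson_gammas a b c d" by algebra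
    thus ?thesis using s unfolding s_def[symmetric] by (simp add: divide_simps) (simp only: mult_ac)
  qed
  finally show ?thesis
    using wilson_gammas_nonzero[OF pos] by (simp add: wilson_const_eq)
qed

definition mean :: real where "mean = (\<integral>x. x * wilson_density a b c d x \<partial>lborel)"

lemma integrable_moments:
  "integrable lborel (\<lambda>x. x * wilson_density a b c d x)"
  "integrable lborel (\<lambda>x. x\<^sup>2 * wilson_density a b c d x)"
proof -
  have 1: "integrable lborel (\<lambda>x. complex_of_real (x * wilson_density a b c d x))"
    using first_moment by (simp add: has_bochner_integral_iff)
  thus "integrable lborel (\<lambda>x. x * wilson_density a b c d x)"
    by (simp only: complex_of_real_integrable_eq)
  have 0: "integrable lborel (\<lambda>x. complex_of_real (wilson_density a b c d x))"
    using has_integral_1 by (simp only: has_bochner_integral_iff complex_of_real_integrable_eq)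
  have 2: "integrable lborel (\<lambda>x. ((of_real x + a\<^sup>2) * (of_real x + b\<^sup>2)) * complex_of_real (wilson_density a b c d x))"
    using product_moment by (simp add: has_bochner_integral_iff)
  have "integrable lborel (\<lambda>x. ((of_real x + a\<^sup>2) * (of_real x + b\<^sup>2)) * complex_of_real (wilson_density a b c d x)
     - (a\<^sup>2 + b\<^sup>2) * complex_of_real (x * wilson_density a b c d x) - a\<^sup>2 * b\<^sup>2 * complex_of_real (wilson_density a b c d x))"
    by (intro Bochner_Integration.integrable_diff integrable_mult_right 0 1 2)
  also have "(\<lambda>x. ((of_real x + a\<^sup>2) * (of_real x + b\<^sup>2)) * complex_of_real (wilson_density a b c d x)
     - (a\<^sup>2 + b\<^sup>2) * complex_of_real (x * wilson_density a b c d x) - a\<^sup>2 * b\<^sup>2 * complex_of_real (wilson_density a b c d x))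
    = (\<lambda>x. complex_of_real (x\<^sup>2 * wilson_density a b c d x))"
    by (simp add: fun_eq_iff power2_eq_square algebra_simps)
  finally show "integrable lborel (\<lambda>x. x\<^sup>2 * wilson_density a b c d x)"
    by (simp only: complex_of_real_integrable_eq)
qed

lemma mean_eq: "of_real mean = (a * b * c + a * b * d + a * c * d + b * c * d) / (a + b + c + d)"
  using first_moment unfolding mean_def
  by (simp add: has_bochner_integral_iff flip: integral_complex_of_real)

lemma variance_eq:
  "of_real (\<integral>x. (x - mean)\<^sup>2 * wilson_density a b c d x \<partial>lborel)
    = (a + b) * (a + c) * (a + d) * (b + c) * (b + d) * (c + d) / ((a + b + c + d)\<^sup>2 * (a + b + c + d + 1))"
proof -
  define s where "s = a + b + c + d"
  define m :: complex where "m = of_real mean"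
  have s: "s \<noteq> 0" "s + 1 \<noteq> 0" using sum_nonzero by (auto simp: s_def)
  let ?f = "\<lambda>x. complex_of_real (wilson_density a b c d x)"
  have f: "has_bochner_integral lborel ?f 1"
    using has_integral_1
    by (simp only: has_bochner_integral_iff complex_of_real_integrable_eq integral_complex_of_real of_real_eq_1_iff)
  have xf: "has_bochner_integral lborel (\<lambda>x. of_real x * ?f x) m"
    using first_moment unfolding m_def mean_eq .
  have "has_bochner_integral lborel (\<lambda>x. ((of_real x + a\<^sup>2) * (of_real x + b\<^sup>2)) * ?f x
      - (a\<^sup>2 + b\<^sup>2 + 2 * m) * (of_real x * ?f x) + (m\<^sup>2 - a\<^sup>2 * b\<^sup>2) * ?f x)
      ((a + b) * (a + b + 1) * (a + c) * (b + c) * (a + d) * (b + d) / (s * (s + 1))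
       - (a\<^sup>2 + b\<^sup>2 + 2 * m) * m + (m\<^sup>2 - a\<^sup>2 * b\<^sup>2) * 1)"
    by (intro has_bochner_integral_diff has_bochner_integral_add has_bochner_integral_mult_right f xf
         product_moment[folded s_def])
  also have "(\<lambda>x. ((of_real x + a\<^sup>2) * (of_real x + b\<^sup>2)) * ?f x
      - (a\<^sup>2 + b\<^sup>2 + 2 * m) * (of_real x * ?f x) + (m\<^sup>2 - a\<^sup>2 * b\<^sup>2) * ?f x)
      = (\<lambda>x. complex_of_real ((x - mean)\<^sup>2 * wilson_density a b c d x))"
    by (simp add: fun_eq_iff m_def power2_eq_square algebra_simps)
  also have "(a + b) * (a + b + 1) * (a + c) * (b + c) * (a + d) * (b + d) / (s * (s + 1))
       - (a\<^sup>2 + b\<^sup>2 + 2 * m) * m + (m\<^sup>2 - a\<^sup>2 * b\<^sup>2) * 1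
       = (a + b) * (a + b + 1) * (a + c) * (b + c) * (a + d) * (b + d) / (s * (s + 1)) - (m + a\<^sup>2) * (m + b\<^sup>2)"
    by (simp add: power2_eq_square algebra_simps)
  also have "m + a\<^sup>2 = (a + b) * (a + c) * (a + d) / s"
    using s(1) unfolding m_def mean_eq s_def[symmetric]
    by (simp add: divide_add_eq_iff) (simp add: s_def power2_eq_square algebra_simps)
  also have "m + b\<^sup>2 = (a + b) * (b + c) * (b + d) / s"
    using s(1) unfolding m_def mean_eq s_def[symmetric]
    by (simp add: divide_add_eq_iff) (simp add: s_def power2_eq_square algebra_simps)
  also have "(a + b) * (a + b + 1) * (a + c) * (b + c) * (a + d) * (b + d) / (s * (s + 1))
      - (a + b) * (a + c) * (a + d) / s * ((a + b) * (b + c) * (b + d) / s)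
      = (a + b) * (a + c) * (a + d) * (b + c) * (b + d) * ((a + b + 1) / (s * (s + 1)) - (a + b) / s\<^sup>2)"
    unfolding right_diff_distrib times_divide_eq_left times_divide_eq_right divide_divide_eq_left power2_eq_square
    by (simp only: mult_ac)
  also have "(a + b + 1) / (s * (s + 1)) - (a + b) / s\<^sup>2 = (c + d) / (s\<^sup>2 * (s + 1))"
  proof -
    have "(a + b + 1) / (s * (s + 1)) = (a + b + 1) * s / (s\<^sup>2 * (s + 1))"
      using s by (simp add: power2_eq_square)
    moreover have "(a + b) / s\<^sup>2 = (a + b) * (s + 1) / (s\<^sup>2 * (s + 1))" using s by simp
    ultimately have "(a + b + 1) / (s * (s + 1)) - (a + b) / s\<^sup>2 = ((a + b + 1) * s - (a + b) * (s + 1)) / (s\<^sup>2 * (s + 1))"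
      by (simp only: diff_divide_distrib)
    also have "(a + b + 1) * s - (a + b) * (s + 1) = c + d" by (simp add: s_def algebra_simps)
    finally show ?thesis .
  qed
  finally have "has_bochner_integral lborel (\<lambda>x. complex_of_real ((x - mean)\<^sup>2 * wilson_density a b c d x))
    ((a + b) * (a + c) * (a + d) * (b + c) * (b + d) * (c + d) / (s\<^sup>2 * (s + 1)))" by simp
  thus ?thesis
    by (simp only: has_bochner_integral_iff integral_complex_of_real s_def)
qed

end

section \<open>The transition densities\<close>

lemma Gamma_pair_nonzero: "Re z = 0 \<Longrightarrow> 0 < Re p \<Longrightarrow> Gamma_pair p z \<noteq> 0"
  by (simp add: Gamma_pair_def Gamma_nonzero_if_Re_pos)

lemma wilson_gammas_plus_minus:
  "wilson_gammas u v (r + z) (r - z)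
    = Gamma (u + v) * Gamma_pair (u + r) z * Gamma_pair (v + r) z * Gamma (2 * r) / Gamma (u + v + 2 * r)"
proof -
  have eq: "u + (r + z) = u + r + z" "u + (r - z) = u + r - z" "v + (r + z) = v + r + z" "v + (r - z) = v + r - z"
    "r + z + (r - z) = 2 * r" "u + v + (r + z) + (r - z) = u + v + 2 * r" by simp_all
  show ?thesis unfolding wilson_gammas_def Gamma_pair_def eq by (simp only: mult_ac)
qed

lemma real_or_conj_plus_minus: "real_or_conj (of_real r + \<i> * of_real q) (of_real r - \<i> * of_real q)"
  by (simp add: real_or_conj_def)

lemma real_or_conj_shift: "real_or_conj a b \<Longrightarrow> real_or_conj (a + of_real r) (b + of_real r)"
  "real_or_conj a b \<Longrightarrow> real_or_conj (a - of_real r) (b - of_real r)"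
  by (auto simp: real_or_conj_def)

text \<open>
  The normalizing constant of the transition density contains \<open>1 / (\<Gamma>(a \<plusminus> i \<surd>x) \<Gamma>(b \<plusminus> i \<surd>x))\<close>, which cancels the
  factors with \<open>a\<close> and \<open>b\<close> in the density of \<open>x\<close>. What is left is symmetric: the coupling
  \<open>\<Gamma>(r \<plusminus> i \<surd>x \<plusminus> i \<surd>y)\<close> does not distinguish \<open>x\<close> from \<open>y\<close>, and the right-hand side arises from the same
  cancellation with the roles of \<open>(a, b)\<close> and \<open>(c, d)\<close> exchanged.
\<close>

lemma wilson_density_swap:
  assumes adm: "real_or_conj a b" "real_or_conj c d"
    and pos: "0 < r" "r < Re a" "r < Re b" "0 < Re c" "0 < Re d"
  shows "wilson_density a b c d x
      * wilson_density (a - of_real r) (b - of_real r) (of_real r + \<i> * of_real (sqrt x)) (of_real r - \<i> * of_real (sqrt x)) y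
    = wilson_density (a - of_real r) (b - of_real r) (c + of_real r) (d + of_real r) y
      * wilson_density c d (of_real r + \<i> * of_real (sqrt y)) (of_real r - \<i> * of_real (sqrt y)) x"
proof (cases "0 < x \<and> 0 < y")
  case False
  thus ?thesis by (auto simp: wilson_density_nonpos not_less)
next
  case True
  define p where "p = sqrt x"
  define q where "q = sqrt y"
  have p: "0 < p" "x = p\<^sup>2" and q: "0 < q" "y = q\<^sup>2" using True by (auto simp: p_def q_def)
  have ip: "\<i> * of_real p = Complex 0 p" and iq: "\<i> * of_real q = Complex 0 q" by (simp_all add: complex_eq_iff)
  define R where "R = complex_of_real r"
  define k where "k p = - 2 * Complex 0 p * sin (2 * of_real pi * Complex 0 p) / of_real pi" for p
  define Q where "Q = Gamma_pair (R + Complex 0 p) (Complex 0 q) * Gamma_pair (R - Complex 0 p) (Complex 0 q)"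
  have Q': "Q = Gamma_pair (R + Complex 0 q) (Complex 0 p) * Gamma_pair (R - Complex 0 q) (Complex 0 p)"
    unfolding Q_def Gamma_pair_def by (simp add: algebra_simps)
  have ReR: "Re R = r" by (simp add: R_def)
  have f': "complex_of_real (wilson_density a' b' c' d' (u\<^sup>2))
      = wilson_weight a' b' c' d' (Complex 0 u) / (4 * of_real pi * wilson_gammas a' b' c' d') / of_real u"
    if "real_or_conj a' b'" "real_or_conj c' d'" "0 < u" for a' b' c' d' u
  proof -
    have "complex_of_real (2 * u * wilson_density a' b' c' d' (u\<^sup>2))
       = 2 * (wilson_weight a' b' c' d' (Complex 0 u) / (4 * of_real pi * wilson_gammas a' b' c' d'))"
      unfolding wilson_density_square[OF that] wilson_const_eq by simp
    hence "wilson_weight a' b' c' d' (Complex 0 u) / (4 * of_real pi * wilson_gammas a' b' c' d') / of_real u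
       = complex_of_real (2 * u * wilson_density a' b' c' d' (u\<^sup>2)) / 2 / of_real u" by simp
    also have "\<dots> = of_real (wilson_density a' b' c' d' (u\<^sup>2))" using that(3) by simp
    finally show ?thesis by simp
  qed
  have roc: "real_or_conj (a - R) (b - R)" "real_or_conj (c + R) (d + R)"
     "real_or_conj (R + Complex 0 u) (R - Complex 0 u)" for u
    using real_or_conj_shift adm real_or_conj_plus_minus[of r u] by (auto simp: R_def complex_eq_iff real_or_conj_def)
  have w: "wilson_weight a' b' c' d' (Complex 0 u)
      = Gamma_pair a' (Complex 0 u) * Gamma_pair b' (Complex 0 u) * Gamma_pair c' (Complex 0 u) * Gamma_pair d' (Complex 0 u) * k u"
    for a' b' c' d' u
    by (simp add: wilson_weight_def wilson_weight3_def k_def)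
  have g1: "wilson_gammas (a - R) (b - R) (R + Complex 0 p) (R - Complex 0 p)
    = Gamma (a + b - 2 * R) * Gamma_pair a (Complex 0 p) * Gamma_pair b (Complex 0 p) * Gamma (2 * R) / Gamma (a + b)"
    unfolding wilson_gammas_plus_minus by (simp add: algebra_simps)
  have g2: "wilson_gammas c d (R + Complex 0 q) (R - Complex 0 q)
    = Gamma (c + d) * Gamma_pair (c + R) (Complex 0 q) * Gamma_pair (d + R) (Complex 0 q) * Gamma (2 * R) / Gamma (c + d + 2 * R)"
    unfolding wilson_gammas_plus_minus ..
  have g3: "wilson_gammas (a - R) (b - R) (c + R) (d + R)
    = Gamma (a + b - 2 * R) * Gamma (a + c) * Gamma (a + d) * Gamma (b + c) * Gamma (b + d) * Gamma (c + d + 2 * R) / Gamma (a + b + c + d)"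
  proof -
    have eq: "a - R + (b - R) = a + b - 2 * R" "a - R + (c + R) = a + c" "a - R + (d + R) = a + d"
      "b - R + (c + R) = b + c" "b - R + (d + R) = b + d" "c + R + (d + R) = c + d + 2 * R"
      "a + b - 2 * R + (c + R) + (d + R) = a + b + c + d" by simp_all
    show ?thesis unfolding wilson_gammas_def eq ..
  qed
  have g4: "wilson_gammas a b c d
    = Gamma (a + b) * Gamma (a + c) * Gamma (a + d) * Gamma (b + c) * Gamma (b + d) * Gamma (c + d) / Gamma (a + b + c + d)"
    unfolding wilson_gammas_def ..
  have nz: "Gamma (a + b) \<noteq> 0" "Gamma (c + d + 2 * R) \<noteq> 0" "Gamma_pair a (Complex 0 p) \<noteq> 0" "Gamma_pair b (Complex 0 p) \<noteq> 0"
     "Gamma_pair (c + R) (Complex 0 q) \<noteq> 0" "Gamma_pair (d + R) (Complex 0 q) \<noteq> 0"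
    using pos by (simp_all add: ReR Gamma_nonzero_if_Re_pos Gamma_pair_nonzero)
  have "complex_of_real (wilson_density a b c d (p\<^sup>2) * wilson_density (a - R) (b - R) (R + Complex 0 p) (R - Complex 0 p) (q\<^sup>2))
    = complex_of_real (wilson_density (a - R) (b - R) (c + R) (d + R) (q\<^sup>2) * wilson_density c d (R + Complex 0 q) (R - Complex 0 q) (p\<^sup>2))"
    unfolding of_real_mult f'[OF adm p(1)] f'[OF roc(1,3) q(1)] f'[OF roc(1,2) q(1)] f'[OF adm(2) roc(3) p(1)]
      w g1 g2 g3 g4 mult.assoc[of _ "Gamma_pair (R + Complex 0 p) (Complex 0 q)"] Q_def[symmetric]
      mult.assoc[of _ "Gamma_pair (R + Complex 0 q) (Complex 0 p)"] Q'[symmetric]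
    using nz by (simp add: divide_simps)
  thus ?thesis
    by (simp only: of_real_eq_iff p(2)[symmetric] q(2)[symmetric] p_def[symmetric] q_def[symmetric] ip iq R_def)
qed

locale wilson_process_data =
  fixes A B C D :: complex
  assumes Re_pos: "0 < Re A" "0 < Re B" "0 < Re C" "0 < Re D"
    and AB: "real_or_conj A B" and CD: "real_or_conj C D"
    and Re_le: "Re A \<le> Re B" "Re C \<le> Re D"
begin

definition T :: "real set" where "T = {- Re C<..<Re A}"

abbreviation marg :: "real \<Rightarrow> real \<Rightarrow> real" where "marg \<equiv> wilson_marginal A B C D"

abbreviation trans :: "real \<Rightarrow> real \<Rightarrow> real \<Rightarrow> real \<Rightarrow> real" where "trans \<equiv> wilson_transition A B"

text \<open>
  The density, as a function of its last argument, of the value at time \<open>t\<close> given the values \<open>x\<close> at time \<open>s\<close> and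
  \<open>z\<close> at time \<open>u\<close>; this is established by \<open>joint_three\<close> below.
\<close>

definition bridge :: "real \<Rightarrow> real \<Rightarrow> real \<Rightarrow> real \<Rightarrow> real \<Rightarrow> real \<Rightarrow> real" where
  "bridge s t u x z = wilson_density (of_real (u - t) + \<i> * of_real (sqrt z)) (of_real (u - t) - \<i> * of_real (sqrt z))
      (of_real (t - s) + \<i> * of_real (sqrt x)) (of_real (t - s) - \<i> * of_real (sqrt x))"

lemma marg_parameters:
  assumes "t \<in> T"
  shows "wilson_parameters (A - of_real t) (B - of_real t) (C + of_real t) (D + of_real t)"
  using assms Re_le by unfold_locales (auto simp: T_def intro!: real_or_conj_shift AB CD)

lemma trans_parameters:
  assumes "s < t" "t \<in> T"
  shows "wilson_parameters (A - of_real t) (B - of_real t)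
    (of_real (t - s) + \<i> * of_real (sqrt x)) (of_real (t - s) - \<i> * of_real (sqrt x))"
proof
  show "real_or_conj (A - of_real t) (B - of_real t)" by (intro real_or_conj_shift AB)
  show "real_or_conj (of_real (t - s) + \<i> * of_real (sqrt x)) (of_real (t - s) - \<i> * of_real (sqrt x))"
    by (rule real_or_conj_plus_minus)
qed (use assms Re_le in \<open>auto simp: T_def\<close>)

lemma bridge_parameters:
  assumes "s < t" "t < u"
  shows "wilson_parameters (of_real (u - t) + \<i> * of_real (sqrt z)) (of_real (u - t) - \<i> * of_real (sqrt z))
      (of_real (t - s) + \<i> * of_real (sqrt x)) (of_real (t - s) - \<i> * of_real (sqrt x))"
  by unfold_locales (use assms in \<open>auto simp del: of_real_diff intro!: real_or_conj_plus_minus\<close>)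

lemma measurable_marg [measurable]: "marg t \<in> borel_measurable borel"
  unfolding wilson_marginal_def by measurable

lemma measurable_trans [measurable]:
  assumes [measurable]: "f \<in> borel_measurable M" "g \<in> borel_measurable M"
  shows "(\<lambda>\<omega>. trans s t (f \<omega>) (g \<omega>)) \<in> borel_measurable M"
  unfolding wilson_transition_def by measurable

lemma measurable_bridge [measurable]:
  assumes [measurable]: "f \<in> borel_measurable M" "g \<in> borel_measurable M" "h \<in> borel_measurable M"
  shows "(\<lambda>\<omega>. bridge s t u (f \<omega>) (g \<omega>) (h \<omega>)) \<in> borel_measurable M"
  unfolding bridge_def by measurable

lemma marg_nonneg: "t \<in> T \<Longrightarrow> 0 \<le> marg t x"
  unfolding wilson_marginal_def by (rule wilson_parameters.wilson_density_nonneg[OF marg_parameters])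

lemma trans_nonneg: "s < t \<Longrightarrow> t \<in> T \<Longrightarrow> 0 \<le> trans s t x y"
  unfolding wilson_transition_def by (rule wilson_parameters.wilson_density_nonneg[OF trans_parameters])

lemma bridge_nonneg: "s < t \<Longrightarrow> t < u \<Longrightarrow> 0 \<le> bridge s t u x z y"
  unfolding bridge_def by (rule wilson_parameters.wilson_density_nonneg[OF bridge_parameters])

lemma nn_integral_marg: "t \<in> T \<Longrightarrow> (\<integral>\<^sup>+x. ennreal (marg t x) \<partial>lborel) = 1"
  unfolding wilson_marginal_def by (rule wilson_parameters.nn_integral_1[OF marg_parameters])

lemma nn_integral_trans: "s < t \<Longrightarrow> t \<in> T \<Longrightarrow> (\<integral>\<^sup>+y. ennreal (trans s t x y) \<partial>lborel) = 1"
  unfolding wilson_transition_def by (rule wilson_parameters.nn_integral_1[OF trans_parameters])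

lemma nn_integral_bridge: "s < t \<Longrightarrow> t < u \<Longrightarrow> (\<integral>\<^sup>+y. ennreal (bridge s t u x z y) \<partial>lborel) = 1"
  unfolding bridge_def by (rule wilson_parameters.nn_integral_1[OF bridge_parameters])

lemma marg_trans:
  assumes "s \<in> T" "t \<in> T" "s < t"
  shows "(\<integral>\<^sup>+x. ennreal (marg s x) * ennreal (trans s t x y) \<partial>lborel) = ennreal (marg t y)"
proof -
  define g where "g x = wilson_density (C + of_real s) (D + of_real s) (of_real (t - s) + \<i> * of_real (sqrt y))
      (of_real (t - s) - \<i> * of_real (sqrt y)) x" for x
  interpret g: wilson_parameters "C + of_real s" "D + of_real s" "of_real (t - s) + \<i> * of_real (sqrt y)"
      "of_real (t - s) - \<i> * of_real (sqrt y)"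
    by unfold_locales
      (use assms Re_le in \<open>auto simp: T_def simp del: of_real_diff intro!: real_or_conj_plus_minus real_or_conj_shift CD\<close>)
  have "marg s x * trans s t x y = marg t y * g x" for x
  proof -
    have eq: "A - of_real s - of_real (t - s) = A - of_real t" "B - of_real s - of_real (t - s) = B - of_real t"
       "C + of_real s + of_real (t - s) = C + of_real t" "D + of_real s + of_real (t - s) = D + of_real t" by simp_all
    have "real_or_conj (A - of_real s) (B - of_real s)" "real_or_conj (C + of_real s) (D + of_real s)"
      by (intro real_or_conj_shift AB CD)+
    from wilson_density_swap[OF this, of "t - s" x y] show ?thesis
      using assms Re_le unfolding wilson_marginal_def wilson_transition_def g_def eq by (simp add: T_def)
  qed
  hence "(\<integral>\<^sup>+x. ennreal (marg s x) * ennreal (trans s t x y) \<partial>lborel) = (\<integral>\<^sup>+x. ennreal (marg t y) * ennreal (g x) \<partial>lborel)"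
    using assms by (simp add: ennreal_mult'[symmetric] marg_nonneg)
  also have "\<dots> = ennreal (marg t y) * (\<integral>\<^sup>+x. ennreal (g x) \<partial>lborel)"
    unfolding g_def by (intro nn_integral_cmult) measurable
  also have "(\<integral>\<^sup>+x. ennreal (g x) \<partial>lborel) = 1" unfolding g_def by (rule g.nn_integral_1)
  finally show ?thesis by simp
qed

text \<open>
  A transition density started at \<open>x\<close> is itself a marginal density, with \<open>C\<close> and \<open>D\<close> replaced by
  \<open>- s \<plusminus> i \<surd>x\<close>. So the exchange identity applies to two consecutive transitions as well.
\<close>

lemma trans_bridge:
  assumes "s < t" "t < u" "u \<in> T"
  shows "trans s t x y * trans t u y z = trans s u x z * bridge s t u x z y"
proof -
  have eq: "A - of_real t - of_real (u - t) = A - of_real u" "B - of_real t - of_real (u - t) = B - of_real u"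
    "of_real (t - s) + \<i> * of_real (sqrt x) + of_real (u - t) = of_real (u - s) + \<i> * of_real (sqrt x)"
    "of_real (t - s) - \<i> * of_real (sqrt x) + of_real (u - t) = of_real (u - s) - \<i> * of_real (sqrt x)" by simp_all
  have sym: "wilson_density a b c d v = wilson_density c d a b v" for a b c d v
    by (simp add: wilson_density_def wilson_const_def mult_ac add_ac)
  have "real_or_conj (A - of_real t) (B - of_real t)" by (intro real_or_conj_shift AB)
  from wilson_density_swap[OF this real_or_conj_plus_minus, of "u - t" "t - s" "sqrt x" y z] show ?thesis
    using assms Re_le unfolding wilson_transition_def bridge_def eq
    by (subst sym[of "of_real (u - t) + \<i> * of_real (sqrt z)"]) (simp add: T_def)
qed

lemma chapman_kolmogorov:
  assumes "s < t" "t < u" "u \<in> T" "t \<in> T"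
  shows "(\<integral>\<^sup>+y. ennreal (trans s t x y) * ennreal (trans t u y z) \<partial>lborel) = ennreal (trans s u x z)"
proof -
  have "(\<integral>\<^sup>+y. ennreal (trans s t x y) * ennreal (trans t u y z) \<partial>lborel)
     = (\<integral>\<^sup>+y. ennreal (trans s u x z) * ennreal (bridge s t u x z y) \<partial>lborel)"
    using assms by (simp add: ennreal_mult'[symmetric] trans_nonneg trans_bridge)
  also have "\<dots> = ennreal (trans s u x z) * (\<integral>\<^sup>+y. ennreal (bridge s t u x z y) \<partial>lborel)"
    by (intro nn_integral_cmult) measurable
  finally show ?thesis using assms by (simp add: nn_integral_bridge)
qed

end

section \<open>Markov processes with given densities\<close>

lemma sets_sigma_of: "sets (sigma_of P X) = {X -` B \<inter> space P | B. B \<in> sets borel}"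
  by (rule sets_vimage_algebra2) simp

lemma sigma_of_subset:
  assumes "X \<in> borel_measurable N" "space N = space P"
  shows "sets (sigma_of P X) \<subseteq> sets N"
  using measurable_sets[OF assms(1)] assms(2) unfolding sets_sigma_of by auto

lemma measurable_sigma_of: "X \<in> borel_measurable (sigma_of P X)"
  by (rule measurable_vimage_algebra1) simp

lemma space_natural_filtration: "s \<in> T \<Longrightarrow> space (natural_filtration P T Y s) = space P"
  by (auto simp: natural_filtration_def space_Sup_eq_UN)

lemma natural_filtration_subset:
  assumes "s \<in> T" "\<And>r. r \<in> T \<Longrightarrow> r \<le> s \<Longrightarrow> Y r \<in> borel_measurable N" "space N = space P"
  shows "sets (natural_filtration P T Y s) \<subseteq> sets N"
  unfolding natural_filtration_def
proof (rule sets_Sup_in_sets)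
  fix F assume "F \<in> (\<lambda>r. sigma_of P (Y r)) ` {r \<in> T. r \<le> s}"
  then obtain r where r: "r \<in> T" "r \<le> s" "F = sigma_of P (Y r)" by auto
  show "sets F \<subseteq> sets N" unfolding r(3) by (rule sigma_of_subset[OF assms(2,3)]) (rule r)+
  show "space F = space N" by (simp add: r assms)
qed (use assms(1) in auto)

lemma measurable_natural_filtration:
  assumes "r \<in> T" "r \<le> s"
  shows "Y r \<in> borel_measurable (natural_filtration P T Y s)"
  unfolding natural_filtration_def
  by (rule measurable_Sup1[OF imageI[of r] measurable_sigma_of]) (use assms in auto)

lemma (in finite_measure) finite_measure_subalgebraI:
  assumes "space F = space M" "sets F \<subseteq> sets M"
  shows "finite_measure_subalgebra M F"
  by unfold_locales (use assms in \<open>auto simp: subalgebra_def\<close>)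

abbreviation paths :: "real set \<Rightarrow> (real \<Rightarrow> real) measure" where
  "paths J \<equiv> PiM J (\<lambda>_. borel)"

abbreviation lpaths :: "real set \<Rightarrow> (real \<Rightarrow> real) measure" where
  "lpaths J \<equiv> PiM J (\<lambda>_. lborel)"

text \<open>
  The initial data of a Markov process on an arbitrary set \<open>T\<close> of times: marginal densities \<open>m\<close> and transition
  densities \<open>k\<close>. The state space is \<open>S\<close>, and \<open>x0\<close> is the value assigned on the null set where a coordinate leaves
  \<open>S\<close>.
\<close>

locale markov_densities =
  fixes T S :: "real set" and x0 :: real
    and m :: "real \<Rightarrow> real \<Rightarrow> ennreal" and k :: "real \<Rightarrow> real \<Rightarrow> real \<Rightarrow> real \<Rightarrow> ennreal"
  assumes m_measurable [measurable]: "m t \<in> borel_measurable borel"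
    and k_measurable_pair: "(\<lambda>(x, y). k s t x y) \<in> borel_measurable (borel \<Otimes>\<^sub>M borel)"
    and nn_integral_m: "t \<in> T \<Longrightarrow> (\<integral>\<^sup>+x. m t x \<partial>lborel) = 1"
    and nn_integral_k: "s \<in> T \<Longrightarrow> t \<in> T \<Longrightarrow> s < t \<Longrightarrow> (\<integral>\<^sup>+y. k s t x y \<partial>lborel) = 1"
    and nn_integral_m_k: "s \<in> T \<Longrightarrow> t \<in> T \<Longrightarrow> s < t \<Longrightarrow> (\<integral>\<^sup>+x. m s x * k s t x y \<partial>lborel) = m t y"
    and nn_integral_k_k: "s \<in> T \<Longrightarrow> t \<in> T \<Longrightarrow> u \<in> T \<Longrightarrow> s < t \<Longrightarrow> t < u \<Longrightarrow>
          (\<integral>\<^sup>+y. k s t x y * k t u y z \<partial>lborel) = k s u x z"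
    and S_measurable [measurable]: "S \<in> sets borel" and x0: "x0 \<in> S"
    and m_outside: "x \<notin> S \<Longrightarrow> m t x = 0"
begin

lemma k_measurable [measurable]:
  assumes [measurable]: "f \<in> borel_measurable M" "g \<in> borel_measurable M"
  shows "(\<lambda>w. k s t (f w) (g w)) \<in> borel_measurable M"
  using measurable_compose[OF _ k_measurable_pair, of "\<lambda>w. (f w, g w)" M s t] by simp

lemma measurable_k_right: "k s t x \<in> borel_measurable lborel"
  by measurable

lemma measurable_k_times:
  assumes [measurable]: "g \<in> borel_measurable borel"
  shows "(\<lambda>y. k s t x y * g y) \<in> borel_measurable lborel"
  by measurable

lemma measurable_nn_integral_k_times:
  assumes [measurable]: "g \<in> borel_measurable borel"
  shows "(\<lambda>x. \<integral>\<^sup>+y. k s t x y * g y \<partial>lborel) \<in> borel_measurable borel"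
  by (intro lborel.borel_measurable_nn_integral) measurable

text \<open>
  The joint density at finitely many times has one factor for each time \<open>j\<close>: the transition density from the preceding
  time in \<open>J\<close> if there is one, and the marginal density otherwise. Indexing the factors by the times rather than
  listing them in order makes it easy to compare the densities of \<open>J\<close> and \<open>insert i J\<close>.
\<close>

definition preds :: "real set \<Rightarrow> real \<Rightarrow> real set" where "preds J j = {i\<in>J. i < j}"

definition factor :: "real set \<Rightarrow> real \<Rightarrow> (real \<Rightarrow> real) \<Rightarrow> ennreal" where
  "factor J j w = (if preds J j = {} then m j (w j) else k (Max (preds J j)) j (w (Max (preds J j))) (w j))"

definition fdd_density :: "real set \<Rightarrow> (real \<Rightarrow> real) \<Rightarrow> ennreal" where
  "fdd_density J w = (\<Prod>j\<in>J. factor J j w)"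

definition fdd :: "real set \<Rightarrow> (real \<Rightarrow> real) measure" where
  "fdd J = density (lpaths J) (fdd_density J)"

lemma finite_preds: "finite J \<Longrightarrow> finite (preds J j)"
  by (simp add: preds_def)

lemma mem_preds: "i \<in> preds J j \<longleftrightarrow> i \<in> J \<and> i < j"
  by (simp add: preds_def)

lemma Max_preds: "finite J \<Longrightarrow> preds J j \<noteq> {} \<Longrightarrow> Max (preds J j) \<in> J \<and> Max (preds J j) < j"
  using Max_in[OF finite_preds] mem_preds by blast

lemma sets_PiM_lborel: "sets (lpaths J) = sets (paths J)"
  by (intro sets_PiM_cong) auto

lemma measurable_PiM_lborel_iff: "f \<in> measurable (lpaths J) N \<longleftrightarrow> f \<in> measurable (paths J) N"
  by (rule arg_cong[where f = "\<lambda>X. f \<in> X"], rule measurable_cong_sets[OF sets_PiM_lborel refl])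

lemma measurable_coordinate:
  "j \<in> J \<Longrightarrow> (\<lambda>w. w j) \<in> borel_measurable (lpaths J)"
  unfolding measurable_PiM_lborel_iff by (rule measurable_component_singleton)

lemma measurable_factor:
  assumes "finite J" "j \<in> J"
  shows "factor J j \<in> borel_measurable (lpaths J)"
proof -
  show ?thesis
  proof (cases "preds J j = {}")
    case False
    have "Max (preds J j) \<in> J" using Max_preds[OF assms(1) False] by (rule conjunct1)
    from k_measurable[OF measurable_coordinate[OF this] measurable_coordinate[OF assms(2)]]
    show ?thesis unfolding factor_def using False by simp
  next
    case True
    have "factor J j = (\<lambda>w. m j (w j))" using True by (simp add: factor_def fun_eq_iff)
    thus ?thesis using measurable_compose[OF measurable_coordinate[OF assms(2)] m_measurable] by simp
  qed
qed

lemma measurable_fdd_density [measurable]: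
  "finite J \<Longrightarrow> fdd_density J \<in> borel_measurable (lpaths J)"
  unfolding fdd_density_def by (intro borel_measurable_prod_ennreal measurable_factor)

lemma preds_insert:
  "preds (insert i H) j = (if i < j then insert i (preds H j) else preds H j)"
  by (auto simp: preds_def)

lemma factor_fun_upd:
  assumes "i \<noteq> j" "i \<notin> preds J j" "finite J"
  shows "factor J j (w(i := y)) = factor J j w"
  using assms Max_in[OF finite_preds[OF assms(3)], of j] by (auto simp: factor_def)

text \<open>
  Inserting a time \<open>i\<close> changes only the factors of \<open>i\<close> and of its successor \<open>n\<close>. If there is no successor, the
  factor of \<open>i\<close> integrates to \<open>1\<close>. Otherwise the product of both factors integrates to the old factor of \<open>n\<close>,
  by the Chapman--Kolmogorov equation or, if \<open>i\<close> has no predecessor, by the invariance of the marginals.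
\<close>

lemma nn_integral_fdd_density_insert:
  assumes H: "finite H" "H \<subseteq> T" and i: "i \<in> T" "i \<notin> H"
  shows "(\<integral>\<^sup>+y. fdd_density (insert i H) (w(i := y)) \<partial>lborel) = fdd_density H w"
proof -
  define J where "J = insert i H"
  have J: "finite J" "J \<subseteq> T" using H i by (auto simp: J_def)
  have predi: "preds J i = preds H i" by (simp add: J_def preds_insert)
  have i_notin: "i \<notin> preds H j" for j using i by (auto simp: preds_def)
  define fi where "fi y = factor J i (w(i := y))" for y
  have fi: "fi y = (if preds H i = {} then m i y else k (Max (preds H i)) i (w (Max (preds H i))) y)" for y
  proof (cases "preds H i = {}")
    case False
    have "Max (preds H i) < i" using Max_preds[OF H(1) False] by (rule conjunct2)
    hence "Max (preds H i) \<noteq> i" by simp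
    thus ?thesis by (simp add: fi_def factor_def predi)
  qed (simp add: fi_def factor_def predi)
  have [measurable]: "fi \<in> borel_measurable borel"
  proof -
    have "fi = (\<lambda>y. if preds H i = {} then m i y else k (Max (preds H i)) i (w (Max (preds H i))) y)"
      by (rule ext) (rule fi)
    thus ?thesis by (cases "preds H i = {}") simp_all
  qed
  have split: "fdd_density J (w(i := y)) = fi y * (\<Prod>j\<in>H. factor J j (w(i := y)))" for y
    using H i unfolding fdd_density_def fi_def J_def by simp
  have same: "factor J j (w(i := y)) = factor H j w" if "j \<in> H" "\<not> i < j" for j y
  proof -
    have "preds J j = preds H j" using that by (simp add: J_def preds_insert)
    hence "factor J j (w(i := y)) = factor H j (w(i := y))" by (simp add: factor_def)
    thus ?thesis using factor_fun_upd[of i j H w y] that i i_notin H by auto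
  qed
  show ?thesis
  proof (cases "\<exists>j\<in>H. i < j")
    case False
    have "(\<integral>\<^sup>+y. fdd_density J (w(i := y)) \<partial>lborel) = (\<integral>\<^sup>+y. fi y * fdd_density H w \<partial>lborel)"
    proof -
      have "(\<Prod>j\<in>H. factor J j (w(i := y))) = fdd_density H w" for y
        unfolding fdd_density_def using False same by (intro prod.cong) auto
      thus ?thesis by (simp only: split)
    qed
    also have "\<dots> = (\<integral>\<^sup>+y. fi y \<partial>lborel) * fdd_density H w" by (rule nn_integral_multc) simp
    also have "(\<integral>\<^sup>+y. fi y \<partial>lborel) = 1"
      unfolding fi using Max_preds[OF H(1), of i] H i
      by (cases "preds H i = {}") (auto intro!: nn_integral_m nn_integral_k)
    finally show ?thesis by (simp only: J_def mult_1_left)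
  next
    case True
    define n where "n = Min {j\<in>H. i < j}"
    have "n \<in> {j\<in>H. i < j}" unfolding n_def using True H by (intro Min_in) auto
    hence n: "n \<in> H" "i < n" by auto
    have n_le: "n \<le> j" if "j \<in> H" "i < j" for j
      unfolding n_def using that H by (intro Min_le) auto
    have predn: "preds H n = preds H i"
    proof (rule set_eqI)
      show "x \<in> preds H n \<longleftrightarrow> x \<in> preds H i" for x
        using n n_le[of x] i by (cases x i rule: linorder_cases) (auto simp: mem_preds)
    qed
    have "Max (insert i (preds H n)) = i"
      unfolding predn using finite_preds[OF H(1), of i]
      by (intro Max_eqI) (auto simp: preds_def)
    hence fn: "factor J n (w(i := y)) = k i n y (w n)" for y
      using n by (simp add: factor_def J_def preds_insert)
    have same': "factor J j (w(i := y)) = factor H j w" if j: "j \<in> H" "j \<noteq> n" for j y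
    proof (cases "i < j")
      case True
      have nj: "n \<in> preds H j" using n_le[OF j(1) True] j n by (auto simp: preds_def)
      have "Max (insert i (preds H j)) = max i (Max (preds H j))"
        using nj finite_preds[OF H(1), of j] by (intro Max_insert) auto
      also have "\<dots> = Max (preds H j)"
        using Max_ge[OF finite_preds[OF H(1)] nj] n(2) by simp
      finally have "Max (insert i (preds H j)) = Max (preds H j)" .
      hence "factor J j (w(i := y)) = factor H j (w(i := y))"
        using nj True by (auto simp: factor_def J_def preds_insert)
      thus ?thesis using factor_fun_upd[of i j H w y] True i_notin H by auto
    qed (use same j in auto)
    have prodH: "(\<Prod>j\<in>H. factor J j (w(i := y))) = k i n y (w n) * (\<Prod>j\<in>H - {n}. factor H j w)" for y
      using H n by (simp add: prod.remove[OF H(1) n(1)] fn same')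
    have "(\<integral>\<^sup>+y. fdd_density J (w(i := y)) \<partial>lborel)
        = (\<integral>\<^sup>+y. fi y * k i n y (w n) * (\<Prod>j\<in>H - {n}. factor H j w) \<partial>lborel)"
      by (simp add: split prodH mult.assoc)
    also have "\<dots> = (\<integral>\<^sup>+y. fi y * k i n y (w n) \<partial>lborel) * (\<Prod>j\<in>H - {n}. factor H j w)"
      by (rule nn_integral_multc) measurable
    also have "(\<integral>\<^sup>+y. fi y * k i n y (w n) \<partial>lborel) = factor H n w"
    proof (cases "preds H i = {}")
      case True
      thus ?thesis using n H i unfolding fi factor_def predn
        by (simp) (intro nn_integral_m_k, auto)
    next
      case False
      hence "Max (preds H i) \<in> T" "Max (preds H i) < i" using Max_preds[OF H(1) False] H by auto
      thus ?thesis using n H i False unfolding fi factor_def predn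
        by (simp) (intro nn_integral_k_k, auto)
    qed
    also have "factor H n w * (\<Prod>j\<in>H - {n}. factor H j w) = fdd_density H w"
      unfolding fdd_density_def by (rule prod.remove[OF H(1) n(1), symmetric])
    finally show ?thesis by (simp only: J_def)
  qed
qed

lemma sets_fdd [simp]: "sets (fdd J) = sets (paths J)"
  by (simp add: fdd_def sets_PiM_lborel)

lemma space_fdd [simp]: "space (fdd J) = space (paths J)"
  by (rule sets_eq_imp_space_eq) simp

lemma nn_integral_fdd:
  assumes "finite J" "f \<in> borel_measurable (paths J)"
  shows "(\<integral>\<^sup>+w. f w \<partial>fdd J) = (\<integral>\<^sup>+w. fdd_density J w * f w \<partial>lpaths J)"
  unfolding fdd_def by (rule nn_integral_density) (use assms in \<open>auto simp: measurable_PiM_lborel_iff\<close>)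

lemma nn_integral_fdd_insert:
  assumes H: "finite H" "i \<notin> H" and f: "f \<in> borel_measurable (paths (insert i H))"
  shows "(\<integral>\<^sup>+w. f w \<partial>fdd (insert i H))
    = (\<integral>\<^sup>+w. (\<integral>\<^sup>+y. fdd_density (insert i H) (w(i := y)) * f (w(i := y)) \<partial>lborel) \<partial>lpaths H)"
proof -
  interpret product_sigma_finite "\<lambda>_. lborel :: real measure" ..
  show ?thesis
    using assms by (subst nn_integral_fdd) (auto simp: measurable_PiM_lborel_iff[symmetric] product_nn_integral_insert)
qed

lemma distr_fdd_insert:
  assumes H: "finite H" "H \<subseteq> T" "i \<in> T"
  shows "distr (fdd (insert i H)) (paths H) (\<lambda>w. restrict w H) = fdd H"
proof (cases "i \<in> H")
  case True
  have "distr (fdd H) (paths H) (\<lambda>w. restrict w H) = distr (fdd H) (fdd H) (\<lambda>w. w)"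
    by (intro distr_cong) (auto simp: space_PiM)
  thus ?thesis using True by (simp add: insert_absorb)
next
  case False
  have rm: "(\<lambda>w. restrict w H) \<in> measurable (fdd (insert i H)) (paths H)"
    by (subst measurable_cong_sets[OF sets_fdd refl]) (rule measurable_restrict_subset, auto)
  show ?thesis
  proof (rule measure_eqI)
    fix X assume "X \<in> sets (distr (fdd (insert i H)) (paths H) (\<lambda>w. restrict w H))"
    hence X: "X \<in> sets (paths H)" by simp
    have X': "(\<lambda>w. indicator X (restrict w H) :: ennreal) \<in> borel_measurable (paths (insert i H))"
      using measurable_compose[OF measurable_restrict_subset[of H "insert i H" "\<lambda>_. borel"], of "indicator X"] X by auto
    have "emeasure (distr (fdd (insert i H)) (paths H) (\<lambda>w. restrict w H)) X
       = (\<integral>\<^sup>+w. indicator X w \<partial>distr (fdd (insert i H)) (paths H) (\<lambda>w. restrict w H))"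
      using X by simp
    also have "\<dots> = (\<integral>\<^sup>+w. indicator X (restrict w H) \<partial>fdd (insert i H))"
      using X by (intro nn_integral_distr rm) simp
    also have "\<dots> = (\<integral>\<^sup>+w. (\<integral>\<^sup>+y. fdd_density (insert i H) (w(i := y)) * indicator X (restrict (w(i := y)) H) \<partial>lborel)
        \<partial>lpaths H)"
      by (rule nn_integral_fdd_insert[OF H(1) False X'])
    also have "\<dots> = (\<integral>\<^sup>+w. fdd_density H w * indicator X w \<partial>lpaths H)"
    proof (intro nn_integral_cong)
      fix w assume "w \<in> space (lpaths H)"
      hence r: "restrict (w(i := y)) H = w" for y using False by (auto simp: space_PiM fun_eq_iff PiE_def extensional_def)
      have "(\<integral>\<^sup>+y. fdd_density (insert i H) (w(i := y)) * indicator X w \<partial>lborel)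
         = (\<integral>\<^sup>+y. fdd_density (insert i H) (w(i := y)) \<partial>lborel) * indicator X w"
        by (cases "w \<in> X") auto
      thus "(\<integral>\<^sup>+y. fdd_density (insert i H) (w(i := y)) * indicator X (restrict (w(i := y)) H) \<partial>lborel)
        = fdd_density H w * indicator X w"
        unfolding r using nn_integral_fdd_density_insert[OF H False] by simp
    qed
    also have "\<dots> = (\<integral>\<^sup>+w. indicator X w \<partial>fdd H)"
      using X by (intro nn_integral_fdd[symmetric] H) simp
    finally show "emeasure (distr (fdd (insert i H)) (paths H) (\<lambda>w. restrict w H)) X = emeasure (fdd H) X"
      using X by simp
  qed simp
qed

lemma distr_fdd:
  assumes "J \<subseteq> H" "finite H" "H \<subseteq> T"
  shows "fdd J = distr (fdd H) (paths J) (\<lambda>w. restrict w J)"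
proof -
  have fin: "finite J" using assms finite_subset by blast
  have "fdd J = distr (fdd (J \<union> K)) (paths J) (\<lambda>w. restrict w J)" if "finite K" "J \<union> K \<subseteq> T" for K
    using that
  proof (induction K rule: finite_induct)
    case empty
    have "distr (fdd J) (paths J) (\<lambda>w. restrict w J) = distr (fdd J) (fdd J) (\<lambda>w. w)"
      by (intro distr_cong) (auto simp: space_PiM)
    also have "\<dots> = fdd J" by (rule distr_id)
    finally show ?case by (simp only: Un_empty_right)
  next
    case (insert i K)
    have "fdd J = distr (fdd (J \<union> K)) (paths J) (\<lambda>w. restrict w J)"
      by (rule insert.IH) (use insert.prems in auto)
    also have "fdd (J \<union> K) = distr (fdd (insert i (J \<union> K))) (paths (J \<union> K)) (\<lambda>w. restrict w (J \<union> K))"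
      using insert fin by (intro distr_fdd_insert[symmetric]) auto
    also have "distr \<dots> (paths J) (\<lambda>w. restrict w J)
       = distr (fdd (insert i (J \<union> K))) (paths J) ((\<lambda>w. restrict w J) \<circ> (\<lambda>w. restrict w (J \<union> K)))"
      by (intro distr_distr measurable_restrict_subset)
        (auto simp: measurable_cong_sets[OF sets_fdd refl] intro!: measurable_restrict_subset)
    also have "(\<lambda>w. restrict w J) \<circ> (\<lambda>w. restrict w (J \<union> K)) = (\<lambda>w. restrict w J :: real \<Rightarrow> real)"
      by (auto simp: fun_eq_iff)
    finally show ?case by simp
  qed
  from this[of H] assms show ?thesis by (simp add: Un_absorb1)
qed

lemma prob_space_fdd:
  assumes "finite J" "J \<subseteq> T"
  shows "prob_space (fdd J)"
proof
  have "fdd {} = distr (fdd J) (paths {}) (\<lambda>w. restrict w {})"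
    using assms by (intro distr_fdd) auto
  moreover have "emeasure (fdd {}) (space (fdd {})) = 1"
  proof -
    interpret product_sigma_finite "\<lambda>_. lborel :: real measure" ..
    have "emeasure (fdd {}) (space (fdd {})) = (\<integral>\<^sup>+w. 1 \<partial>fdd {})" by simp
    also have "\<dots> = 1" by (subst nn_integral_fdd) (auto simp: PiM_empty fdd_density_def)
    finally show ?thesis .
  qed
  moreover have "(\<lambda>w. restrict w {}) \<in> measurable (fdd J) (paths {})"
    by (auto simp: measurable_cong_sets[OF sets_fdd refl] intro!: measurable_restrict_subset)
  ultimately show "emeasure (fdd J) (space (fdd J)) = 1"
    using emeasure_distr[of "\<lambda>w. restrict w {}" "fdd J" "paths {}" "space (paths {})"]
    by (simp add: vimage_def) (simp add: space_PiM restrict_def)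
qed

sublocale polish_projective T fdd
  by (intro polish_projective.intro projective_family.intro distr_fdd prob_space_fdd)

abbreviation Q :: "(real \<Rightarrow> real) measure" where "Q \<equiv> lim"

lemma distr_Q:
  assumes "finite J" "J \<subseteq> T"
  shows "distr Q (paths J) (\<lambda>w. restrict w J) = fdd J"
proof (rule measure_eqI)
  have rm: "(\<lambda>w. restrict w J) \<in> measurable Q (paths J)"
    using assms by (subst measurable_cong_sets[OF sets_lim refl]) (rule measurable_restrict_subset)
  fix X assume "X \<in> sets (distr Q (paths J) (\<lambda>w. restrict w J))"
  hence X: "X \<in> sets (paths J)" by simp
  have "emeasure (distr Q (paths J) (\<lambda>w. restrict w J)) X = emeasure Q (prod_emb T (\<lambda>_. borel) J X)"
    using X by (subst emeasure_distr[OF rm]) (auto simp: prod_emb_def space_PiM)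
  thus "emeasure (distr Q (paths J) (\<lambda>w. restrict w J)) X = emeasure (fdd J) X"
    using emeasure_lim_emb[OF assms(2,1) X] by simp
qed simp

lemma measurable_restrict_Q: "J \<subseteq> T \<Longrightarrow> (\<lambda>w. restrict w J) \<in> measurable Q (paths J)"
  by (subst measurable_cong_sets[OF sets_lim refl]) (rule measurable_restrict_subset)

lemma measurable_X: "t \<in> T \<Longrightarrow> (\<lambda>w. w t) \<in> borel_measurable Q"
  by (subst measurable_cong_sets[OF sets_lim refl]) (rule measurable_component_singleton)

lemma nn_integral_Q:
  assumes "finite J" "J \<subseteq> T" "f \<in> borel_measurable (paths J)"
  shows "(\<integral>\<^sup>+w. f (restrict w J) \<partial>Q) = (\<integral>\<^sup>+w. fdd_density J w * f w \<partial>lpaths J)"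
proof -
  have "(\<integral>\<^sup>+w. f (restrict w J) \<partial>Q) = (\<integral>\<^sup>+w. f w \<partial>distr Q (paths J) (\<lambda>w. restrict w J))"
    using assms by (intro nn_integral_distr[symmetric] measurable_restrict_Q) auto
  thus ?thesis using assms by (simp only: distr_Q nn_integral_fdd)
qed

text \<open>
  The Markov property for cylinder functions: if \<open>t\<close> lies after all times in \<open>J\<close>, the joint density on
  \<open>insert t J\<close> is that on \<open>J\<close> times one transition density from \<open>Max J\<close>.
\<close>

lemma nn_integral_Q_next:
  assumes J: "finite J" "J \<subseteq> T" "s \<in> J" "\<And>j. j \<in> J \<Longrightarrow> j \<le> s" and t: "t \<in> T" "s < t"
    and f: "f \<in> borel_measurable (paths J)" and g [measurable]: "g \<in> borel_measurable borel"
  shows "(\<integral>\<^sup>+w. f (restrict w J) * g (w t) \<partial>Q) = (\<integral>\<^sup>+w. f (restrict w J) * (\<integral>\<^sup>+y. k s t (w s) y * g y \<partial>lborel) \<partial>Q)"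
proof -
  have kg1: "(\<lambda>y. k s t x y * g y) \<in> borel_measurable lborel" for x
    by (rule measurable_k_times[OF g])
  have tJ: "t \<notin> J" using J t by force
  have fr: "(\<lambda>w. f (restrict w J)) \<in> borel_measurable (paths (insert t J))"
    by (rule measurable_compose[OF measurable_restrict_subset f]) auto
  have "(\<lambda>w. w t) \<in> borel_measurable (paths (insert t J))"
    by (rule measurable_component_singleton) simp
  hence fg: "(\<lambda>w. f (restrict w J) * g (w t)) \<in> borel_measurable (paths (insert t J))"
    by (intro borel_measurable_times_ennreal fr measurable_compose[OF _ g])
  have ws: "(\<lambda>w. w s) \<in> borel_measurable (paths J)"
    by (rule measurable_component_singleton) (rule J)
  have kg: "(\<lambda>x. \<integral>\<^sup>+y. k s t x y * g y \<partial>lborel) \<in> borel_measurable borel"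
    by (rule measurable_nn_integral_k_times[OF g])
  have dens: "fdd_density (insert t J) (w(t := y)) = fdd_density J w * k s t (w s) y" for w y
  proof -
    have pt: "preds (insert t J) t = J" using J t tJ by (force simp: preds_def)
    have Ms: "Max J = s" using J by (intro Max_eqI) auto
    have pj: "preds (insert t J) j = preds J j" if "j \<in> J" for j
      using J(4)[OF that] t by (auto simp: preds_def)
    have "factor (insert t J) j (w(t := y)) = factor J j w" if "j \<in> J" for j
    proof -
      have "factor (insert t J) j (w(t := y)) = factor J j (w(t := y))" by (simp add: factor_def pj that)
      also have "\<dots> = factor J j w"
        using that tJ J by (intro factor_fun_upd) (auto simp: preds_def)
      finally show ?thesis .
    qed
    moreover have "factor (insert t J) t (w(t := y)) = k s t (w s) y"
      using J(3) t by (auto simp: factor_def pt Ms)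
    ultimately show ?thesis using J tJ by (simp add: fdd_density_def mult.commute)
  qed
  have rt: "restrict w (insert t J) t = w t" "restrict (restrict w (insert t J)) J = restrict w J" for w :: "real \<Rightarrow> real"
    by (auto simp: Int_absorb1 subset_insertI)
  have "(\<integral>\<^sup>+w. f (restrict w J) * g (w t) \<partial>Q)
     = (\<integral>\<^sup>+w. (\<lambda>w. f (restrict w J) * g (w t)) (restrict w (insert t J)) \<partial>Q)"
    by (simp only: rt)
  also have "\<dots> = (\<integral>\<^sup>+w. (\<lambda>w. f (restrict w J) * g (w t)) w \<partial>fdd (insert t J))"
    using J t by (subst nn_integral_Q[OF _ _ fg]) (simp_all add: nn_integral_fdd[OF _ fg])
  also have "\<dots> = (\<integral>\<^sup>+w. (\<integral>\<^sup>+y. fdd_density (insert t J) (w(t := y)) * (f (restrict (w(t := y)) J) * g y) \<partial>lborel) \<partial>lpaths J)"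
    by (subst nn_integral_fdd_insert[OF J(1) tJ fg]) (simp only: fun_upd_same)
  also have "\<dots> = (\<integral>\<^sup>+w. fdd_density J w * (f w * (\<integral>\<^sup>+y. k s t (w s) y * g y \<partial>lborel)) \<partial>lpaths J)"
  proof (intro nn_integral_cong)
    fix w assume "w \<in> space (lpaths J)"
    hence r: "restrict (w(t := y)) J = w" for y using tJ by (auto simp: space_PiM fun_eq_iff PiE_def extensional_def)
    have "(\<integral>\<^sup>+y. fdd_density (insert t J) (w(t := y)) * (f (restrict (w(t := y)) J) * g y) \<partial>lborel)
      = (\<integral>\<^sup>+y. (fdd_density J w * f w) * (k s t (w s) y * g y) \<partial>lborel)"
      unfolding r dens by (simp only: mult_ac)
    also have "\<dots> = (fdd_density J w * f w) * (\<integral>\<^sup>+y. k s t (w s) y * g y \<partial>lborel)"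
      by (rule nn_integral_cmult) (rule kg1)
    finally show "(\<integral>\<^sup>+y. fdd_density (insert t J) (w(t := y)) * (f (restrict (w(t := y)) J) * g y) \<partial>lborel)
      = fdd_density J w * (f w * (\<integral>\<^sup>+y. k s t (w s) y * g y \<partial>lborel))" by (simp add: mult.assoc)
  qed
  also have "\<dots> = (\<integral>\<^sup>+w. (\<lambda>w. f w * (\<integral>\<^sup>+y. k s t (w s) y * g y \<partial>lborel)) (restrict w J) \<partial>Q)"
  proof (rule nn_integral_Q[symmetric, OF J(1,2)])
    have "(\<lambda>w. \<integral>\<^sup>+y. k s t (w s) y * g y \<partial>lborel) \<in> borel_measurable (paths J)"
      by (rule measurable_compose[OF ws kg])
    thus "(\<lambda>w. f w * (\<integral>\<^sup>+y. k s t (w s) y * g y \<partial>lborel)) \<in> borel_measurable (paths J)"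
      using f by (intro borel_measurable_times_ennreal)
  qed
  also have "\<dots> = (\<integral>\<^sup>+w. f (restrict w J) * (\<integral>\<^sup>+y. k s t (w s) y * g y \<partial>lborel) \<partial>Q)"
    using J(3) by (simp only: restrict_apply' if_True)
  finally show ?thesis .
qed

text \<open>
  As functions of the event \<open>A\<close>, both sides are finite measures on the paths up to time \<open>s\<close>. They agree on cylinders
  by the preceding lemma (with the time \<open>s\<close> added to the base of the cylinder), hence on the whole filtration.
\<close>

lemma markov_emeasure:
  assumes s: "s \<in> T" and t: "t \<in> T" "s < t" and B [measurable]: "B \<in> sets borel"
    and A: "A \<in> sets (natural_filtration Q T (\<lambda>r w. w r) s)"
  shows "(\<integral>\<^sup>+w. indicator A w * indicator B (w t) \<partial>Q)
    = (\<integral>\<^sup>+w. indicator A w * (\<integral>\<^sup>+y. k s t (w s) y * indicator B y \<partial>lborel) \<partial>Q)"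
proof -
  define I where "I = {r\<in>T. r \<le> s}"
  have I: "I \<subseteq> T" "s \<in> I" using s by (auto simp: I_def)
  let ?K = "\<lambda>w. \<integral>\<^sup>+y. k s t (w s) y * indicator B y \<partial>lborel"
  have kB: "(\<lambda>x. \<integral>\<^sup>+y. k s t x y * indicator B y \<partial>lborel) \<in> borel_measurable borel"
    by (rule measurable_nn_integral_k_times) simp
  have rI: "(\<lambda>w. restrict w I) \<in> measurable Q (paths I)"
    by (rule measurable_restrict_Q[OF I(1)])
  have Bt: "(\<lambda>w. indicator B (w t) :: ennreal) \<in> borel_measurable Q"
    by (rule measurable_compose[OF measurable_X[OF t(1)]]) measurable
  have XI: "(\<lambda>w. indicator X (restrict w I) :: ennreal) \<in> borel_measurable Q"
    if "X \<in> sets (paths I)" for X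
    by (rule measurable_compose[OF rI]) (use that in simp)
  have K [measurable]: "?K \<in> borel_measurable Q" by (rule measurable_compose[OF measurable_X[OF s] kB])
  define M1 where "M1 = distr (density Q (\<lambda>w. indicator B (w t))) (paths I) (\<lambda>w. restrict w I)"
  define M2 where "M2 = distr (density Q ?K) (paths I) (\<lambda>w. restrict w I)"
  have em: "emeasure (distr (density Q g) (paths I) (\<lambda>w. restrict w I)) X = (\<integral>\<^sup>+w. indicator X (restrict w I) * g w \<partial>Q)"
    if X: "X \<in> sets (paths I)" and g: "g \<in> borel_measurable Q" for X g
  proof -
    let ?D = "distr (density Q g) (paths I) (\<lambda>w. restrict w I)"
    have "emeasure ?D X = (\<integral>\<^sup>+w. indicator X w \<partial>?D)" using X by simp
    also have "\<dots> = (\<integral>\<^sup>+w. indicator X (restrict w I) \<partial>density Q g)"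
      using X by (intro nn_integral_distr) (simp_all add: rI)
    also have "\<dots> = (\<integral>\<^sup>+w. g w * indicator X (restrict w I) \<partial>Q)"
      by (intro nn_integral_density g XI X)
    finally show ?thesis by (simp add: mult.commute)
  qed
  note em1 = em[OF _ Bt, folded M1_def] and em2 = em[OF _ K, folded M2_def]
  have eq: "emeasure M1 (prod_emb I (\<lambda>_. borel) J (PiE J E)) = emeasure M2 (prod_emb I (\<lambda>_. borel) J (PiE J E))"
    if J: "finite J" "J \<subseteq> I" and E: "\<And>i. i \<in> J \<Longrightarrow> E i \<in> sets (borel :: real measure)" for E J
  proof -
    \<comment> \<open>The conditional law refers to the value at time \<open>s\<close>, so \<open>s\<close> must belong to the base of the cylinder.\<close>
    define J' where "J' = insert s J"
    define f where "f w = (\<Prod>j\<in>J. indicator (E j) (w j) :: ennreal)" for w :: "real \<Rightarrow> real"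
    have J': "finite J'" "J' \<subseteq> T" "s \<in> J'" "\<And>j. j \<in> J' \<Longrightarrow> j \<le> s" using J I by (auto simp: J'_def I_def)
    have f: "f \<in> borel_measurable (PiM J' (\<lambda>_. borel))"
      unfolding f_def
    proof (rule borel_measurable_prod_ennreal)
      fix j assume j: "j \<in> J"
      have "(\<lambda>w. w j) \<in> borel_measurable (PiM J' (\<lambda>_. borel :: real measure))"
        using j by (intro measurable_component_singleton) (simp add: J'_def)
      thus "(\<lambda>w. indicator (E j) (w j) :: ennreal) \<in> borel_measurable (PiM J' (\<lambda>_. borel))"
        using E[OF j] by measurable
    qed
    have PE: "prod_emb I (\<lambda>_. borel) J (PiE J E) \<in> sets (paths I)"
      using J E by (intro measurable_prod_emb sets_PiM_I_finite) auto
    have ind: "indicator (prod_emb I (\<lambda>_. borel) J (PiE J E)) (restrict w I) = f (restrict w J')" for w :: "real \<Rightarrow> real"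
    proof -
      have "f (restrict w J') = (\<Prod>j\<in>J. indicator (E j) (w j))"
        unfolding f_def by (intro prod.cong) (auto simp: J'_def)
      also have "\<dots> = (if \<forall>j\<in>J. w j \<in> E j then 1 else 0)"
        using J by (auto simp: indicator_def prod_zero_iff)
      also have "\<dots> = indicator (prod_emb I (\<lambda>_. borel) J (PiE J E)) (restrict w I)"
        using J by (auto simp: indicator_def prod_emb_def Int_absorb1 space_PiM PiE_def Pi_def extensional_def)
      finally show ?thesis ..
    qed
    show ?thesis
      unfolding em1[OF PE] em2[OF PE] ind by (rule nn_integral_Q_next[OF J' t f]) measurable
  qed
  have "M1 = M2"
  proof (rule measure_eqI_PiM_infinite[where M = "\<lambda>_. borel" and I = I])
    show "sets M1 = sets (paths I)" "sets M2 = sets (paths I)"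
      by (simp_all add: M1_def M2_def)
    show "finite_measure M1"
    proof
      have "emeasure M1 (space M1) \<le> (\<integral>\<^sup>+w. 1 \<partial>Q)"
      proof -
        have "space M1 \<in> sets (paths I)" by (simp add: M1_def)
        from em1[OF this] show ?thesis
          by (simp only:) (intro nn_integral_mono, auto simp: indicator_def)
      qed
      also have "\<dots> = 1" using P.emeasure_space_1 by simp
      finally show "emeasure M1 (space M1) \<noteq> \<infinity>" by (auto simp: top_unique)
    qed
    show "emeasure M1 (prod_emb I (\<lambda>_. borel) J (PiE J E)) = emeasure M2 (prod_emb I (\<lambda>_. borel) J (PiE J E))"
      if "finite J" "J \<subseteq> I" "\<And>i. i \<in> J \<Longrightarrow> E i \<in> sets borel" for E J
      using that by (rule eq)
  qed
  have "sets (natural_filtration Q T (\<lambda>r w. w r) s)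
      \<subseteq> sets (vimage_algebra (space Q) (\<lambda>w. restrict w I) (paths I))"
    unfolding natural_filtration_def I_def[symmetric]
  proof (rule sets_Sup_in_sets)
    show "(\<lambda>r. sigma_of Q (\<lambda>w. w r)) ` I \<noteq> {}" using I by auto
    fix N assume "N \<in> (\<lambda>r. sigma_of Q (\<lambda>w. w r)) ` I"
    then obtain r where r: "r \<in> I" "N = sigma_of Q (\<lambda>w. w r)" by auto
    show "space N = space (vimage_algebra (space Q) (\<lambda>w. restrict w I) (paths I))"
      by (simp add: r)
    show "sets N \<subseteq> sets (vimage_algebra (space Q) (\<lambda>w. restrict w I) (paths I))"
    proof
      fix Z assume "Z \<in> sets N"
      then obtain E where E: "E \<in> sets borel" "Z = (\<lambda>w. w r) -` E \<inter> space Q"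
        unfolding r by (subst (asm) sets_vimage_algebra2) auto
      define W where "W = (\<lambda>w. w r) -` E \<inter> space (paths I)"
      have "W \<in> sets (paths I)"
        unfolding W_def using r E by (intro measurable_sets[OF measurable_component_singleton])
      moreover have "Z = (\<lambda>w. restrict w I) -` W \<inter> space Q"
        using r by (auto simp: E W_def space_PiM)
      ultimately show "Z \<in> sets (vimage_algebra (space Q) (\<lambda>w. restrict w I) (paths I))"
        by (auto intro: in_vimage_algebra)
    qed
  qed
  with A have "A \<in> sets (vimage_algebra (space Q) (\<lambda>w. restrict w I) (paths I))" by auto
  moreover have "(\<lambda>w. restrict w I) \<in> space Q \<rightarrow> space (paths I)"
    by (auto simp: space_PiM)
  ultimately obtain X where X: "X \<in> sets (paths I)" "A = (\<lambda>w. restrict w I) -` X \<inter> space Q"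
    by (subst (asm) sets_vimage_algebra2) auto
  have indA: "indicator A w = (indicator X (restrict w I) :: ennreal)" if "w \<in> space Q" for w
    using that by (auto simp: X indicator_def)
  have "(\<integral>\<^sup>+w. indicator A w * indicator B (w t) \<partial>Q) = emeasure M1 X"
    unfolding em1[OF X(1)] by (intro nn_integral_cong) (simp only: indA)
  also have "\<dots> = emeasure M2 X" using \<open>M1 = M2\<close> by simp
  also have "\<dots> = (\<integral>\<^sup>+w. indicator A w * ?K w \<partial>Q)"
    unfolding em2[OF X(1)] by (intro nn_integral_cong) (simp only: indA)
  finally show ?thesis .
qed


lemma distr_X:
  assumes t: "t \<in> T"
  shows "distr Q lborel (\<lambda>w. w t) = density lborel (m t)"
proof (rule measure_eqI)
  interpret product_sigma_finite "\<lambda>_. lborel :: real measure" ..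
  fix B assume "B \<in> sets (distr Q lborel (\<lambda>w. w t))"
  hence B: "B \<in> sets borel" by simp
  have X: "(\<lambda>w. w t) \<in> measurable Q lborel" using measurable_X[OF t] by simp
  have iB: "(\<lambda>w. indicator B (w t) :: ennreal) \<in> borel_measurable (paths {t})"
    by (rule measurable_compose[OF measurable_component_singleton]) (use B in auto)
  have "emeasure (distr Q lborel (\<lambda>w. w t)) B = (\<integral>\<^sup>+x. indicator B x \<partial>distr Q lborel (\<lambda>w. w t))"
    using B by simp
  also have "\<dots> = (\<integral>\<^sup>+w. indicator B (w t) \<partial>Q)"
    using B by (intro nn_integral_distr X) simp
  also have "\<dots> = (\<integral>\<^sup>+w. (\<lambda>w. indicator B (w t)) (restrict w {t}) \<partial>Q)" by simp
  also have "\<dots> = (\<integral>\<^sup>+w. fdd_density {t} w * indicator B (w t) \<partial>lpaths {t})"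
    using t by (intro nn_integral_Q iB) auto
  also have "\<dots> = (\<integral>\<^sup>+w. (\<lambda>x. m t x * indicator B x) (w t) \<partial>lpaths {t})"
    by (simp add: fdd_density_def factor_def preds_def)
  also have "\<dots> = (\<integral>\<^sup>+x. m t x * indicator B x \<partial>lborel)"
    using B by (intro product_nn_integral_singleton) simp
  also have "\<dots> = emeasure (density lborel (m t)) B"
    using B by (simp add: emeasure_density)
  finally show "emeasure (distr Q lborel (\<lambda>w. w t)) B = emeasure (density lborel (m t)) B" .
qed simp

text \<open>
  The coordinate process takes values outside \<open>S\<close> on a null set that depends on the time; the modification removes
  them.
\<close>

definition Y :: "real \<Rightarrow> (real \<Rightarrow> real) \<Rightarrow> real" where
  "Y t w = (if w t \<in> S then w t else x0)"

lemma AE_Y_eq: "t \<in> T \<Longrightarrow> AE w in Q. Y t w = w t"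
proof -
  assume t: "t \<in> T"
  have "AE x in density lborel (m t). x \<in> S"
  proof (subst AE_density)
    have "x \<in> S" if "0 < m t x" for x using m_outside[of x t] that by (cases "x \<in> S") auto
    thus "AE x in lborel. 0 < m t x \<longrightarrow> x \<in> S" by simp
  qed simp
  hence "AE x in distr Q lborel (\<lambda>w. w t). x \<in> S" by (simp only: distr_X[OF t])
  hence "AE w in Q. w t \<in> S"
    using measurable_X[OF t] by (subst (asm) AE_distr_iff) auto
  thus ?thesis by (auto simp: Y_def)
qed

lemma measurable_Y_of_X:
  assumes X: "(\<lambda>w. w t) \<in> borel_measurable N"
  shows "Y t \<in> borel_measurable N"
proof -
  have "(\<lambda>x. if x \<in> S then x else x0) \<in> borel_measurable borel" by simp
  from measurable_compose[OF X this] show ?thesis by (simp add: Y_def[abs_def])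
qed

lemma measurable_Y: "t \<in> T \<Longrightarrow> Y t \<in> borel_measurable Q"
  by (intro measurable_Y_of_X measurable_X)

lemma distr_Y: "t \<in> T \<Longrightarrow> distr Q lborel (Y t) = density lborel (m t)"
  using distr_cong_AE[OF refl refl AE_Y_eq, of t lborel] measurable_Y measurable_X by (simp add: distr_X)

definition kernel :: "real \<Rightarrow> real \<Rightarrow> real set \<Rightarrow> real \<Rightarrow> ennreal" where
  "kernel s t B x = (\<integral>\<^sup>+y. k s t x y * indicator B y \<partial>lborel)"

lemma kernel_eq: "B \<in> sets borel \<Longrightarrow> kernel s t B x = emeasure (density lborel (k s t x)) B"
  unfolding kernel_def by (intro emeasure_density[symmetric] measurable_k_right) simp

lemma kernel_le_1: "s \<in> T \<Longrightarrow> t \<in> T \<Longrightarrow> s < t \<Longrightarrow> kernel s t B x \<le> 1"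
  unfolding kernel_def
  by (rule order_trans[OF nn_integral_mono, of _ _ "k s t x"]) (auto simp: indicator_def nn_integral_k)

text \<open>
  Stated for every \<open>\<sigma>\<close>-algebra between that of \<open>Y s\<close> and the past of the coordinate process. The two instances in which the
  \<open>\<sigma>\<close>-algebra is the past of \<open>Y\<close> and that of \<open>Y s\<close> give the Markov property and the transition law.
\<close>

lemma cond_exp_Y:
  assumes s: "s \<in> T" and t: "t \<in> T" "s < t" and B: "B \<in> sets borel"
    and G: "space G = space Q" "sets (sigma_of Q (Y s)) \<subseteq> sets G"
       "sets G \<subseteq> sets (natural_filtration Q T (\<lambda>r w. w r) s)"
  shows "AE w in Q. real_cond_exp Q G (indicator (Y t -` B \<inter> space Q)) w = measure (density lborel (k s t (Y s w))) B"
proof -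
  have FQ: "sets (natural_filtration Q T (\<lambda>r w. w r) s) \<subseteq> sets Q"
    by (rule natural_filtration_subset[OF s measurable_X]) auto
  interpret finite_measure_subalgebra Q G
    by (rule P.finite_measure_subalgebraI) (use G FQ in auto)
  have ms: "measure (density lborel (k s t x)) B = enn2real (kernel s t B x)" for x
    by (simp add: measure_def kernel_eq[OF B])
  have Kb: "kernel s t B \<in> borel_measurable borel"
    unfolding kernel_def[abs_def] by (rule measurable_nn_integral_k_times) (use B in simp)
  have YG: "Y s \<in> borel_measurable G"
    using measurable_sigma_of[of "Y s" Q] G(1,2) unfolding measurable_def by auto
  have KG: "(\<lambda>w. enn2real (kernel s t B (Y s w))) \<in> borel_measurable G"
    by (rule measurable_compose[OF measurable_compose[OF YG Kb]]) simp
  have KQ: "(\<lambda>w. enn2real (kernel s t B (Y s w))) \<in> borel_measurable Q"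
    by (rule measurable_from_subalg[OF subalg KG])
  have K1: "enn2real (kernel s t B x) \<le> 1" "ennreal (enn2real (kernel s t B x)) = kernel s t B x" for x
    using kernel_le_1[OF s t, of B x] order.strict_trans1[OF kernel_le_1[OF s t, of B x] ennreal_one_less_top]
    by (simp_all add: enn2real_leI)
  have YB: "Y t -` B \<inter> space Q \<in> sets Q" using measurable_sets[OF measurable_Y[OF t(1)] B] .
  have intK: "integrable Q (\<lambda>w. enn2real (kernel s t B (Y s w)))"
    using KQ K1(1) by (intro P.integrable_const_bound[of _ 1]) auto
  have intB: "integrable Q (indicator (Y t -` B \<inter> space Q) :: _ \<Rightarrow> real)"
    using YB by (simp add: integrable_indicator_iff P.emeasure_finite less_top[symmetric])
  have "AE w in Q. real_cond_exp Q G (indicator (Y t -` B \<inter> space Q)) w = enn2real (kernel s t B (Y s w))"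
  proof (rule real_cond_exp_charact[OF _ intB intK KG])
    fix A assume A: "A \<in> sets G"
    have AQ: "A \<in> sets Q" using A G(3) FQ by auto
    have "(\<integral>w\<in>A. (indicator (Y t -` B \<inter> space Q) w :: real) \<partial>Q)
        = (\<integral>w. indicator A w * indicator (Y t -` B \<inter> space Q) w \<partial>Q)"
      by (simp add: set_lebesgue_integral_def)
    also have "\<dots> = enn2real (\<integral>\<^sup>+w. ennreal (indicator A w * indicator (Y t -` B \<inter> space Q) w) \<partial>Q)"
      using AQ YB by (intro integral_eq_nn_integral borel_measurable_times borel_measurable_indicator) simp_all
    also have "(\<integral>\<^sup>+w. ennreal (indicator A w * indicator (Y t -` B \<inter> space Q) w) \<partial>Q)
        = (\<integral>\<^sup>+w. indicator A w * indicator B (w t) \<partial>Q)"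
      by (rule nn_integral_cong_AE)
        (use AE_Y_eq[OF t(1)] sets.sets_into_space[OF AQ] in \<open>auto simp: indicator_def elim!: eventually_mono\<close>)
    also have "\<dots> = (\<integral>\<^sup>+w. indicator A w * kernel s t B (w s) \<partial>Q)"
      unfolding kernel_def by (rule markov_emeasure[OF s t B]) (use A G in auto)
    also have "\<dots> = (\<integral>\<^sup>+w. ennreal (indicator A w * enn2real (kernel s t B (Y s w))) \<partial>Q)"
      by (rule nn_integral_cong_AE)
        (use AE_Y_eq[OF s] K1 in \<open>auto simp: ennreal_mult'' indicator_def elim!: eventually_mono\<close>)
    also have "enn2real \<dots> = (\<integral>w. indicator A w * enn2real (kernel s t B (Y s w)) \<partial>Q)"
      using AQ by (intro integral_eq_nn_integral[symmetric] borel_measurable_times KQ borel_measurable_indicator) simp_all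
    also have "\<dots> = (\<integral>w\<in>A. enn2real (kernel s t B (Y s w)) \<partial>Q)"
      by (simp add: set_lebesgue_integral_def)
    finally show "(\<integral>w\<in>A. (indicator (Y t -` B \<inter> space Q) w :: real) \<partial>Q) = (\<integral>w\<in>A. enn2real (kernel s t B (Y s w)) \<partial>Q)" .
  qed
  thus ?thesis by (simp only: ms)
qed

theorem markov_process_Y: "markov_process Q T S Y"
  unfolding markov_process_def
proof (intro conjI ballI impI)
  show "prob_space Q" by (rule P.prob_space_axioms)
  show "Y t \<in> Q \<rightarrow>\<^sub>M restrict_space borel S" if "t \<in> T" for t
    using measurable_Y[OF that] x0 by (intro measurable_restrict_space2) (auto simp: Y_def)
  fix s t B assume s: "s \<in> T" and t: "t \<in> T" "s \<le> t" and B: "B \<in> sets (borel :: real measure)"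
  let ?F = "natural_filtration Q T Y s"
  have YF: "sets (sigma_of Q (Y s)) \<subseteq> sets ?F"
    by (rule sigma_of_subset[OF measurable_natural_filtration]) (use s in \<open>auto simp: space_natural_filtration\<close>)
  have FX: "sets ?F \<subseteq> sets (natural_filtration Q T (\<lambda>r w. w r) s)"
    using s by (intro natural_filtration_subset measurable_Y_of_X measurable_natural_filtration)
      (auto simp: space_natural_filtration)
  show "AE w in Q. real_cond_exp Q ?F (indicator (Y t -` B \<inter> space Q)) w
      = real_cond_exp Q (sigma_of Q (Y s)) (indicator (Y t -` B \<inter> space Q)) w"
  proof (cases "s = t")
    case False
    hence "s < t" using t by simp
    have "AE w in Q. real_cond_exp Q ?F (indicator (Y t -` B \<inter> space Q)) w = measure (density lborel (k s t (Y s w))) B"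
      using s t \<open>s < t\<close> B YF FX by (intro cond_exp_Y) (auto simp: space_natural_filtration)
    moreover have "AE w in Q. real_cond_exp Q (sigma_of Q (Y s)) (indicator (Y t -` B \<inter> space Q)) w
        = measure (density lborel (k s t (Y s w))) B"
      using s t \<open>s < t\<close> B YF FX by (intro cond_exp_Y) auto
    ultimately show ?thesis by eventually_elim simp
  next
    case True
    have YQ: "sets (sigma_of Q (Y s)) \<subseteq> sets Q" "sets ?F \<subseteq> sets Q"
      by (rule sigma_of_subset[OF measurable_Y[OF s]], simp)
        (rule natural_filtration_subset[OF s measurable_Y], auto)
    interpret f1: finite_measure_subalgebra Q ?F
      by (rule P.finite_measure_subalgebraI) (use YQ s in \<open>auto simp: space_natural_filtration\<close>)
    interpret f2: finite_measure_subalgebra Q "sigma_of Q (Y s)"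
      by (rule P.finite_measure_subalgebraI) (use YQ in auto)
    have ev: "Y t -` B \<inter> space Q \<in> sets (sigma_of Q (Y s))"
      using True B by (auto simp: sets_sigma_of)
    have int: "integrable Q (indicator (Y t -` B \<inter> space Q) :: _ \<Rightarrow> real)"
      using ev YQ by (intro integrable_real_indicator) (auto simp: P.emeasure_finite less_top[symmetric])
    have "AE w in Q. real_cond_exp Q ?F (indicator (Y t -` B \<inter> space Q)) w = indicator (Y t -` B \<inter> space Q) w"
      using ev YF by (intro f1.real_cond_exp_F_meas int borel_measurable_indicator) auto
    moreover have "AE w in Q. real_cond_exp Q (sigma_of Q (Y s)) (indicator (Y t -` B \<inter> space Q)) w
        = indicator (Y t -` B \<inter> space Q) w"
      using ev by (intro f2.real_cond_exp_F_meas int borel_measurable_indicator)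
    ultimately show ?thesis by eventually_elim simp
  qed
qed

lemma cond_exp_Y_sigma_of:
  assumes "s \<in> T" "t \<in> T" "s < t" "B \<in> sets borel"
  shows "AE w in Q. real_cond_exp Q (sigma_of Q (Y s)) (indicator (Y t -` B \<inter> space Q)) w
     = measure (density lborel (k s t (Y s w))) B"
proof (rule cond_exp_Y[OF assms])
  show "sets (sigma_of Q (Y s)) \<subseteq> sets (natural_filtration Q T (\<lambda>r w. w r) s)"
    using assms by (intro sigma_of_subset measurable_Y_of_X measurable_natural_filtration)
      (auto simp: space_natural_filtration)
qed auto

end

section \<open>Joint densities and conditional moments\<close>

lemma measure_eqI_times:
  fixes M N :: "('a :: second_countable_topology \<times> 'b :: second_countable_topology) measure"
  assumes M: "sets M = sets borel" and N: "sets N = sets borel" and fin: "emeasure M UNIV \<noteq> \<infinity>"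
    and eq: "\<And>A B. A \<in> sets borel \<Longrightarrow> B \<in> sets borel \<Longrightarrow> emeasure M (A \<times> B) = emeasure N (A \<times> B)"
  shows "M = N"
proof (rule measure_eqI_generator_eq[where A = "\<lambda>_. UNIV" and \<Omega> = UNIV
      and E = "{a \<times> b | a b. a \<in> sets (borel :: 'a measure) \<and> b \<in> sets (borel :: 'b measure)}"])
  show "Int_stable {a \<times> b | a b. a \<in> sets (borel :: 'a measure) \<and> b \<in> sets (borel :: 'b measure)}"
    by (rule Int_stable_pair_measure_generator)
  have "sets borel = sets (borel \<Otimes>\<^sub>M borel :: ('a \<times> 'b) measure)" by (simp only: borel_prod)
  also have "\<dots> = sigma_sets UNIV {a \<times> b | a b. a \<in> sets (borel :: 'a measure) \<and> b \<in> sets (borel :: 'b measure)}"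
    by (simp add: sets_pair_measure)
  finally show "sets M = sigma_sets UNIV {a \<times> b | a b. a \<in> sets (borel :: 'a measure) \<and> b \<in> sets (borel :: 'b measure)}"
    "sets N = sigma_sets UNIV {a \<times> b | a b. a \<in> sets (borel :: 'a measure) \<and> b \<in> sets (borel :: 'b measure)}"
    by (simp_all only: M N)
  show "emeasure M X = emeasure N X"
    if "X \<in> {a \<times> b | a b. a \<in> sets (borel :: 'a measure) \<and> b \<in> sets (borel :: 'b measure)}" for X
    using that eq by auto
  show "range (\<lambda>_::nat. UNIV) \<subseteq> {a \<times> b | a b. a \<in> sets (borel :: 'a measure) \<and> b \<in> sets (borel :: 'b measure)}"
    using UNIV_Times_UNIV by (auto intro!: exI[of _ UNIV])
qed (use fin in auto)

text \<open>
  If the conditional law of \<open>Z\<close> given \<open>G\<close> depends only on a \<open>G\<close>-measurable \<open>X\<close> and has density \<open>k (X w)\<close>, then \<open>(X, Z)\<close>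
  has density \<open>p x * k x z\<close>. The case \<open>G = \<sigma>(X)\<close> gives the law of the process at two times; with \<open>G\<close> the past of
  the process and \<open>X\<close> a pair of values it gives three times.
\<close>

lemma distributed_Pair_of_cond_exp:
  fixes X :: "'w \<Rightarrow> 'b :: euclidean_space" and Z :: "'w \<Rightarrow> real" and p :: "'b \<Rightarrow> real" and k :: "'b \<Rightarrow> real \<Rightarrow> real"
  assumes P: "prob_space P" and G: "space G = space P" "sets G \<subseteq> sets P"
    and X: "distributed P lborel X (\<lambda>x. ennreal (p x))" "X \<in> borel_measurable G"
    and Z: "Z \<in> borel_measurable P"
    and k [measurable]: "(\<lambda>(x, z). k x z) \<in> borel_measurable (borel \<Otimes>\<^sub>M borel)"
    and p0: "\<And>x. 0 \<le> p x" and k0: "\<And>x z. 0 \<le> k x z" and k1: "\<And>x. (\<integral>\<^sup>+z. ennreal (k x z) \<partial>lborel) = 1"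
    and cond: "\<And>B. B \<in> sets borel \<Longrightarrow>
      AE w in P. real_cond_exp P G (indicator (Z -` B \<inter> space P)) w = measure (density lborel (\<lambda>z. ennreal (k (X w) z))) B"
  shows "distributed P lborel (\<lambda>w. (X w, Z w)) (\<lambda>(x, z). ennreal (p x * k x z))"
proof -
  interpret prob_space P by fact
  interpret finite_measure_subalgebra P G by (rule finite_measure_subalgebraI[OF G])
  have Xm [measurable]: "X \<in> borel_measurable P" using distributed_measurable[OF X(1)] by simp
  have pm [measurable]: "p \<in> borel_measurable borel"
    using distributed_real_measurable[OF _ X(1)] p0 by simp
  note [measurable] = Z
  have kx [measurable]: "k x \<in> borel_measurable borel" for x
    using measurable_Pair_compose_split[OF k, of "\<lambda>_. x" borel "\<lambda>z. z"] by simp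
  have XZ: "(\<lambda>w. (X w, Z w)) \<in> measurable P lborel" by (simp add: borel_prod[symmetric])
  have f: "(\<lambda>(x, z). ennreal (p x * k x z)) \<in> borel_measurable lborel"
    by (simp add: borel_prod[symmetric])
  define \<kappa> where "\<kappa> B x = (\<integral>\<^sup>+z. ennreal (k x z) * indicator B z \<partial>lborel)" for B x
  have \<kappa>_le: "\<kappa> B x \<le> 1" for B x
    unfolding \<kappa>_def by (rule order_trans[OF nn_integral_mono, of _ _ "\<lambda>z. ennreal (k x z)"]) (auto simp: indicator_def k1)
  have \<kappa>_real: "ennreal (enn2real (\<kappa> B x)) = \<kappa> B x" for B x
    using order.strict_trans1[OF \<kappa>_le ennreal_one_less_top] by simp
  have "distr P lborel (\<lambda>w. (X w, Z w)) = density lborel (\<lambda>(x, z). ennreal (p x * k x z))"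
  proof (rule measure_eqI_times)
    have "emeasure (distr P lborel (\<lambda>w. (X w, Z w))) UNIV = emeasure P (space P)"
      by (subst emeasure_distr[OF XZ]) auto
    thus "emeasure (distr P lborel (\<lambda>w. (X w, Z w))) UNIV \<noteq> \<infinity>" by (simp add: emeasure_space_1)
    fix A :: "'b set" and B :: "real set" assume A [measurable]: "A \<in> sets borel" and B [measurable]: "B \<in> sets borel"
    have AB: "A \<times> B \<in> sets (lborel :: ('b \<times> real) measure)" by (simp add: borel_prod[symmetric])
    have \<kappa>m [measurable]: "\<kappa> B \<in> borel_measurable borel"
      unfolding \<kappa>_def[abs_def] by (intro lborel.borel_measurable_nn_integral) simp
    have ms: "measure (density lborel (\<lambda>z. ennreal (k x z))) B = enn2real (\<kappa> B x)" for x
      unfolding measure_def \<kappa>_def by (subst emeasure_density) auto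
    have int: "integrable P (\<lambda>w. indicator A (X w) * indicator (Z -` B \<inter> space P) w :: real)"
      by (intro integrable_const_bound[of _ 1]) (auto simp: indicator_def)
    have "emeasure (distr P lborel (\<lambda>w. (X w, Z w))) (A \<times> B) = (\<integral>\<^sup>+w. ennreal (indicator A (X w) * indicator (Z -` B \<inter> space P) w) \<partial>P)"
    proof -
      define S where "S = (\<lambda>w. (X w, Z w)) -` (A \<times> B) \<inter> space P"
      have "emeasure (distr P lborel (\<lambda>w. (X w, Z w))) (A \<times> B) = emeasure P S"
        unfolding S_def by (rule emeasure_distr[OF XZ AB])
      also have "\<dots> = (\<integral>\<^sup>+w. indicator S w \<partial>P)"
        unfolding S_def by (rule nn_integral_indicator[symmetric, OF measurable_sets[OF XZ AB]])
      also have "\<dots> = (\<integral>\<^sup>+w. ennreal (indicator A (X w) * indicator (Z -` B \<inter> space P) w) \<partial>P)"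
        by (intro nn_integral_cong) (auto simp: S_def indicator_def)
      finally show ?thesis .
    qed
    also have "\<dots> = ennreal (\<integral>w. indicator A (X w) * indicator (Z -` B \<inter> space P) w \<partial>P)"
      by (intro nn_integral_eq_integral int) auto
    also have "(\<integral>w. indicator A (X w) * indicator (Z -` B \<inter> space P) w \<partial>P)
        = (\<integral>w. indicator A (X w) * real_cond_exp P G (indicator (Z -` B \<inter> space P)) w \<partial>P)"
      by (rule real_cond_exp_intg(2)[symmetric, OF int]) (use X(2) in measurable)
    also have "\<dots> = (\<integral>w. indicator A (X w) * enn2real (\<kappa> B (X w)) \<partial>P)"
      using cond[OF B] by (intro integral_cong_AE) (auto simp: ms)
    also have "ennreal \<dots> = (\<integral>\<^sup>+w. ennreal (indicator A (X w) * enn2real (\<kappa> B (X w))) \<partial>P)"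
    proof (rule nn_integral_eq_integral[symmetric])
      show "integrable P (\<lambda>w. indicator A (X w) * enn2real (\<kappa> B (X w)))"
        by (intro integrable_const_bound[of _ 1]) (auto simp: indicator_def intro!: enn2real_leI \<kappa>_le)
    qed auto
    also have "\<dots> = (\<integral>\<^sup>+w. indicator A (X w) * \<kappa> B (X w) \<partial>P)"
    proof (intro nn_integral_cong)
      show "ennreal (indicator A (X w) * enn2real (\<kappa> B (X w))) = indicator A (X w) * \<kappa> B (X w)" for w
        by (cases "X w \<in> A") (simp_all add: \<kappa>_real)
    qed
    also have "\<dots> = (\<integral>\<^sup>+x. ennreal (p x) * (indicator A x * \<kappa> B x) \<partial>lborel)"
      by (rule distributed_nn_integral[OF X(1), symmetric]) simp
    also have "\<dots> = (\<integral>\<^sup>+x. (\<integral>\<^sup>+z. ennreal (p x * k x z) * indicator (A \<times> B) (x, z) \<partial>lborel) \<partial>lborel)"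
    proof (intro nn_integral_cong)
      fix x :: 'b
      have "(\<integral>\<^sup>+z. ennreal (p x * k x z) * indicator (A \<times> B) (x, z) \<partial>lborel)
         = (\<integral>\<^sup>+z. (ennreal (p x) * indicator A x) * (ennreal (k x z) * indicator B z) \<partial>lborel)"
        by (intro nn_integral_cong) (auto simp: indicator_def ennreal_mult' p0 k0)
      also have "\<dots> = (ennreal (p x) * indicator A x) * \<kappa> B x"
        unfolding \<kappa>_def by (rule nn_integral_cmult) simp
      finally show "ennreal (p x) * (indicator A x * \<kappa> B x) = (\<integral>\<^sup>+z. ennreal (p x * k x z) * indicator (A \<times> B) (x, z) \<partial>lborel)"
        by (simp add: mult.assoc)
    qed
    also have "\<dots> = (\<integral>\<^sup>+v. (\<lambda>(x, z). ennreal (p x * k x z)) v * indicator (A \<times> B) v \<partial>(lborel \<Otimes>\<^sub>M lborel))"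
      by (subst lborel.nn_integral_fst[symmetric]) auto
    also have "\<dots> = emeasure (density lborel (\<lambda>(x, z). ennreal (p x * k x z))) (A \<times> B)"
      using AB f by (subst emeasure_density) (auto simp: lborel_prod)
    finally show "emeasure (distr P lborel (\<lambda>w. (X w, Z w))) (A \<times> B)
        = emeasure (density lborel (\<lambda>(x, z). ennreal (p x * k x z))) (A \<times> B)" .
  qed (simp_all)
  thus ?thesis using XZ f by (simp add: distributed_def)
qed

text \<open>
  The converse situation: from a joint density \<open>p x * k x z\<close>, with \<open>k x\<close> a probability density for each \<open>x\<close>, the
  conditional moments of \<open>Z\<close> given \<open>X\<close> are read off as moments of \<open>k x\<close>.
\<close>

locale joint_density = prob_space P for P :: "'w measure" +
  fixes X :: "'w \<Rightarrow> 'b :: euclidean_space" and Z :: "'w \<Rightarrow> real" and p :: "'b \<Rightarrow> real" and k :: "'b \<Rightarrow> real \<Rightarrow> real"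
  assumes XZ: "distributed P lborel (\<lambda>w. (X w, Z w)) (\<lambda>(x, z). ennreal (p x * k x z))"
    and p [measurable]: "p \<in> borel_measurable borel"
    and k [measurable]: "(\<lambda>(x, z). k x z) \<in> borel_measurable (borel \<Otimes>\<^sub>M borel)"
    and p0: "\<And>x. 0 \<le> p x" and k0: "\<And>x z. 0 \<le> k x z" and k1: "\<And>x. (\<integral>\<^sup>+z. ennreal (k x z) \<partial>lborel) = 1"
begin

lemma measurable_X [measurable]: "X \<in> borel_measurable P"
  and measurable_Z [measurable]: "Z \<in> borel_measurable P"
proof -
  have "(\<lambda>w. (X w, Z w)) \<in> borel_measurable P" using distributed_measurable[OF XZ] by simp
  from measurable_compose[OF this, of fst borel] measurable_compose[OF this, of snd borel]
  show "X \<in> borel_measurable P" "Z \<in> borel_measurable P"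
    by (simp_all add: borel_measurable_continuous_onI continuous_on_fst continuous_on_snd)
qed

lemma kx: "integrable lborel (k x)" "(\<integral>z. k x z \<partial>lborel) = 1"
proof -
  have "k x \<in> borel_measurable lborel"
    using measurable_Pair_compose_split[OF k, of "\<lambda>_. x" borel "\<lambda>z. z"] by simp
  thus "integrable lborel (k x)" by (intro integrableI_nonneg) (auto simp: k0 k1)
  thus "(\<integral>z. k x z \<partial>lborel) = 1" using k1[of x] k0
    by (subst (asm) nn_integral_eq_integral) auto
qed

sublocale finite_measure_subalgebra P "sigma_of P X"
  by (rule finite_measure_subalgebraI) (simp_all add: sigma_of_subset measurable_X)

lemma cond_exp:
  assumes h [measurable]: "(\<lambda>(x, z). h x z) \<in> borel_measurable (borel \<Otimes>\<^sub>M borel)"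
    and int: "integrable P (\<lambda>w. h (X w) (Z w) :: real)"
  shows "AE w in P. real_cond_exp P (sigma_of P X) (\<lambda>w. h (X w) (Z w)) w = (\<integral>z. h (X w) z * k (X w) z \<partial>lborel)"
proof -
  define \<mu> where "\<mu> x = (\<integral>z. h x z * k x z \<partial>lborel)" for x
  have \<mu>m [measurable]: "\<mu> \<in> borel_measurable borel"
    unfolding \<mu>_def[abs_def] by (intro lborel.borel_measurable_lebesgue_integral) simp
  have pk0: "0 \<le> (\<lambda>(x, z). p x * k x z) v" for v using p0 k0 by (cases v) simp
  have XZ': "distributed P lborel (\<lambda>w. (X w, Z w)) (\<lambda>v. ennreal ((\<lambda>(x, z). p x * k x z) v))"
    using XZ by (simp add: case_prod_beta')
  have prod: "integrable P (\<lambda>w. g (X w) (Z w))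
        \<longleftrightarrow> integrable (lborel \<Otimes>\<^sub>M lborel) (\<lambda>(x, z). p x * k x z * g x z)"
      "(\<integral>w. g (X w) (Z w) \<partial>P) = (\<integral>(x, z). p x * k x z * g x z \<partial>(lborel \<Otimes>\<^sub>M lborel))"
    if g [measurable]: "(\<lambda>(x, z). g x z) \<in> borel_measurable (borel \<Otimes>\<^sub>M borel)" for g :: "'b \<Rightarrow> real \<Rightarrow> real"
  proof -
    have g': "(\<lambda>(x, z). g x z) \<in> borel_measurable (lborel :: ('b \<times> real) measure)"
      using g by (simp add: borel_prod)
    show "integrable P (\<lambda>w. g (X w) (Z w)) \<longleftrightarrow> integrable (lborel \<Otimes>\<^sub>M lborel) (\<lambda>(x, z). p x * k x z * g x z)"
      using distributed_integrable[OF XZ' g' pk0] by (simp add: lborel_prod case_prod_beta')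
    show "(\<integral>w. g (X w) (Z w) \<partial>P) = (\<integral>(x, z). p x * k x z * g x z \<partial>(lborel \<Otimes>\<^sub>M lborel))"
      using distributed_integral[OF XZ' g' pk0] by (simp add: lborel_prod case_prod_beta')
  qed
  have hpk: "integrable (lborel \<Otimes>\<^sub>M lborel) (\<lambda>(x, z). p x * k x z * h x z)"
    using prod(1)[OF h] int by simp
  have p\<mu>: "(\<integral>z. p x * k x z * h x z \<partial>lborel) = p x * \<mu> x" for x
  proof -
    have "(\<integral>z. p x * k x z * h x z \<partial>lborel) = (\<integral>z. p x * (h x z * k x z) \<partial>lborel)" by (simp add: mult_ac)
    thus ?thesis by (simp add: \<mu>_def)
  qed
  have int_p\<mu>: "integrable lborel (\<lambda>x. p x * \<mu> x)"
    using lborel_pair.integrable_fst'[OF hpk] by (simp add: p\<mu>)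
  have int\<mu>: "integrable P (\<lambda>w. \<mu> (X w))"
  proof -
    have "integrable (lborel \<Otimes>\<^sub>M lborel) (\<lambda>(x, z). p x * k x z * \<mu> x)"
    proof (rule lborel_pair.Fubini_integrable)
      have "(\<integral>z. norm (p x * k x z * \<mu> x) \<partial>lborel) = norm (p x * \<mu> x)" for x
      proof -
        have "(\<integral>z. norm (p x * k x z * \<mu> x) \<partial>lborel) = (\<integral>z. norm (p x * \<mu> x) * k x z \<partial>lborel)"
          using k0 by (intro Bochner_Integration.integral_cong) (auto simp: abs_mult)
        thus ?thesis using kx by simp
      qed
      thus "integrable lborel (\<lambda>x. \<integral>z. norm (case (x, z) of (x, z) \<Rightarrow> p x * k x z * \<mu> x) \<partial>lborel)"
        using int_p\<mu> by simp
      show "AE x in lborel. integrable lborel (\<lambda>z. case (x, z) of (x, z) \<Rightarrow> p x * k x z * \<mu> x)"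
        using kx by (intro AE_I2) simp
    qed simp
    thus ?thesis using prod(1)[of "\<lambda>x z. \<mu> x"] by simp
  qed
  have \<mu>X: "(\<lambda>w. \<mu> (X w)) \<in> borel_measurable (sigma_of P X)"
    by (rule measurable_compose[OF measurable_sigma_of \<mu>m])
  have "AE w in P. real_cond_exp P (sigma_of P X) (\<lambda>w. h (X w) (Z w)) w = \<mu> (X w)"
  proof (rule real_cond_exp_charact[OF _ int int\<mu> \<mu>X])
    fix A assume "A \<in> sets (sigma_of P X)"
    then obtain E where E [measurable]: "E \<in> sets borel" and A: "A = X -` E \<inter> space P"
      unfolding sets_sigma_of by auto
    have setint: "(\<integral>w\<in>A. f w \<partial>P) = (\<integral>w. indicator E (X w) * f w \<partial>P)" for f :: "'w \<Rightarrow> real"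
      unfolding set_lebesgue_integral_def by (intro Bochner_Integration.integral_cong) (auto simp: A indicator_def)
    have swap: "(\<integral>(x, z). p x * k x z * (indicator E x * g x z) \<partial>(lborel \<Otimes>\<^sub>M lborel))
       = (\<integral>x. indicator E x * (\<integral>z. p x * k x z * g x z \<partial>lborel) \<partial>lborel)"
      if gi: "integrable P (\<lambda>w. g (X w) (Z w))" and g [measurable]: "(\<lambda>(x, z). g x z) \<in> borel_measurable (borel \<Otimes>\<^sub>M borel)" for g
    proof -
      have "integrable P (\<lambda>w. indicator E (X w) * g (X w) (Z w))"
        by (rule Bochner_Integration.integrable_bound[OF gi]) (auto simp: indicator_def)
      hence "integrable (lborel \<Otimes>\<^sub>M lborel) (\<lambda>(x, z). p x * k x z * (indicator E x * g x z))"
        by (subst prod(1)[symmetric]) simp_all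
      from lborel_pair.integral_fst'[OF this] have "(\<integral>(x, z). p x * k x z * (indicator E x * g x z) \<partial>(lborel \<Otimes>\<^sub>M lborel))
         = (\<integral>x. (\<integral>z. p x * k x z * (indicator E x * g x z) \<partial>lborel) \<partial>lborel)" by simp
      also have "\<dots> = (\<integral>x. (\<integral>z. indicator E x * (p x * k x z * g x z) \<partial>lborel) \<partial>lborel)"
        by (simp add: mult_ac)
      finally show ?thesis by simp
    qed
    have "(\<integral>w\<in>A. h (X w) (Z w) \<partial>P) = (\<integral>x. indicator E x * (\<integral>z. p x * k x z * h x z \<partial>lborel) \<partial>lborel)"
      unfolding setint by (subst prod(2)[of "\<lambda>x z. indicator E x * h x z"]) (simp_all add: swap[OF int h])
    also have "\<dots> = (\<integral>x. indicator E x * (p x * \<mu> x) \<partial>lborel)" by (simp add: p\<mu>)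
    also have "\<dots> = (\<integral>x. indicator E x * (\<integral>z. p x * k x z * \<mu> x \<partial>lborel) \<partial>lborel)"
    proof -
      have "(\<integral>z. p x * k x z * \<mu> x \<partial>lborel) = (\<integral>z. (p x * \<mu> x) * k x z \<partial>lborel)" for x by (simp only: mult_ac)
      thus ?thesis by (simp add: kx)
    qed
    also have "\<dots> = (\<integral>w\<in>A. \<mu> (X w) \<partial>P)"
      unfolding setint by (subst prod(2)[of "\<lambda>x z. indicator E x * \<mu> x"]) (simp_all add: swap[of "\<lambda>x z. \<mu> x", OF int\<mu>])
    finally show "(\<integral>w\<in>A. h (X w) (Z w) \<partial>P) = (\<integral>w\<in>A. \<mu> (X w) \<partial>P)" .
  qed
  thus ?thesis by (simp only: \<mu>_def)
qed

text \<open>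
  The variance is the conditional expectation of \<open>(Z - \<mu>(X))\<^sup>2\<close>, whose integrability follows from that of \<open>Z\<^sup>2\<close>: for each
  \<open>x\<close> the variance of \<open>k x\<close> is at most its second moment. The constant \<open>c\<close> allows for a deterministic shift of \<open>Z\<close>.
\<close>

lemma cond_mean_var:
  assumes m1: "\<And>x. integrable lborel (\<lambda>z. z * k x z)" and m2: "\<And>x. integrable lborel (\<lambda>z. z\<^sup>2 * k x z)"
    and Z2: "integrable P (\<lambda>w. (Z w)\<^sup>2)"
    and \<mu>: "\<And>x. \<mu> x = (\<integral>z. z * k x z \<partial>lborel)"
  shows "AE w in P. real_cond_exp P (sigma_of P X) (\<lambda>w. Z w + c) w = \<mu> (X w) + c"
    and "AE w in P. real_cond_var P (sigma_of P X) (\<lambda>w. Z w + c) w = (\<integral>z. (z - \<mu> (X w))\<^sup>2 * k (X w) z \<partial>lborel)"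
proof -
  have \<mu>m [measurable]: "\<mu> \<in> borel_measurable borel"
    unfolding \<mu>[abs_def] by (intro lborel.borel_measurable_lebesgue_integral) simp
  have Z1: "integrable P Z"
  proof (rule Bochner_Integration.integrable_bound)
    show "integrable P (\<lambda>w. 1 + (Z w)\<^sup>2)" using Z2 by simp
    show "AE w in P. norm (Z w) \<le> norm (1 + (Z w)\<^sup>2)"
    proof (rule AE_I2)
      fix w
      have "\<bar>Z w\<bar> \<le> 1 + (Z w)\<^sup>2"
        using sum_power2_ge_zero[of "\<bar>Z w\<bar> - 1" 0] by (simp add: power2_eq_square algebra_simps)
      thus "norm (Z w) \<le> norm (1 + (Z w)\<^sup>2)" by simp
    qed
  qed simp
  have mean: "(\<integral>z. (z + c) * k x z \<partial>lborel) = \<mu> x + c" for x c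
    using m1[of x] kx[of x] by (simp add: distrib_right \<mu>)
  have "AE w in P. real_cond_exp P (sigma_of P X) (\<lambda>w. Z w + c) w = (\<integral>z. (z + c) * k (X w) z \<partial>lborel)"
    using Z1 by (intro cond_exp[of "\<lambda>x z. z + c"]) auto
  thus ce: "AE w in P. real_cond_exp P (sigma_of P X) (\<lambda>w. Z w + c) w = \<mu> (X w) + c"
    by (simp only: mean)
  have var_le: "integrable lborel (\<lambda>z. (z - \<mu> x)\<^sup>2 * k x z)"
    "(\<integral>z. (z - \<mu> x)\<^sup>2 * k x z \<partial>lborel) \<le> (\<integral>z. z\<^sup>2 * k x z \<partial>lborel)" for x
  proof -
    have eq: "(\<lambda>z. (z - \<mu> x)\<^sup>2 * k x z) = (\<lambda>z. z\<^sup>2 * k x z - 2 * \<mu> x * (z * k x z) + (\<mu> x)\<^sup>2 * k x z)"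
      by (simp add: fun_eq_iff power2_eq_square algebra_simps)
    show "integrable lborel (\<lambda>z. (z - \<mu> x)\<^sup>2 * k x z)"
      unfolding eq by (intro Bochner_Integration.integrable_add Bochner_Integration.integrable_diff integrable_mult_right m1 m2 kx)
    have "(\<integral>z. (z - \<mu> x)\<^sup>2 * k x z \<partial>lborel) = (\<integral>z. z\<^sup>2 * k x z \<partial>lborel) - 2 * \<mu> x * \<mu> x + (\<mu> x)\<^sup>2"
      unfolding eq using m1[of x] m2[of x] kx[of x] by (simp add: \<mu>[of x, symmetric])
    thus "(\<integral>z. (z - \<mu> x)\<^sup>2 * k x z \<partial>lborel) \<le> (\<integral>z. z\<^sup>2 * k x z \<partial>lborel)"
      using zero_le_square[of "\<mu> x"] by (simp add: power2_eq_square)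
  qed
  have nn: "(\<integral>\<^sup>+w. ennreal (g (X w) (Z w)) \<partial>P) = (\<integral>\<^sup>+x. ennreal (p x) * ennreal (\<integral>z. g x z * k x z \<partial>lborel) \<partial>lborel)"
    if g [measurable]: "(\<lambda>(x, z). g x z) \<in> borel_measurable (borel \<Otimes>\<^sub>M borel)" and g0: "\<And>x z. 0 \<le> g x z"
      and gi: "\<And>x. integrable lborel (\<lambda>z. g x z * k x z)" for g :: "'b \<Rightarrow> real \<Rightarrow> real"
  proof -
    have g': "(\<lambda>v. ennreal (case v of (x, z) \<Rightarrow> g x z)) \<in> borel_measurable (lborel :: ('b \<times> real) measure)"
      using g by (simp add: borel_prod)
    have "(\<integral>\<^sup>+w. ennreal (g (X w) (Z w)) \<partial>P) = (\<integral>\<^sup>+v. (case v of (x, z) \<Rightarrow> ennreal (p x * k x z)) * ennreal (case v of (x, z) \<Rightarrow> g x z) \<partial>lborel)"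
      using distributed_nn_integral[OF XZ g'] by simp
    also have "\<dots> = (\<integral>\<^sup>+x. (\<integral>\<^sup>+z. ennreal (p x * k x z) * ennreal (g x z) \<partial>lborel) \<partial>lborel)"
      unfolding lborel_prod[symmetric] by (subst lborel.nn_integral_fst[symmetric]) (auto simp: case_prod_beta')
    also have "\<dots> = (\<integral>\<^sup>+x. ennreal (p x) * ennreal (\<integral>z. g x z * k x z \<partial>lborel) \<partial>lborel)"
    proof (intro nn_integral_cong)
      fix x :: 'b
      have "(\<integral>\<^sup>+z. ennreal (p x * k x z) * ennreal (g x z) \<partial>lborel) = (\<integral>\<^sup>+z. ennreal (p x) * ennreal (g x z * k x z) \<partial>lborel)"
        by (intro nn_integral_cong) (simp add: ennreal_mult'[symmetric] p0 k0 g0 mult_ac)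
      also have "\<dots> = ennreal (p x) * (\<integral>\<^sup>+z. ennreal (g x z * k x z) \<partial>lborel)"
        using gi[of x] by (intro nn_integral_cmult) (simp add: borel_measurable_integrable)
      finally show "(\<integral>\<^sup>+z. ennreal (p x * k x z) * ennreal (g x z) \<partial>lborel) = ennreal (p x) * ennreal (\<integral>z. g x z * k x z \<partial>lborel)"
        using g0 k0 by (simp add: nn_integral_eq_integral[OF gi])
    qed
    finally show ?thesis .
  qed
  have intv: "integrable P (\<lambda>w. (Z w - \<mu> (X w))\<^sup>2)"
  proof (rule integrableI_nonneg)
    have "(\<integral>\<^sup>+w. ennreal ((Z w - \<mu> (X w))\<^sup>2) \<partial>P) = (\<integral>\<^sup>+x. ennreal (p x) * ennreal (\<integral>z. (z - \<mu> x)\<^sup>2 * k x z \<partial>lborel) \<partial>lborel)"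
      by (rule nn[of "\<lambda>x z. (z - \<mu> x)\<^sup>2"]) (simp_all add: var_le)
    also have "\<dots> \<le> (\<integral>\<^sup>+x. ennreal (p x) * ennreal (\<integral>z. z\<^sup>2 * k x z \<partial>lborel) \<partial>lborel)"
      by (intro nn_integral_mono mult_left_mono ennreal_leI var_le) simp
    also have "\<dots> = (\<integral>\<^sup>+w. ennreal ((Z w)\<^sup>2) \<partial>P)"
      by (rule nn[of "\<lambda>x z. z\<^sup>2", symmetric]) (simp_all add: m2)
    also have "\<dots> < \<infinity>" using Z2 by (simp add: nn_integral_eq_integral)
    finally show "(\<integral>\<^sup>+w. ennreal ((Z w - \<mu> (X w))\<^sup>2) \<partial>P) < \<infinity>" .
  qed auto
  have "AE w in P. real_cond_exp P (sigma_of P X) (\<lambda>w. ((Z w + c) - real_cond_exp P (sigma_of P X) (\<lambda>w. Z w + c) w)\<^sup>2) w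
     = real_cond_exp P (sigma_of P X) (\<lambda>w. (Z w - \<mu> (X w))\<^sup>2) w"
    using ce by (intro real_cond_exp_cong) (auto elim!: eventually_mono)
  moreover have "AE w in P. real_cond_exp P (sigma_of P X) (\<lambda>w. (Z w - \<mu> (X w))\<^sup>2) w
      = (\<integral>z. (z - \<mu> (X w))\<^sup>2 * k (X w) z \<partial>lborel)"
    by (rule cond_exp[of "\<lambda>x z. (z - \<mu> x)\<^sup>2"]) (use intv in auto)
  ultimately show "AE w in P. real_cond_var P (sigma_of P X) (\<lambda>w. Z w + c) w = (\<integral>z. (z - \<mu> (X w))\<^sup>2 * k (X w) z \<partial>lborel)"
    unfolding real_cond_var_def by eventually_elim simp
qed

end

lemma nn_integral_lborel_triple:
  fixes g :: "(real \<times> real) \<times> real \<Rightarrow> ennreal"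
  assumes g: "g \<in> borel_measurable borel"
  shows "(\<integral>\<^sup>+v. g v \<partial>lborel) = (\<integral>\<^sup>+x. (\<integral>\<^sup>+y. (\<integral>\<^sup>+z. g ((x, y), z) \<partial>lborel) \<partial>lborel) \<partial>lborel)"
proof -
  have g' [measurable]: "g \<in> borel_measurable ((lborel \<Otimes>\<^sub>M lborel) \<Otimes>\<^sub>M lborel)"
    using g by (simp add: lborel_prod)
  have "(\<integral>\<^sup>+v. g v \<partial>lborel) = (\<integral>\<^sup>+v. g v \<partial>((lborel \<Otimes>\<^sub>M lborel) \<Otimes>\<^sub>M lborel))"
    by (simp only: lborel_prod)
  also have "\<dots> = (\<integral>\<^sup>+p. (\<integral>\<^sup>+z. g (p, z) \<partial>lborel) \<partial>(lborel \<Otimes>\<^sub>M lborel))"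
    by (rule lborel.nn_integral_fst[symmetric, OF g'])
  also have "\<dots> = (\<integral>\<^sup>+x. (\<integral>\<^sup>+y. (\<integral>\<^sup>+z. g ((x, y), z) \<partial>lborel) \<partial>lborel) \<partial>lborel)"
    by (rule lborel.nn_integral_fst[symmetric]) (rule lborel.borel_measurable_nn_integral, simp)
  finally show ?thesis .
qed

lemma distr_lborel_swap_last:
  "distr lborel lborel (\<lambda>((x, y), z). ((x, z), y)) = (lborel :: ((real \<times> real) \<times> real) measure)"
proof (rule measure_eqI)
  have \<phi>: "(\<lambda>((x, y), z). ((x, z), y)) \<in> measurable (lborel :: ((real \<times> real) \<times> real) measure) (lborel :: ((real \<times> real) \<times> real) measure)"
    by (simp add: borel_prod[symmetric] case_prod_beta')
  fix E assume "E \<in> sets (distr lborel lborel (\<lambda>((x, y), z). ((x, z), y)) :: ((real \<times> real) \<times> real) measure)"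
  hence E: "E \<in> sets (borel :: ((real \<times> real) \<times> real) measure)" by simp
  have iE: "(indicator E :: _ \<Rightarrow> ennreal) \<in> borel_measurable borel" using E by simp
  have iE': "(indicator E :: _ \<Rightarrow> ennreal) \<in> borel_measurable lborel" using E by simp
  have E' [measurable]: "E \<in> sets ((borel \<Otimes>\<^sub>M borel) \<Otimes>\<^sub>M borel)" using E by (simp only: borel_prod)
  have "emeasure (distr lborel lborel (\<lambda>((x, y), z). ((x, z), y))) E
     = (\<integral>\<^sup>+v. indicator E ((\<lambda>((x, y), z). ((x, z), y)) v) \<partial>lborel)"
    using E by (subst nn_integral_distr[OF \<phi>, symmetric]) simp_all
  also have "\<dots> = (\<integral>\<^sup>+x. (\<integral>\<^sup>+y. (\<integral>\<^sup>+z. indicator E ((x, z), y) \<partial>lborel) \<partial>lborel) \<partial>lborel)"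
    by (subst nn_integral_lborel_triple) (use measurable_compose[OF \<phi> iE'] in simp_all)
  also have "\<dots> = (\<integral>\<^sup>+x. (\<integral>\<^sup>+z. (\<integral>\<^sup>+y. indicator E ((x, z), y) \<partial>lborel) \<partial>lborel) \<partial>lborel)"
    by (intro nn_integral_cong lborel_pair.Fubini') simp
  also have "\<dots> = (\<integral>\<^sup>+v. indicator E v \<partial>lborel)"
    by (rule nn_integral_lborel_triple[symmetric, OF iE])
  also have "\<dots> = emeasure lborel E" using E by simp
  finally show "emeasure (distr lborel lborel (\<lambda>((x, y), z). ((x, z), y))) E = emeasure lborel E" .
qed simp

lemma distributed_swap_last:
  fixes X Y Z :: "'w \<Rightarrow> real"
  assumes "distributed P lborel (\<lambda>w. ((X w, Y w), Z w)) (\<lambda>((x, y), z). f x y z)"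
  shows "distributed P lborel (\<lambda>w. ((X w, Z w), Y w)) (\<lambda>((x, z), y). f x y z)"
proof -
  define \<phi> :: "(real \<times> real) \<times> real \<Rightarrow> (real \<times> real) \<times> real" where "\<phi> = (\<lambda>((x, y), z). ((x, z), y))"
  define F where "F = (\<lambda>((x, y), z). f x y z)"
  have \<phi>: "\<phi> \<in> measurable lborel lborel"
    by (simp add: \<phi>_def borel_prod[symmetric] case_prod_beta')
  have F: "F \<in> borel_measurable lborel" and D: "distr P lborel (\<lambda>w. ((X w, Y w), Z w)) = density lborel F"
    and V: "(\<lambda>w. ((X w, Y w), Z w)) \<in> measurable P lborel"
    using assms by (auto simp: distributed_def F_def)
  have F\<phi>: "(\<lambda>v. F (\<phi> v)) \<in> borel_measurable lborel" by (rule measurable_compose[OF \<phi> F])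
  have inv: "F (\<phi> (\<phi> v)) = F v" for v by (simp add: \<phi>_def split: prod.split)
  have "distr P lborel (\<lambda>w. \<phi> ((X w, Y w), Z w)) = distr (density lborel F) lborel \<phi>"
    unfolding D[symmetric] by (subst distr_distr[OF \<phi> V]) (simp add: o_def)
  also have "\<dots> = density (distr lborel lborel \<phi>) (\<lambda>v. F (\<phi> v))"
    using density_distr[OF F\<phi> \<phi>] by (simp add: inv)
  also have "distr lborel lborel \<phi> = lborel" unfolding \<phi>_def by (rule distr_lborel_swap_last)
  finally have "distr P lborel (\<lambda>w. \<phi> ((X w, Y w), Z w)) = density lborel (\<lambda>v. F (\<phi> v))" .
  moreover have "(\<lambda>w. \<phi> ((X w, Y w), Z w)) \<in> measurable P lborel" by (rule measurable_compose[OF V \<phi>])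
  moreover have "(\<lambda>v. F (\<phi> v)) = (\<lambda>((x, z), y). f x y z)" by (auto simp: F_def \<phi>_def)
  moreover have "(\<lambda>w. \<phi> ((X w, Y w), Z w)) = (\<lambda>w. ((X w, Z w), Y w))" by (simp add: \<phi>_def)
  ultimately show ?thesis using F\<phi> by (simp add: distributed_def)
qed

text \<open>
  A Borel function with a Borel left inverse generates the same \<open>\<sigma>\<close>-algebra.
\<close>

lemma sigma_of_transform:
  assumes f: "f \<in> borel_measurable borel" and g: "g \<in> borel_measurable borel" and gf: "\<And>x. g (f x) = x"
  shows "sigma_of P (\<lambda>w. f (X w)) = sigma_of P X"
proof -
  have "{(\<lambda>w. f (X w)) -` B \<inter> space P | B. B \<in> sets borel} = {X -` B \<inter> space P | B. B \<in> sets borel}"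
  proof (intro equalityI subsetI)
    fix A assume "A \<in> {(\<lambda>w. f (X w)) -` B \<inter> space P | B. B \<in> sets borel}"
    then obtain B where B: "B \<in> sets borel" "A = X -` (f -` B) \<inter> space P" by auto
    have "f -` B \<in> sets borel" using measurable_sets[OF f B(1)] by simp
    with B(2) show "A \<in> {X -` B \<inter> space P | B. B \<in> sets borel}" by blast
  next
    fix A assume "A \<in> {X -` B \<inter> space P | B. B \<in> sets borel}"
    then obtain B where B: "B \<in> sets borel" "A = X -` B \<inter> space P" by auto
    have "A = (\<lambda>w. f (X w)) -` (g -` B) \<inter> space P" using B(2) by (auto simp: gf)
    moreover have "g -` B \<in> sets borel" using measurable_sets[OF g B(1)] by simp
    ultimately show "A \<in> {(\<lambda>w. f (X w)) -` B \<inter> space P | B. B \<in> sets borel}" by blast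
  qed
  thus ?thesis by (simp add: vimage_algebra_def)
qed

section \<open>Existence of the process\<close>

context wilson_process_data
begin

lemma sum_pos: "0 < Re (A + B + C + D)" using Re_pos by simp

lemma zero_in_T: "0 \<in> T" using Re_pos by (simp add: T_def)

lemma markov_densities_wilson:
  "markov_densities T {0<..} 1 (\<lambda>t x. ennreal (marg t x)) (\<lambda>s t x y. ennreal (trans s t x y))"
proof
  show "(\<lambda>x. ennreal (marg t x)) \<in> borel_measurable borel" for t by measurable
  show "(\<lambda>(x, y). ennreal (trans s t x y)) \<in> borel_measurable (borel \<Otimes>\<^sub>M borel)" for s t
    by (simp add: case_prod_beta')
  show "ennreal (marg t x) = 0" if "x \<notin> {0<..}" for t x
    using that by (simp add: wilson_marginal_def wilson_density_nonpos)
qed (simp_all add: nn_integral_marg nn_integral_trans marg_trans chapman_kolmogorov)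

lemma ex_wilson_process: "\<exists>(P :: (real \<Rightarrow> real) measure) Y. wilson_process A B C D P Y"
proof -
  interpret M: markov_densities T "{0<..}" 1 "\<lambda>t x. ennreal (marg t x)" "\<lambda>s t x y. ennreal (trans s t x y)"
    by (rule markov_densities_wilson)
  have "distributed M.Q lborel (M.Y t) (\<lambda>x. ennreal (marg t x))" if "t \<in> T" for t
    using M.distr_Y[OF that] M.measurable_Y[OF that] by (simp add: distributed_def)
  moreover have "has_conditional_density M.Q {0<..} (M.Y t) (M.Y s) (trans s t)" if st: "s \<in> T" "t \<in> T" "s < t" for s t
    unfolding has_conditional_density_def
  proof (intro conjI ballI)
    fix x :: real
    show "trans s t x \<in> borel_measurable borel" by measurable
    show "prob_space (density lborel (\<lambda>y. ennreal (trans s t x y)))"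
      by (rule prob_spaceI) (simp add: emeasure_density nn_integral_trans st)
  qed (rule M.cond_exp_Y_sigma_of[OF st])
  ultimately have "wilson_process A B C D M.Q M.Y"
    unfolding wilson_process_def Let_def T_def[symmetric] using M.markov_process_Y by blast
  thus ?thesis by blast
qed

end

section \<open>Moments of the process\<close>

text \<open>
  Conjugation permutes the four factors: they are either all real and positive or fall into two pairs of nonzero
  conjugates.
\<close>

lemma prod_pair_sums_pos:
  assumes adm: "real_or_conj a b" "real_or_conj c d"
    and pos: "0 < Re a" "0 < Re b" "0 < Re c" "0 < Re d"
  shows "\<exists>r>0. (a + c) * (b + c) * (a + d) * (b + d) = complex_of_real r"
proof -
  have nz: "a + c \<noteq> 0" "b + c \<noteq> 0" "a + d \<noteq> 0" "b + d \<noteq> 0" using pos by (auto simp: complex_eq_iff)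
  have sq: "z * cnj z = complex_of_real ((cmod z)\<^sup>2)" for z by (rule complex_norm_square[symmetric])
  consider (rr) "a \<in> \<real>" "b \<in> \<real>" "c \<in> \<real>" "d \<in> \<real>" | (cr) "a = cnj b" "cnj c = c" "cnj d = d"
    | (rc) "cnj a = a" "cnj b = b" "c = cnj d" | (cc) "a = cnj b" "c = cnj d"
    using adm by (auto simp: real_or_conj_def Reals_cnj_iff)
  thus ?thesis
  proof cases
    case rr
    then obtain a' b' c' d' where "a = of_real a'" "b = of_real b'" "c = of_real c'" "d = of_real d'"
      by (auto elim!: Reals_cases)
    with pos show ?thesis
      by (intro exI[of _ "(a' + c') * (b' + c') * (a' + d') * (b' + d')"]) auto
  next
    case cr
    have "(a + c) * (b + c) * (a + d) * (b + d) = ((b + c) * cnj (b + c)) * ((b + d) * cnj (b + d))"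
      using cr by (simp add: mult_ac)
    also have "\<dots> = complex_of_real ((cmod (b + c))\<^sup>2 * (cmod (b + d))\<^sup>2)" by (simp only: sq of_real_mult)
    finally show ?thesis using nz by (intro exI[of _ "(cmod (b + c))\<^sup>2 * (cmod (b + d))\<^sup>2"]) simp
  next
    case rc
    have "(a + c) * (b + c) * (a + d) * (b + d) = ((a + d) * cnj (a + d)) * ((b + d) * cnj (b + d))"
      using rc by (simp add: mult_ac)
    also have "\<dots> = complex_of_real ((cmod (a + d))\<^sup>2 * (cmod (b + d))\<^sup>2)" by (simp only: sq of_real_mult)
    finally show ?thesis using nz by (intro exI[of _ "(cmod (a + d))\<^sup>2 * (cmod (b + d))\<^sup>2"]) simp
  next
    case cc
    have "(a + c) * (b + c) * (a + d) * (b + d) = ((b + d) * cnj (b + d)) * ((b + c) * cnj (b + c))"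
      using cc by (simp add: mult_ac)
    also have "\<dots> = complex_of_real ((cmod (b + d))\<^sup>2 * (cmod (b + c))\<^sup>2)" by (simp only: sq of_real_mult)
    finally show ?thesis using nz by (intro exI[of _ "(cmod (b + d))\<^sup>2 * (cmod (b + c))\<^sup>2"]) simp
  qed
qed

lemma real_or_conj_sum: "real_or_conj a b \<Longrightarrow> a + b = complex_of_real (Re (a + b))"
  by (auto simp: real_or_conj_def complex_eq_iff complex_is_Real_iff)

locale wilson_markov = wilson_process_data +
  fixes P :: "'w measure" and Y :: "real \<Rightarrow> 'w \<Rightarrow> real"
  assumes wilson: "wilson_process A B C D P Y"
begin

definition M2 :: complex where
  "M2 = (A + C) * (B + C) * (A + D) * (B + D) / ((A + B + C + D)\<^sup>2 * (A + B + C + D + 1))"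

lemma markov: "markov_process P T {0<..} Y"
  and distributed_Y: "t \<in> T \<Longrightarrow> distributed P lborel (Y t) (\<lambda>x. ennreal (marg t x))"
  and cond_density: "s \<in> T \<Longrightarrow> t \<in> T \<Longrightarrow> s < t \<Longrightarrow> has_conditional_density P {0<..} (Y t) (Y s) (trans s t)"
  using wilson unfolding wilson_process_def Let_def T_def[symmetric] by auto

sublocale prob_space P
  using markov by (simp add: markov_process_def)

lemma Y_pos: "t \<in> T \<Longrightarrow> w \<in> space P \<Longrightarrow> 0 < Y t w"
  using markov measurable_space[of "Y t" P "restrict_space borel {0<..}" w] by (auto simp: markov_process_def)

lemma measurable_Y: "t \<in> T \<Longrightarrow> Y t \<in> borel_measurable P"
  using distributed_measurable[OF distributed_Y] by simp

lemma sigma_Y: "s \<in> T \<Longrightarrow> sets (sigma_of P (Y s)) \<subseteq> sets P"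
  by (rule sigma_of_subset[OF measurable_Y]) auto

lemma joint_two:
  assumes st: "s \<in> T" "t \<in> T" "s < t"
  shows "distributed P lborel (\<lambda>w. (Y s w, Y t w)) (\<lambda>(x, y). ennreal (marg s x * trans s t x y))"
proof (rule distributed_Pair_of_cond_exp[where G = "sigma_of P (Y s)"])
  show "AE w in P. real_cond_exp P (sigma_of P (Y s)) (indicator (Y t -` E \<inter> space P)) w
      = measure (density lborel (\<lambda>z. ennreal (trans s t (Y s w) z))) E" if "E \<in> sets borel" for E
    using cond_density[OF st] that by (simp add: has_conditional_density_def)
qed (use st in \<open>simp_all add: prob_space_axioms sigma_Y distributed_Y measurable_sigma_of measurable_Y
      marg_nonneg trans_nonneg nn_integral_trans case_prod_beta'\<close>)

text \<open>
  In the order of time the density is a marginal times two transitions. By \<open>trans_bridge\<close> it factors into the joint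
  density at the outer times and the bridge density, and exchanging the last two coordinates preserves Lebesgue measure.
\<close>

lemma joint_three:
  assumes stu: "s \<in> T" "t \<in> T" "u \<in> T" "s < t" "t < u"
  shows "distributed P lborel (\<lambda>w. ((Y s w, Y u w), Y t w))
    (\<lambda>((x, z), y). ennreal ((marg s x * trans s u x z) * bridge s t u x z y))"
proof -
  let ?F = "natural_filtration P T Y t"
  have "distributed P lborel (\<lambda>w. ((Y s w, Y t w), Y u w))
      (\<lambda>(xy, z). ennreal ((case xy of (x, y) \<Rightarrow> marg s x * trans s t x y) * trans t u (snd xy) z))"
  proof (rule distributed_Pair_of_cond_exp[where G = ?F])
    show "space ?F = space P" using stu by (simp add: space_natural_filtration)
    show "sets ?F \<subseteq> sets P" by (rule natural_filtration_subset[OF stu(2) measurable_Y]) auto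
    show "distributed P lborel (\<lambda>w. (Y s w, Y t w)) (\<lambda>x. ennreal (case x of (x, y) \<Rightarrow> marg s x * trans s t x y))"
      using joint_two[OF stu(1,2,4)] by (simp add: case_prod_beta')
    have "Y s \<in> borel_measurable ?F" "Y t \<in> borel_measurable ?F"
      using stu by (auto intro!: measurable_natural_filtration)
    thus "(\<lambda>w. (Y s w, Y t w)) \<in> borel_measurable ?F" by (rule borel_measurable_Pair)
    show "AE w in P. real_cond_exp P ?F (indicator (Y u -` E \<inter> space P)) w
      = measure (density lborel (\<lambda>z. ennreal (trans t u (snd (Y s w, Y t w)) z))) E" if E: "E \<in> sets borel" for E
    proof -
      have "AE w in P. real_cond_exp P ?F (indicator (Y u -` E \<inter> space P)) w
          = real_cond_exp P (sigma_of P (Y t)) (indicator (Y u -` E \<inter> space P)) w"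
        using markov stu E by (auto simp: markov_process_def)
      moreover have "AE w in P. real_cond_exp P (sigma_of P (Y t)) (indicator (Y u -` E \<inter> space P)) w
          = measure (density lborel (\<lambda>z. ennreal (trans t u (Y t w) z))) E"
        using cond_density[OF stu(2,3,5)] E by (simp add: has_conditional_density_def)
      ultimately show ?thesis by eventually_elim simp
    qed
    have "(\<lambda>v :: (real \<times> real) \<times> real. trans t u (snd (fst v)) (snd v)) \<in> borel_measurable ((borel \<Otimes>\<^sub>M borel) \<Otimes>\<^sub>M borel)"
      by measurable
    thus "(\<lambda>(xy :: real \<times> real, z). trans t u (snd xy) z) \<in> borel_measurable (borel \<Otimes>\<^sub>M borel)"
      by (simp only: case_prod_beta' borel_prod)
  qed (use stu in \<open>auto simp: prob_space_axioms measurable_Y marg_nonneg trans_nonneg nn_integral_trans\<close>)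
  also have "(\<lambda>(xy, z). ennreal ((case xy of (x, y) \<Rightarrow> marg s x * trans s t x y) * trans t u (snd xy) z))
     = (\<lambda>((x, y), z). ennreal ((marg s x * trans s u x z) * bridge s t u x z y))"
    using trans_bridge[OF stu(4,5,3)] by (auto simp: fun_eq_iff mult.assoc)
  finally show ?thesis by (rule distributed_swap_last)
qed

lemma marg_moments:
  assumes "t \<in> T"
  shows "integrable P (Y t)" "integrable P (\<lambda>w. (Y t w)\<^sup>2)"
    and "complex_of_real (expectation (Y t)) = (A * B * C + A * B * D + A * C * D + B * C * D) / (A + B + C + D)
       + 2 * ((A * B - C * D) / (A + B + C + D)) * of_real t - (of_real t)\<^sup>2"
    and "complex_of_real (expectation (\<lambda>w. (Y t w - expectation (Y t))\<^sup>2)) = M2 * (C + D + 2 * of_real t) * (A + B - 2 * of_real t)"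
proof -
  interpret W: wilson_parameters "A - of_real t" "B - of_real t" "C + of_real t" "D + of_real t"
    by (rule marg_parameters[OF assms])
  note D = distributed_Y[OF assms]
  have m: "marg t = wilson_density (A - of_real t) (B - of_real t) (C + of_real t) (D + of_real t)"
    by (simp add: wilson_marginal_def fun_eq_iff)
  have m0: "0 \<le> marg t x" for x by (rule marg_nonneg[OF assms])
  show "integrable P (Y t)"
    using distributed_integrable[OF D, of "\<lambda>x. x"] W.integrable_moments(1) m0 by (simp add: m mult.commute)
  show "integrable P (\<lambda>w. (Y t w)\<^sup>2)"
    using distributed_integrable[OF D, of "\<lambda>x. x\<^sup>2"] W.integrable_moments(2) m0 by (simp add: m mult.commute)
  have mean: "expectation (Y t) = W.mean"
    using distributed_integral[OF D, of "\<lambda>x. x"] m0 by (simp add: W.mean_def m mult.commute)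
  define \<sigma> where "\<sigma> = A + B + C + D"
  define \<tau> where "\<tau> = complex_of_real t"
  have \<sigma>: "A - \<tau> + (B - \<tau>) + (C + \<tau>) + (D + \<tau>) = \<sigma>" by (simp add: \<sigma>_def)
  have \<sigma>0: "\<sigma> \<noteq> 0" using sum_pos unfolding \<sigma>_def by (metis less_irrefl zero_complex.sel(1))
  have "(A - \<tau>) * (B - \<tau>) * (C + \<tau>) + (A - \<tau>) * (B - \<tau>) * (D + \<tau>) + (A - \<tau>) * (C + \<tau>) * (D + \<tau>) + (B - \<tau>) * (C + \<tau>) * (D + \<tau>)
     = A * B * C + A * B * D + A * C * D + B * C * D + 2 * (A * B - C * D) * \<tau> - \<tau>\<^sup>2 * \<sigma>"
    unfolding \<sigma>_def power2_eq_square by algebra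
  hence "complex_of_real W.mean = (A * B * C + A * B * D + A * C * D + B * C * D + 2 * (A * B - C * D) * \<tau> - \<tau>\<^sup>2 * \<sigma>) / \<sigma>"
    using W.mean_eq by (simp only: \<tau>_def[symmetric] \<sigma>)
  thus "complex_of_real (expectation (Y t)) = (A * B * C + A * B * D + A * C * D + B * C * D) / (A + B + C + D)
       + 2 * ((A * B - C * D) / (A + B + C + D)) * of_real t - (of_real t)\<^sup>2"
  proof -
    have "(N + 2 * X * \<tau> - \<tau>\<^sup>2 * \<sigma>) / \<sigma> = N / \<sigma> + 2 * (X / \<sigma>) * \<tau> - \<tau>\<^sup>2" for N X
      using \<sigma>0 by (simp add: add_divide_distrib diff_divide_distrib)
    with \<open>complex_of_real W.mean = _\<close> show ?thesis
      unfolding mean \<sigma>_def[symmetric] \<tau>_def[symmetric] by (simp only:)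
  qed
  have "expectation (\<lambda>w. (Y t w - expectation (Y t))\<^sup>2)
     = (\<integral>x. (x - W.mean)\<^sup>2 * wilson_density (A - of_real t) (B - of_real t) (C + of_real t) (D + of_real t) x \<partial>lborel)"
    unfolding mean using distributed_integral[OF D, of "\<lambda>x. (x - W.mean)\<^sup>2"] m0 by (simp add: m mult.commute)
  hence "complex_of_real (expectation (\<lambda>w. (Y t w - expectation (Y t))\<^sup>2)) =
     (A - \<tau> + (B - \<tau>)) * (A - \<tau> + (C + \<tau>)) * (A - \<tau> + (D + \<tau>)) * (B - \<tau> + (C + \<tau>)) * (B - \<tau> + (D + \<tau>)) * (C + \<tau> + (D + \<tau>))
       / (\<sigma>\<^sup>2 * (\<sigma> + 1))"
    using W.variance_eq by (simp only: \<tau>_def[symmetric] \<sigma>)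
  moreover have "A - \<tau> + (B - \<tau>) = A + B - 2 * \<tau>" "A - \<tau> + (C + \<tau>) = A + C" "A - \<tau> + (D + \<tau>) = A + D"
     "B - \<tau> + (C + \<tau>) = B + C" "B - \<tau> + (D + \<tau>) = B + D" "C + \<tau> + (D + \<tau>) = C + D + 2 * \<tau>" by simp_all
  ultimately show "complex_of_real (expectation (\<lambda>w. (Y t w - expectation (Y t))\<^sup>2)) = M2 * (C + D + 2 * of_real t) * (A + B - 2 * of_real t)"
    unfolding M2_def \<sigma>_def[symmetric] \<tau>_def[symmetric] by (simp only: times_divide_eq_left times_divide_eq_right mult_ac)
qed

definition trans_mean :: "real \<Rightarrow> real \<Rightarrow> real \<Rightarrow> real" where
  "trans_mean s t x = (\<integral>y. y * trans s t x y \<partial>lborel)"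

lemma trans_moments:
  assumes "s < t" "t \<in> T"
  shows "integrable lborel (\<lambda>y. y * trans s t x y)" "integrable lborel (\<lambda>y. y\<^sup>2 * trans s t x y)"
    and "0 < x \<Longrightarrow> complex_of_real (trans_mean s t x)
      = ((A - of_real t) * (B - of_real t) * (2 * (of_real t - of_real s))
          + ((of_real t - of_real s)\<^sup>2 + of_real x) * (A + B - 2 * of_real t)) / (A + B - 2 * of_real s)"
    and "0 < x \<Longrightarrow> complex_of_real (\<integral>y. (y - trans_mean s t x)\<^sup>2 * trans s t x y \<partial>lborel)
      = (A + B - 2 * of_real t) * (2 * (of_real t - of_real s)) * ((A - of_real s)\<^sup>2 + of_real x) * ((B - of_real s)\<^sup>2 + of_real x)
        / ((A + B - 2 * of_real s)\<^sup>2 * (A + B - 2 * of_real s + 1))"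
proof -
  define \<iota> where "\<iota> = \<i> * complex_of_real (sqrt x)"
  define \<delta> where "\<delta> = complex_of_real (t - s)"
  define a where "a = A - of_real t"
  define b where "b = B - of_real t"
  interpret W: wilson_parameters a b "\<delta> + \<iota>" "\<delta> - \<iota>"
    unfolding a_def b_def \<delta>_def \<iota>_def by (rule trans_parameters[OF assms])
  have k: "trans s t x = wilson_density a b (\<delta> + \<iota>) (\<delta> - \<iota>)"
    by (simp add: wilson_transition_def fun_eq_iff a_def b_def \<delta>_def \<iota>_def)
  show "integrable lborel (\<lambda>y. y * trans s t x y)" "integrable lborel (\<lambda>y. y\<^sup>2 * trans s t x y)"
    unfolding k by (rule W.integrable_moments)+
  have mean: "trans_mean s t x = W.mean" by (simp add: trans_mean_def W.mean_def k)
  have \<delta>: "\<delta> = of_real t - of_real s" by (simp add: \<delta>_def)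
  have sum: "a + b + (\<delta> + \<iota>) + (\<delta> - \<iota>) = A + B - 2 * of_real s" by (simp add: a_def b_def \<delta>)
  have ab: "a + b = A + B - 2 * of_real t" by (simp add: a_def b_def)
  assume x: "0 < x"
  have \<iota>: "\<iota> * \<iota> = - of_real x"
    using x unfolding \<iota>_def by (simp add: complex_eq_iff)
  have "a * b * (\<delta> + \<iota>) + a * b * (\<delta> - \<iota>) + a * (\<delta> + \<iota>) * (\<delta> - \<iota>) + b * (\<delta> + \<iota>) * (\<delta> - \<iota>)
     = a * b * (2 * \<delta>) + (\<delta>\<^sup>2 - \<iota> * \<iota>) * (a + b)"
    by (simp add: power2_eq_square algebra_simps)
  thus "complex_of_real (trans_mean s t x)
      = ((A - of_real t) * (B - of_real t) * (2 * (of_real t - of_real s))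
          + ((of_real t - of_real s)\<^sup>2 + of_real x) * (A + B - 2 * of_real t)) / (A + B - 2 * of_real s)"
    using W.mean_eq unfolding mean sum ab \<iota> by (simp add: a_def b_def \<delta>)
  have as: "a + \<delta> = A - of_real s" and bs: "b + \<delta> = B - of_real s" by (simp_all add: a_def b_def \<delta>)
  have V: "(a + b) * (a + (\<delta> + \<iota>)) * (a + (\<delta> - \<iota>)) * (b + (\<delta> + \<iota>)) * (b + (\<delta> - \<iota>)) * (\<delta> + \<iota> + (\<delta> - \<iota>))
     = (a + b) * (2 * \<delta>) * ((a + \<delta>)\<^sup>2 - \<iota> * \<iota>) * ((b + \<delta>)\<^sup>2 - \<iota> * \<iota>)"
    unfolding power2_eq_square by algebra
  show "complex_of_real (\<integral>y. (y - trans_mean s t x)\<^sup>2 * trans s t x y \<partial>lborel)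
      = (A + B - 2 * of_real t) * (2 * (of_real t - of_real s)) * ((A - of_real s)\<^sup>2 + of_real x) * ((B - of_real s)\<^sup>2 + of_real x)
        / ((A + B - 2 * of_real s)\<^sup>2 * (A + B - 2 * of_real s + 1))"
    using W.variance_eq[unfolded V sum] unfolding mean k as bs \<iota> ab by (simp add: \<delta>)
qed

lemma cond_trans:
  assumes st: "s \<in> T" "t \<in> T" "s < t"
  shows "AE w in P. real_cond_exp P (sigma_of P (Y s)) (\<lambda>w. Y t w + c) w = trans_mean s t (Y s w) + c"
    and "AE w in P. real_cond_var P (sigma_of P (Y s)) (\<lambda>w. Y t w + c) w
        = (\<integral>y. (y - trans_mean s t (Y s w))\<^sup>2 * trans s t (Y s w) y \<partial>lborel)"
proof -
  interpret J: joint_density P "Y s" "Y t" "marg s" "trans s t"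
    by unfold_locales
      (use st joint_two[OF st] in \<open>simp_all add: marg_nonneg trans_nonneg nn_integral_trans case_prod_beta'\<close>)
  note * = J.cond_mean_var[OF trans_moments(1,2)[OF st(3,2)] marg_moments(2)[OF st(2)], of "trans_mean s t" c]
  show "AE w in P. real_cond_exp P (sigma_of P (Y s)) (\<lambda>w. Y t w + c) w = trans_mean s t (Y s w) + c"
    by (rule *(1)) (simp add: trans_mean_def)
  show "AE w in P. real_cond_var P (sigma_of P (Y s)) (\<lambda>w. Y t w + c) w
        = (\<integral>y. (y - trans_mean s t (Y s w))\<^sup>2 * trans s t (Y s w) y \<partial>lborel)"
    by (rule *(2)) (simp add: trans_mean_def)
qed

definition bridge_mean :: "real \<Rightarrow> real \<Rightarrow> real \<Rightarrow> real \<times> real \<Rightarrow> real" where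
  "bridge_mean s t u v = (\<integral>y. y * bridge s t u (fst v) (snd v) y \<partial>lborel)"

lemma bridge_moments:
  assumes "s < t" "t < u"
  shows "integrable lborel (\<lambda>y. y * bridge s t u x z y)" "integrable lborel (\<lambda>y. y\<^sup>2 * bridge s t u x z y)"
    and "0 < x \<Longrightarrow> 0 < z \<Longrightarrow> bridge_mean s t u (x, z) = (((u - t)\<^sup>2 + z) * (t - s) + ((t - s)\<^sup>2 + x) * (u - t)) / (u - s)"
    and "0 < x \<Longrightarrow> 0 < z \<Longrightarrow> (\<integral>y. (y - bridge_mean s t u (x, z))\<^sup>2 * bridge s t u x z y \<partial>lborel)
      = (u - t) * (t - s) * ((u - s)^4 + 2 * (u - s)\<^sup>2 * (x + z) + (z - x)\<^sup>2) / ((u - s)\<^sup>2 * (2 * (u - s) + 1))"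
proof -
  define \<iota> where "\<iota> = \<i> * complex_of_real (sqrt x)"
  define \<kappa> where "\<kappa> = \<i> * complex_of_real (sqrt z)"
  define \<delta> where "\<delta> = complex_of_real (t - s)"
  define \<epsilon> where "\<epsilon> = complex_of_real (u - t)"
  interpret W: wilson_parameters "\<epsilon> + \<kappa>" "\<epsilon> - \<kappa>" "\<delta> + \<iota>" "\<delta> - \<iota>"
    unfolding \<epsilon>_def \<kappa>_def \<delta>_def \<iota>_def by (rule bridge_parameters[OF assms])
  have k: "bridge s t u x z = wilson_density (\<epsilon> + \<kappa>) (\<epsilon> - \<kappa>) (\<delta> + \<iota>) (\<delta> - \<iota>)"
    by (simp add: bridge_def fun_eq_iff \<epsilon>_def \<kappa>_def \<delta>_def \<iota>_def)
  show "integrable lborel (\<lambda>y. y * bridge s t u x z y)" "integrable lborel (\<lambda>y. y\<^sup>2 * bridge s t u x z y)"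
    unfolding k by (rule W.integrable_moments)+
  have mean: "bridge_mean s t u (x, z) = W.mean" by (simp add: bridge_mean_def W.mean_def k)
  assume x: "0 < x" and z: "0 < z"
  have sq: "\<iota> * \<iota> = - of_real x" "\<kappa> * \<kappa> = - of_real z"
    using x z unfolding \<iota>_def \<kappa>_def by (simp_all add: complex_eq_iff)
  have sum: "\<epsilon> + \<kappa> + (\<epsilon> - \<kappa>) + (\<delta> + \<iota>) + (\<delta> - \<iota>) = of_real (2 * (u - s))" by (simp add: \<epsilon>_def \<delta>_def)
  have "(\<epsilon> + \<kappa>) * (\<epsilon> - \<kappa>) * (\<delta> + \<iota>) + (\<epsilon> + \<kappa>) * (\<epsilon> - \<kappa>) * (\<delta> - \<iota>) + (\<epsilon> + \<kappa>) * (\<delta> + \<iota>) * (\<delta> - \<iota>) + (\<epsilon> - \<kappa>) * (\<delta> + \<iota>) * (\<delta> - \<iota>)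
     = 2 * ((\<epsilon>\<^sup>2 - \<kappa> * \<kappa>) * \<delta> + (\<delta>\<^sup>2 - \<iota> * \<iota>) * \<epsilon>)"
    unfolding power2_eq_square by algebra
  also have "\<dots> = of_real (2 * (((u - t)\<^sup>2 + z) * (t - s) + ((t - s)\<^sup>2 + x) * (u - t)))"
    unfolding sq by (simp add: \<epsilon>_def \<delta>_def)
  finally have "complex_of_real W.mean = of_real (2 * (((u - t)\<^sup>2 + z) * (t - s) + ((t - s)\<^sup>2 + x) * (u - t)) / (2 * (u - s)))"
    using W.mean_eq unfolding sum by (simp only: of_real_divide)
  hence "W.mean = 2 * (((u - t)\<^sup>2 + z) * (t - s) + ((t - s)\<^sup>2 + x) * (u - t)) / (2 * (u - s))"
    by (simp only: of_real_eq_iff)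
  thus "bridge_mean s t u (x, z) = (((u - t)\<^sup>2 + z) * (t - s) + ((t - s)\<^sup>2 + x) * (u - t)) / (u - s)"
    unfolding mean by (metis nonzero_mult_divide_mult_cancel_left zero_neq_numeral)
  have us: "\<epsilon> + \<delta> = of_real (u - s)" by (simp add: \<epsilon>_def \<delta>_def)
  have "(\<epsilon> + \<kappa> + (\<epsilon> - \<kappa>)) * (\<epsilon> + \<kappa> + (\<delta> + \<iota>)) * (\<epsilon> + \<kappa> + (\<delta> - \<iota>)) * (\<epsilon> - \<kappa> + (\<delta> + \<iota>)) * (\<epsilon> - \<kappa> + (\<delta> - \<iota>)) * (\<delta> + \<iota> + (\<delta> - \<iota>))
     = 4 * \<epsilon> * \<delta> * ((\<epsilon> + \<delta>)^4 - 2 * (\<epsilon> + \<delta>)\<^sup>2 * (\<iota> * \<iota> + \<kappa> * \<kappa>) + (\<kappa> * \<kappa> - \<iota> * \<iota>)\<^sup>2)"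
    unfolding power2_eq_square power4_eq_xxxx by algebra
  also have "\<dots> = of_real (4 * (u - t) * (t - s) * ((u - s)^4 + 2 * (u - s)\<^sup>2 * (x + z) + (z - x)\<^sup>2))"
    unfolding sq us by (simp add: \<epsilon>_def \<delta>_def power2_commute[of _ "of_real z"] algebra_simps)
  finally have "complex_of_real (\<integral>y. (y - bridge_mean s t u (x, z))\<^sup>2 * bridge s t u x z y \<partial>lborel)
     = of_real (4 * (u - t) * (t - s) * ((u - s)^4 + 2 * (u - s)\<^sup>2 * (x + z) + (z - x)\<^sup>2) / ((2 * (u - s))\<^sup>2 * (2 * (u - s) + 1)))"
    using W.variance_eq unfolding mean k sum by (simp only: of_real_divide of_real_mult of_real_add of_real_power of_real_1)
  hence var: "(\<integral>y. (y - bridge_mean s t u (x, z))\<^sup>2 * bridge s t u x z y \<partial>lborel)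
     = 4 * (u - t) * (t - s) * ((u - s)^4 + 2 * (u - s)\<^sup>2 * (x + z) + (z - x)\<^sup>2) / ((2 * (u - s))\<^sup>2 * (2 * (u - s) + 1))"
    by (simp only: of_real_eq_iff)
  show "(\<integral>y. (y - bridge_mean s t u (x, z))\<^sup>2 * bridge s t u x z y \<partial>lborel)
      = (u - t) * (t - s) * ((u - s)^4 + 2 * (u - s)\<^sup>2 * (x + z) + (z - x)\<^sup>2) / ((u - s)\<^sup>2 * (2 * (u - s) + 1))"
  proof -
    have "4 * a * b * e / ((2 * w)\<^sup>2 * q) = a * b * e / (w\<^sup>2 * q)" for a b e w q :: real
      by (simp add: power_mult_distrib)
    with var show ?thesis by (simp only:)
  qed
qed

lemma cond_bridge:
  assumes stu: "s \<in> T" "t \<in> T" "u \<in> T" "s < t" "t < u"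
  shows "AE w in P. real_cond_exp P (sigma_of P (\<lambda>w. (Y s w, Y u w))) (\<lambda>w. Y t w + c) w = bridge_mean s t u (Y s w, Y u w) + c"
    and "AE w in P. real_cond_var P (sigma_of P (\<lambda>w. (Y s w, Y u w))) (\<lambda>w. Y t w + c) w
        = (\<integral>y. (y - bridge_mean s t u (Y s w, Y u w))\<^sup>2 * bridge s t u (Y s w) (Y u w) y \<partial>lborel)"
proof -
  define p where "p v = marg s (fst v) * trans s u (fst v) (snd v)" for v :: "real \<times> real"
  define k where "k v y = bridge s t u (fst v) (snd v) y" for v :: "real \<times> real" and y
  have D: "distributed P lborel (\<lambda>w. ((Y s w, Y u w), Y t w)) (\<lambda>(v, y). ennreal (p v * k v y))"
    using joint_three[OF stu] by (simp add: p_def k_def case_prod_beta')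
  have "(\<lambda>v. marg s (fst v) * trans s u (fst v) (snd v)) \<in> borel_measurable (borel \<Otimes>\<^sub>M borel)" by measurable
  hence p: "p \<in> borel_measurable borel" by (simp add: p_def[abs_def] borel_prod)
  have "(\<lambda>v. bridge s t u (fst (fst v)) (snd (fst v)) (snd v)) \<in> borel_measurable ((borel \<Otimes>\<^sub>M borel) \<Otimes>\<^sub>M borel)"
    by measurable
  hence k: "(\<lambda>(x, z). k x z) \<in> borel_measurable (borel \<Otimes>\<^sub>M borel)"
    by (simp add: k_def[abs_def] case_prod_beta' borel_prod)
  have su: "s < u" using stu by simp
  have p0: "0 \<le> p v" for v using stu su by (simp add: p_def marg_nonneg trans_nonneg)
  have k0: "0 \<le> k v y" for v y using stu by (simp add: k_def bridge_nonneg)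
  have k1: "(\<integral>\<^sup>+y. ennreal (k v y) \<partial>lborel) = 1" for v using stu by (simp add: k_def nn_integral_bridge)
  have m: "integrable lborel (\<lambda>y. y * k v y)" "integrable lborel (\<lambda>y. y\<^sup>2 * k v y)" for v
    unfolding k_def using bridge_moments(1,2)[OF stu(4,5)] by auto
  have \<mu>: "bridge_mean s t u v = (\<integral>y. y * k v y \<partial>lborel)" for v by (simp add: bridge_mean_def k_def)
  interpret J: joint_density P "\<lambda>w. (Y s w, Y u w)" "Y t" p k
    by unfold_locales (rule D p k p0 k0 k1)+
  note * = J.cond_mean_var[OF m marg_moments(2)[OF stu(2)] \<mu>, of c]
  show "AE w in P. real_cond_exp P (sigma_of P (\<lambda>w. (Y s w, Y u w))) (\<lambda>w. Y t w + c) w = bridge_mean s t u (Y s w, Y u w) + c"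
    by (rule *(1))
  show "AE w in P. real_cond_var P (sigma_of P (\<lambda>w. (Y s w, Y u w))) (\<lambda>w. Y t w + c) w
        = (\<integral>y. (y - bridge_mean s t u (Y s w, Y u w))\<^sup>2 * bridge s t u (Y s w) (Y u w) y \<partial>lborel)"
    using *(2) by (simp add: k_def)
qed

text \<open>
  Condition on \<open>Y s\<close>. The conditional mean of \<open>Y t\<close> is affine in \<open>Y s\<close> with slope
  \<open>(A + B - 2 t) / (A + B - 2 s)\<close>, so the covariance is this slope times the variance of \<open>Y s\<close>.
\<close>

lemma covariance_Y:
  assumes st: "s \<in> T" "t \<in> T" "s \<le> t"
  shows "complex_of_real (covariance P (Y s) (Y t)) = M2 * (C + D + 2 * of_real s) * (A + B - 2 * of_real t)"
proof (cases "s = t")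
  case True
  thus ?thesis using marg_moments(4)[OF st(2)] by (simp add: covariance_def power2_eq_square)
next
  case False
  hence lt: "s < t" using st by simp
  define X where "X w = Y s w - expectation (Y s)" for w
  define c where "c = - expectation (Y t)"
  define \<mu> where "\<mu> w = trans_mean s t (Y s w) + c" for w
  have int: "integrable P (Y s)" "integrable P (\<lambda>w. (Y s w)\<^sup>2)" "integrable P (Y t)" "integrable P (\<lambda>w. (Y t w)\<^sup>2)"
    using marg_moments(1,2) st by auto
  have [measurable]: "Y s \<in> borel_measurable P" "Y t \<in> borel_measurable P" using measurable_Y st by auto
  interpret F: finite_measure_subalgebra P "sigma_of P (Y s)"
    by (rule finite_measure_subalgebraI) (simp_all add: sigma_Y st)
  have XF: "X \<in> borel_measurable (sigma_of P (Y s))"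
    unfolding X_def by (intro borel_measurable_diff measurable_sigma_of) simp
  have intX: "integrable P X" unfolding X_def using int by simp
  have X2: "integrable P (\<lambda>w. (X w)\<^sup>2)"
    using int by (simp add: X_def power2_diff)
  have Z2: "integrable P (\<lambda>w. (Y t w + c)\<^sup>2)"
    using int by (simp add: power2_sum)
  have XZ: "integrable P (\<lambda>w. X w * (Y t w + c))"
  proof (rule Bochner_Integration.integrable_bound)
    show "integrable P (\<lambda>w. (X w)\<^sup>2 + (Y t w + c)\<^sup>2)" using X2 Z2 by simp
    show "AE w in P. norm (X w * (Y t w + c)) \<le> norm ((X w)\<^sup>2 + (Y t w + c)\<^sup>2)"
    proof (rule AE_I2)
      fix w
      have "2 * \<bar>X w * (Y t w + c)\<bar> \<le> (X w)\<^sup>2 + (Y t w + c)\<^sup>2"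
        using sum_squares_bound[of "\<bar>X w\<bar>" "\<bar>Y t w + c\<bar>"] by (simp add: abs_mult)
      thus "norm (X w * (Y t w + c)) \<le> norm ((X w)\<^sup>2 + (Y t w + c)\<^sup>2)" by simp
    qed
  qed (simp add: X_def)
  \<comment> \<open>The conditional mean of the centred \<open>Y t\<close> is \<open>\<rho> X + \<alpha>\<close>, and \<open>\<alpha>\<close> meets the mean of \<open>X\<close>, which is \<open>0\<close>.\<close>
  define \<rho> where "\<rho> = (A + B - 2 * of_real t) / (A + B - 2 * of_real s)"
  define \<alpha> where "\<alpha> = ((A - of_real t) * (B - of_real t) * (2 * (of_real t - of_real s))
          + (of_real t - of_real s)\<^sup>2 * (A + B - 2 * of_real t)) / (A + B - 2 * of_real s)
          + \<rho> * of_real (expectation (Y s)) + of_real c"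
  have "covariance P (Y s) (Y t) = (\<integral>w. X w * (Y t w + c) \<partial>P)"
    by (simp add: covariance_def X_def c_def)
  also have "\<dots> = (\<integral>w. X w * real_cond_exp P (sigma_of P (Y s)) (\<lambda>w. Y t w + c) w \<partial>P)"
    by (rule F.real_cond_exp_intg(2)[symmetric, OF XZ XF]) simp
  also have "complex_of_real \<dots> = (\<integral>w. complex_of_real (X w * real_cond_exp P (sigma_of P (Y s)) (\<lambda>w. Y t w + c) w) \<partial>P)"
    by (rule integral_complex_of_real[symmetric])
  also have "(\<integral>w. complex_of_real (X w * real_cond_exp P (sigma_of P (Y s)) (\<lambda>w. Y t w + c) w) \<partial>P)
     = (\<integral>w. \<rho> * of_real ((X w)\<^sup>2) + \<alpha> * of_real (X w) \<partial>P)"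
  proof (rule integral_cong_AE)
    show "AE w in P. complex_of_real (X w * real_cond_exp P (sigma_of P (Y s)) (\<lambda>w. Y t w + c) w)
        = \<rho> * of_real ((X w)\<^sup>2) + \<alpha> * of_real (X w)"
      using cond_trans(1)[OF st(1,2) lt, of c] AE_space
    proof eventually_elim
      case (elim w)
      have "complex_of_real (trans_mean s t (Y s w)) = ((A - of_real t) * (B - of_real t) * (2 * (of_real t - of_real s))
          + (of_real t - of_real s)\<^sup>2 * (A + B - 2 * of_real t)) / (A + B - 2 * of_real s) + \<rho> * of_real (Y s w)"
        unfolding trans_moments(3)[OF lt st(2) Y_pos[OF st(1) elim(2)]] \<rho>_def
        by (simp add: add_divide_distrib[symmetric] algebra_simps)
      hence "complex_of_real (trans_mean s t (Y s w) + c) = \<rho> * of_real (X w) + \<alpha>"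
        by (simp add: \<alpha>_def X_def algebra_simps)
      thus ?case unfolding elim(1) of_real_mult by (simp add: power2_eq_square algebra_simps)
    qed
  qed (simp_all add: X_def)
  also have "\<dots> = \<rho> * of_real (\<integral>w. (X w)\<^sup>2 \<partial>P) + \<alpha> * of_real (\<integral>w. X w \<partial>P)"
  proof -
    have 1: "integrable P (\<lambda>w. \<rho> * complex_of_real ((X w)\<^sup>2))"
      using X2 by (intro integrable_mult_right) (simp only: complex_of_real_integrable_eq)
    have 2: "integrable P (\<lambda>w. \<alpha> * complex_of_real (X w))"
      using intX by (intro integrable_mult_right) (simp only: complex_of_real_integrable_eq)
    show ?thesis
      by (simp only: Bochner_Integration.integral_add[OF 1 2] integral_mult_right_zero integral_complex_of_real)
  qed
  also have "(\<integral>w. X w \<partial>P) = 0" using int by (simp add: X_def prob_space)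
  also have "complex_of_real (\<integral>w. (X w)\<^sup>2 \<partial>P) = M2 * (C + D + 2 * of_real s) * (A + B - 2 * of_real s)"
    unfolding X_def by (rule marg_moments(4)[OF st(1)])
  finally have "complex_of_real (covariance P (Y s) (Y t)) = \<rho> * (M2 * (C + D + 2 * of_real s) * (A + B - 2 * of_real s))"
    by simp
  moreover have "A + B - 2 * of_real s \<noteq> 0"
  proof -
    have "0 < Re (A + B - 2 * of_real s)" using st Re_le by (simp add: T_def)
    thus ?thesis by (metis less_irrefl zero_complex.sel(1))
  qed
  ultimately show ?thesis by (simp add: \<rho>_def mult_ac)
qed

lemma M2_real_pos: "M2 \<in> \<real>" "0 < Re M2"
proof -
  obtain r where r: "0 < r" "(A + C) * (B + C) * (A + D) * (B + D) = complex_of_real r"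
    using prod_pair_sums_pos[OF AB CD Re_pos] by blast
  define q where "q = Re (A + B) + Re (C + D)"
  have q: "0 < q" using Re_pos by (simp add: q_def)
  have "A + B + C + D = complex_of_real q"
    using real_or_conj_sum[OF AB] real_or_conj_sum[OF CD] by (simp add: q_def add.assoc)
  hence "M2 = complex_of_real (r / (q\<^sup>2 * (q + 1)))"
    by (simp add: M2_def r)
  thus "M2 \<in> \<real>" "0 < Re M2" using r q by simp_all
qed

end

section \<open>The process with linear mean\<close>

context wilson_markov
begin

abbreviation Z :: "real \<Rightarrow> 'w \<Rightarrow> real" where
  "Z t w \<equiv> Y (t / 2) w + t\<^sup>2 / 4"

lemma sigma_of_Z: "sigma_of P (Z s) = sigma_of P (Y (s / 2))"
  by (rule sigma_of_transform[where f = "\<lambda>x. x + s\<^sup>2 / 4" and g = "\<lambda>x. x - s\<^sup>2 / 4"]) simp_all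

lemma sigma_of_Z_pair: "sigma_of P (\<lambda>w. (Z s w, Z u w)) = sigma_of P (\<lambda>w. (Y (s / 2) w, Y (u / 2) w))"
proof -
  have m: "(\<lambda>v :: real \<times> real. (fst v + c, snd v + d)) \<in> borel_measurable borel" for c d
    by (intro borel_measurable_continuous_onI continuous_intros)
  show ?thesis
    using sigma_of_transform[where X = "\<lambda>w. (Y (s / 2) w, Y (u / 2) w)" and P = P,
        OF m[of "s\<^sup>2 / 4" "u\<^sup>2 / 4"] m[of "- (s\<^sup>2 / 4)" "- (u\<^sup>2 / 4)"]] by simp
qed

lemma expectation_Z: "t / 2 \<in> T \<Longrightarrow> expectation (Z t) = expectation (Y (t / 2)) + t\<^sup>2 / 4"
  using marg_moments(1)[of "t / 2"] by (simp add: prob_space)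

lemma mean_Z:
  assumes "t / 2 \<in> T"
  shows "complex_of_real (expectation (Z t)) = of_real (expectation (Y 0)) + (A * B - C * D) / (A + B + C + D) * of_real t"
proof -
  define K where "K = (A * B - C * D) / (A + B + C + D)"
  show ?thesis
    using marg_moments(3)[OF assms] marg_moments(3)[OF zero_in_T]
    unfolding expectation_Z[OF assms] K_def[symmetric] by (simp add: power2_eq_square)
qed

lemma covariance_Z:
  assumes "s / 2 \<in> T" "t / 2 \<in> T" "s \<le> t"
  shows "complex_of_real (covariance P (Z s) (Z t)) = M2 * (C + D + of_real s) * (A + B - of_real t)"
proof -
  have "covariance P (Z s) (Z t) = covariance P (Y (s / 2)) (Y (t / 2))"
    unfolding covariance_def expectation_Z[OF assms(1)] expectation_Z[OF assms(2)] by simp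
  thus ?thesis using covariance_Y[OF assms(1,2)] assms(3) by simp
qed

lemma cond_Z_refl:
  assumes "s / 2 \<in> T"
  shows "AE w in P. real_cond_exp P (sigma_of P (Z s)) (Z s) w = Z s w"
    and "AE w in P. real_cond_var P (sigma_of P (Z s)) (Z s) w = 0"
proof -
  interpret F: finite_measure_subalgebra P "sigma_of P (Z s)"
    by (rule finite_measure_subalgebraI) (simp_all add: sigma_of_Z sigma_Y assms)
  have ZP [measurable]: "Z s \<in> borel_measurable P" using measurable_Y[OF assms] by simp
  show ce: "AE w in P. real_cond_exp P (sigma_of P (Z s)) (Z s) w = Z s w"
    using marg_moments(1)[OF assms] by (intro F.real_cond_exp_F_meas measurable_sigma_of) simp
  have "AE w in P. real_cond_exp P (sigma_of P (Z s)) (\<lambda>w. (Z s w - real_cond_exp P (sigma_of P (Z s)) (Z s) w)\<^sup>2) w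
     = real_cond_exp P (sigma_of P (Z s)) (\<lambda>w. 0) w"
    using ce by (intro F.real_cond_exp_cong) (auto elim!: eventually_mono)
  moreover have "AE w in P. real_cond_exp P (sigma_of P (Z s)) (\<lambda>w. 0) w = 0"
    by (rule F.real_cond_exp_F_meas) simp_all
  ultimately show "AE w in P. real_cond_var P (sigma_of P (Z s)) (Z s) w = 0"
    unfolding real_cond_var_def by eventually_elim simp
qed

lemma sum_minus_nonzero:
  assumes "s / 2 \<in> T"
  shows "A + B - of_real s \<noteq> 0"
proof -
  have "0 < Re (A + B - of_real s)" using assms Re_le by (simp add: T_def)
  thus ?thesis by (metis less_irrefl zero_complex.sel(1))
qed

lemma cond_exp_Z:
  assumes "s / 2 \<in> T" "t / 2 \<in> T" "s \<le> t"
  shows "AE w in P. complex_of_real (real_cond_exp P (sigma_of P (Z s)) (Z t) w)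
      = (A + B - of_real t) / (A + B - of_real s) * of_real (Z s w) + A * B * of_real (t - s) / (A + B - of_real s)"
proof (cases "s = t")
  case True
  show ?thesis
    using cond_Z_refl(1)[OF assms(1)] sum_minus_nonzero[OF assms(1)] unfolding True by (auto elim!: eventually_mono)
next
  case False
  hence lt: "s / 2 < t / 2" using assms by simp
  show ?thesis
    using cond_trans(1)[OF assms(1,2) lt, of "t\<^sup>2 / 4"] AE_space unfolding sigma_of_Z
  proof eventually_elim
    case (elim w)
    define x where "x = complex_of_real (Y (s / 2) w)"
    define p where "p = complex_of_real s / 2"
    define q where "q = complex_of_real t / 2"
    define \<sigma> where "\<sigma> = A + B - of_real s"
    have \<sigma>: "\<sigma> \<noteq> 0" "A + B - 2 * p = \<sigma>"
      using sum_minus_nonzero[OF assms(1)] by (simp_all add: \<sigma>_def p_def)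
    have orig: "2 * q = of_real t" "2 * p = of_real s" "x + p\<^sup>2 = of_real (Z s w)"
      by (simp_all add: p_def q_def x_def power2_eq_square)
    have "complex_of_real (trans_mean (s / 2) (t / 2) (Y (s / 2) w))
       = ((A - q) * (B - q) * (2 * (q - p)) + ((q - p)\<^sup>2 + x) * (A + B - 2 * q)) / \<sigma>"
      using trans_moments(3)[OF lt assms(2) Y_pos[OF assms(1) elim(2)]]
      unfolding \<sigma>(2)[symmetric] by (simp add: p_def q_def x_def)
    hence "complex_of_real (trans_mean (s / 2) (t / 2) (Y (s / 2) w) + t\<^sup>2 / 4)
       = ((A - q) * (B - q) * (2 * (q - p)) + ((q - p)\<^sup>2 + x) * (A + B - 2 * q)) / \<sigma> + q\<^sup>2"
      by (simp add: q_def power2_eq_square)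
    also have "\<dots> = ((A - q) * (B - q) * (2 * (q - p)) + ((q - p)\<^sup>2 + x) * (A + B - 2 * q) + q\<^sup>2 * \<sigma>) / \<sigma>"
      by (rule divide_add_eq_iff[OF \<sigma>(1)])
    also have "(A - q) * (B - q) * (2 * (q - p)) + ((q - p)\<^sup>2 + x) * (A + B - 2 * q) + q\<^sup>2 * \<sigma>
       = (A + B - 2 * q) * (x + p\<^sup>2) + A * B * (2 * q - 2 * p)"
      unfolding \<sigma>(2)[symmetric] power2_eq_square by algebra
    also have "\<dots> / \<sigma> = (A + B - 2 * q) / \<sigma> * (x + p\<^sup>2) + A * B * (2 * q - 2 * p) / \<sigma>"
      by (simp only: add_divide_distrib times_divide_eq_left)
    finally show ?case unfolding elim(1) \<sigma>_def orig by (simp only: of_real_diff)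
  qed
qed

lemma cond_var_Z:
  assumes "s / 2 \<in> T" "t / 2 \<in> T" "s \<le> t"
  shows "AE w in P. complex_of_real (real_cond_var P (sigma_of P (Z s)) (Z t) w)
      = (A + B - of_real t) * of_real (t - s) * (A\<^sup>2 - of_real s * A + of_real (Z s w)) * (B\<^sup>2 - of_real s * B + of_real (Z s w))
          / ((A + B - of_real s)\<^sup>2 * (A + B - of_real s + 1))"
proof (cases "s = t")
  case True
  show ?thesis
    using cond_Z_refl(2)[OF assms(1)] unfolding True by (auto elim!: eventually_mono)
next
  case False
  hence lt: "s / 2 < t / 2" using assms by simp
  show ?thesis
    using cond_trans(2)[OF assms(1,2) lt, of "t\<^sup>2 / 4"] AE_space unfolding sigma_of_Z
  proof eventually_elim
    case (elim w)
    have sq: "(a - of_real (s / 2))\<^sup>2 + of_real (Y (s / 2) w) = a\<^sup>2 - of_real s * a + of_real (Z s w)" for a :: complex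
      by (simp add: power2_eq_square algebra_simps)
    have half: "A + B - 2 * of_real (r / 2) = A + B - of_real r" for r by simp
    have diff: "2 * (of_real (t / 2) - of_real (s / 2)) = complex_of_real (t - s)" by simp
    show ?case
      unfolding elim(1) using trans_moments(4)[OF lt assms(2) Y_pos[OF assms(1) elim(2)]]
      unfolding sq half diff .
  qed
qed

lemma cond_exp_Z_bridge:
  assumes "s / 2 \<in> T" "t / 2 \<in> T" "u / 2 \<in> T" "s < t" "t < u"
  shows "AE w in P. real_cond_exp P (sigma_of P (\<lambda>w. (Z s w, Z u w))) (Z t) w
    = ((u - t) * Z s w + (t - s) * Z u w) / (u - s)"
proof -
  have lt: "s / 2 < t / 2" "t / 2 < u / 2" using assms by auto
  show ?thesis
    using cond_bridge(1)[OF assms(1-3) lt, of "t\<^sup>2 / 4"] AE_space unfolding sigma_of_Z_pair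
  proof eventually_elim
    case (elim w)
    define x where "x = Y (s / 2) w"
    define z where "z = Y (u / 2) w"
    define p where "p = s / 2"
    define q where "q = t / 2"
    define r where "r = u / 2"
    have h: "r - p \<noteq> 0" using assms by (simp add: p_def r_def)
    have stu: "s = 2 * p" "t = 2 * q" "u = 2 * r" by (simp_all add: p_def q_def r_def)
    have "bridge_mean (s / 2) (t / 2) (u / 2) (x, z) + t\<^sup>2 / 4
       = (((r - q)\<^sup>2 + z) * (q - p) + ((q - p)\<^sup>2 + x) * (r - q)) / (r - p) + q\<^sup>2"
      using bridge_moments(3)[OF lt Y_pos[OF assms(1) elim(2)] Y_pos[OF assms(3) elim(2)]]
      by (simp add: stu x_def z_def power2_eq_square)
    also have "\<dots> = (((r - q)\<^sup>2 + z) * (q - p) + ((q - p)\<^sup>2 + x) * (r - q) + q\<^sup>2 * (r - p)) / (r - p)"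
      by (rule divide_add_eq_iff[OF h])
    also have "((r - q)\<^sup>2 + z) * (q - p) + ((q - p)\<^sup>2 + x) * (r - q) + q\<^sup>2 * (r - p)
      = (r - q) * (x + p\<^sup>2) + (q - p) * (z + r\<^sup>2)"
      unfolding power2_eq_square by algebra
    also have "\<dots> / (r - p) = (2 * ((r - q) * (x + p\<^sup>2) + (q - p) * (z + r\<^sup>2))) / (2 * (r - p))"
      by (rule nonzero_mult_divide_mult_cancel_left[symmetric]) simp
    also have "2 * ((r - q) * (x + p\<^sup>2) + (q - p) * (z + r\<^sup>2)) = (u - t) * Z s w + (t - s) * Z u w"
      by (simp add: stu x_def z_def power2_eq_square algebra_simps)
    also have "2 * (r - p) = u - s" by (simp add: stu)
    finally show ?case unfolding elim(1) x_def z_def .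
  qed
qed

lemma cond_var_Z_bridge:
  assumes "s / 2 \<in> T" "t / 2 \<in> T" "u / 2 \<in> T" "s < t" "t < u"
  shows "AE w in P. real_cond_var P (sigma_of P (\<lambda>w. (Z s w, Z u w))) (Z t) w
    = (u - t) * (t - s) / (u - s + 1) * ((Z u w - Z s w)\<^sup>2 / (u - s)\<^sup>2 + (u * Z s w - s * Z u w) / (u - s))"
proof -
  have lt: "s / 2 < t / 2" "t / 2 < u / 2" using assms by auto
  show ?thesis
    using cond_bridge(2)[OF assms(1-3) lt, of "t\<^sup>2 / 4"] AE_space unfolding sigma_of_Z_pair
  proof eventually_elim
    case (elim w)
    define x where "x = Y (s / 2) w"
    define z where "z = Y (u / 2) w"
    define p where "p = s / 2"
    define q where "q = t / 2"
    define r where "r = u / 2"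
    define h where "h = r - p"
    have h: "h \<noteq> 0" "2 * h + 1 \<noteq> 0" using assms by (simp_all add: h_def p_def r_def)
    have stu: "s = 2 * p" "t = 2 * q" "u = 2 * r" by (simp_all add: p_def q_def r_def)
    \<comment> \<open>The identity behind the formula: \<open>x + p\<^sup>2\<close> and \<open>z + r\<^sup>2\<close> are the values of \<open>Z\<close> at the times \<open>s\<close> and \<open>u\<close>.\<close>
    have h4: "h^4 + 2 * h\<^sup>2 * (x + z) + (z - x)\<^sup>2 = ((z + r\<^sup>2) - (x + p\<^sup>2))\<^sup>2 + 4 * h * (r * (x + p\<^sup>2) - p * (z + r\<^sup>2))"
      unfolding h_def power2_eq_square power4_eq_xxxx by algebra
    have "(\<integral>y. (y - bridge_mean (s / 2) (t / 2) (u / 2) (x, z))\<^sup>2 * bridge (s / 2) (t / 2) (u / 2) x z y \<partial>lborel)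
       = (r - q) * (q - p) * (h^4 + 2 * h\<^sup>2 * (x + z) + (z - x)\<^sup>2) / (h\<^sup>2 * (2 * h + 1))"
      using bridge_moments(4)[OF lt Y_pos[OF assms(1) elim(2)] Y_pos[OF assms(3) elim(2)]]
      unfolding x_def z_def p_def q_def r_def h_def .
    also have "\<dots> = (2 * (r - q)) * (2 * (q - p)) / (2 * h + 1)
         * (((z + r\<^sup>2) - (x + p\<^sup>2))\<^sup>2 / (2 * h)\<^sup>2 + (2 * r * (x + p\<^sup>2) - 2 * p * (z + r\<^sup>2)) / (2 * h))"
    proof -
      define X where "X = ((z + r\<^sup>2) - (x + p\<^sup>2))\<^sup>2"
      define V where "V = r * (x + p\<^sup>2) - p * (z + r\<^sup>2)"
      have V: "2 * r * (x + p\<^sup>2) - 2 * p * (z + r\<^sup>2) = 2 * V" by (simp add: V_def algebra_simps)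
      show ?thesis
        unfolding h4 V X_def[symmetric] V_def[symmetric] using h
        by (simp add: divide_simps power2_eq_square) (simp add: algebra_simps)
    qed
    finally show ?case
      unfolding elim(1) by (simp add: stu x_def z_def h_def power_mult_distrib right_diff_distrib)
  qed
qed

end

theorem proposition2p3:
  fixes A B C D :: complex
  assumes "0 < Re A" and "0 < Re B" and "0 < Re C" and "0 < Re D"
    and "(A \<in> \<real> \<and> B \<in> \<real>) \<or> A = cnj B"
    and "(C \<in> \<real> \<and> D \<in> \<real>) \<or> C = cnj D"
    and "Re A \<le> Re B" and "Re C \<le> Re D"
  shows
    "let T = {- Re C<..<Re A};
         T' = {- 2 * Re C<..<2 * Re A};
         M2 = (A + C) * (B + C) * (A + D) * (B + D)
              / ((A + B + C + D)\<^sup>2 * (A + B + C + D + 1));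
         \<beta> = (A * B - C * D) / (A + B + C + D)
     in
      (\<exists>(P :: (real \<Rightarrow> real) measure) Y. wilson_process A B C D P Y) \<and>
      M2 \<in> \<real> \<and> 0 < Re M2 \<and>
      (\<forall>(P :: 'w measure) Y. wilson_process A B C D P Y \<longrightarrow>
        (\<forall>t\<in>T. integrable P (Y t) \<and> integrable P (\<lambda>\<omega>. (Y t \<omega>)\<^sup>2)) \<and>
        of_real (\<integral>\<omega>. Y 0 \<omega> \<partial>P)
          = (A * B * C + A * B * D + A * C * D + B * C * D) / (A + B + C + D) \<and>
        (\<forall>t\<in>T. of_real (\<integral>\<omega>. Y t \<omega> \<partial>P)
          = of_real (\<integral>\<omega>. Y 0 \<omega> \<partial>P)
            + 2 * ((A * B - C * D) / (A + B + C + D)) * of_real t - (of_real t)\<^sup>2) \<and>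
        (\<forall>s\<in>T. \<forall>t\<in>T. s \<le> t \<longrightarrow>
          of_real (covariance P (Y s) (Y t))
          = M2 * (C + D + 2 * of_real s) * (A + B - 2 * of_real t)) \<and>
        (let Z = (\<lambda>t \<omega>. Y (t / 2) \<omega> + t\<^sup>2 / 4) in
          (\<forall>t\<in>T'. of_real (\<integral>\<omega>. Z t \<omega> \<partial>P)
            = of_real (\<integral>\<omega>. Y 0 \<omega> \<partial>P) + \<beta> * of_real t) \<and>
          (\<forall>s\<in>T'. \<forall>t\<in>T'. s \<le> t \<longrightarrow>
            of_real (covariance P (Z s) (Z t))
              = M2 * (C + D + of_real s) * (A + B - of_real t) \<and>
            (AE \<omega> in P. of_real (real_cond_exp P (sigma_of P (Z s)) (Z t) \<omega>)
              = (A + B - of_real t) / (A + B - of_real s) * of_real (Z s \<omega>)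
                + A * B * of_real (t - s) / (A + B - of_real s)) \<and>
            (AE \<omega> in P. of_real (real_cond_var P (sigma_of P (Z s)) (Z t) \<omega>)
              = (A + B - of_real t) * of_real (t - s)
                * (A\<^sup>2 - of_real s * A + of_real (Z s \<omega>))
                * (B\<^sup>2 - of_real s * B + of_real (Z s \<omega>))
                / ((A + B - of_real s)\<^sup>2 * (A + B - of_real s + 1)))) \<and>
          (\<forall>s\<in>T'. \<forall>t\<in>T'. \<forall>u\<in>T'. s < t \<and> t < u \<longrightarrow>
            (AE \<omega> in P. real_cond_exp P (sigma_of P (\<lambda>\<xi>. (Z s \<xi>, Z u \<xi>))) (Z t) \<omega>
              = ((u - t) * Z s \<omega> + (t - s) * Z u \<omega>) / (u - s)) \<and>
            (AE \<omega> in P. real_cond_var P (sigma_of P (\<lambda>\<xi>. (Z s \<xi>, Z u \<xi>))) (Z t) \<omega>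
              = (u - t) * (t - s) / (u - s + 1)
                * ((Z u \<omega> - Z s \<omega>)\<^sup>2 / (u - s)\<^sup>2
                   + (u * Z s \<omega> - s * Z u \<omega>) / (u - s))))))"
proof -
  interpret W: wilson_process_data A B C D
    using assms by unfold_locales (simp_all add: real_or_conj_def)
  have T: "{- Re C<..<Re A} = W.T" by (simp add: W.T_def)
  have T': "t / 2 \<in> W.T" if "t \<in> {- 2 * Re C<..<2 * Re A}" for t
    using that by (simp add: W.T_def)
  have "wilson_markov A B C D P Y" if "wilson_process A B C D P Y" for P :: "'v measure" and Y
    by unfold_locales (rule that)
  note markov = this
  obtain P0 :: "(real \<Rightarrow> real) measure" and Y0 where ex: "wilson_process A B C D P0 Y0"
    using W.ex_wilson_process by blast
  interpret M0: wilson_markov A B C D P0 Y0 by (rule markov[OF ex])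
  show ?thesis
    unfolding Let_def T M0.M2_def[symmetric]
  proof (intro conjI allI impI ballI)
    show "\<exists>(P :: (real \<Rightarrow> real) measure) Y. wilson_process A B C D P Y" by (rule W.ex_wilson_process)
    show "M0.M2 \<in> \<real>" "0 < Re M0.M2" by (rule M0.M2_real_pos)+
    fix P :: "'w measure" and Y assume "wilson_process A B C D P Y"
    then interpret M: wilson_markov A B C D P Y by (rule markov)
    show "integrable P (Y t)" "integrable P (\<lambda>\<omega>. (Y t \<omega>)\<^sup>2)" if "t \<in> W.T" for t
      using M.marg_moments(1,2)[OF that] .
    show mean0: "of_real (\<integral>\<omega>. Y 0 \<omega> \<partial>P) = (A * B * C + A * B * D + A * C * D + B * C * D) / (A + B + C + D)"
      using M.marg_moments(3)[OF W.zero_in_T] by simp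
    show "of_real (\<integral>\<omega>. Y t \<omega> \<partial>P) = of_real (\<integral>\<omega>. Y 0 \<omega> \<partial>P)
            + 2 * ((A * B - C * D) / (A + B + C + D)) * of_real t - (of_real t)\<^sup>2" if "t \<in> W.T" for t
      unfolding mean0 by (rule M.marg_moments(3)[OF that])
    show "of_real (covariance P (Y s) (Y t)) = M0.M2 * (C + D + 2 * of_real s) * (A + B - 2 * of_real t)"
      if "s \<in> W.T" "t \<in> W.T" "s \<le> t" for s t
      by (rule M.covariance_Y[OF that])
    show "of_real (\<integral>\<omega>. Y (t / 2) \<omega> + t\<^sup>2 / 4 \<partial>P)
        = of_real (\<integral>\<omega>. Y 0 \<omega> \<partial>P) + (A * B - C * D) / (A + B + C + D) * of_real t"
      if "t \<in> {- 2 * Re C<..<2 * Re A}" for t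
      by (rule M.mean_Z[OF T'[OF that]])
    fix s t assume s: "s \<in> {- 2 * Re C<..<2 * Re A}" and t: "t \<in> {- 2 * Re C<..<2 * Re A}"
    show "of_real (covariance P (M.Z s) (M.Z t)) = M0.M2 * (C + D + of_real s) * (A + B - of_real t)" if "s \<le> t"
      by (rule M.covariance_Z[OF T'[OF s] T'[OF t] that])
    show "AE \<omega> in P. of_real (real_cond_exp P (sigma_of P (M.Z s)) (M.Z t) \<omega>)
              = (A + B - of_real t) / (A + B - of_real s) * of_real (M.Z s \<omega>)
                + A * B * of_real (t - s) / (A + B - of_real s)" if "s \<le> t"
      by (rule M.cond_exp_Z[OF T'[OF s] T'[OF t] that])
    show "AE \<omega> in P. of_real (real_cond_var P (sigma_of P (M.Z s)) (M.Z t) \<omega>)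
              = (A + B - of_real t) * of_real (t - s)
                * (A\<^sup>2 - of_real s * A + of_real (M.Z s \<omega>))
                * (B\<^sup>2 - of_real s * B + of_real (M.Z s \<omega>))
                / ((A + B - of_real s)\<^sup>2 * (A + B - of_real s + 1))" if "s \<le> t"
      by (rule M.cond_var_Z[OF T'[OF s] T'[OF t] that])
    fix u assume u: "u \<in> {- 2 * Re C<..<2 * Re A}" and lt: "s < t \<and> t < u"
    show "AE \<omega> in P. real_cond_exp P (sigma_of P (\<lambda>\<xi>. (M.Z s \<xi>, M.Z u \<xi>))) (M.Z t) \<omega>
              = ((u - t) * M.Z s \<omega> + (t - s) * M.Z u \<omega>) / (u - s)"
      using M.cond_exp_Z_bridge[OF T'[OF s] T'[OF t] T'[OF u]] lt by blast
    show "AE \<omega> in P. real_cond_var P (sigma_of P (\<lambda>\<xi>. (M.Z s \<xi>, M.Z u \<xi>))) (M.Z t) \<omega>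
              = (u - t) * (t - s) / (u - s + 1)
                * ((M.Z u \<omega> - M.Z s \<omega>)\<^sup>2 / (u - s)\<^sup>2
                   + (u * M.Z s \<omega> - s * M.Z u \<omega>) / (u - s))"
      using M.cond_var_Z_bridge[OF T'[OF s] T'[OF t] T'[OF u]] lt by blast
  qed
qed

end
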